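(* Let $P$ be a probability measure on $\Omega_{\mathbb Z}$ such that, for some positive integers $L,R$: (i) the transition vectors $\{\omega^x\}_{x\in\mathbb Z}$ are i.i.d. under $P$; (ii) for $P$-a.e. environment $\omega$, the Markov chain induced by $P_\omega^0$ is irreducible on $\mathbb Z$; (iii) for $P$-a.e. $\omega$, $\omega(a,b)=0$ whenever $b\notin[a-L,a+R]$; (iv) for $P$-a.e. $\omega$, $\lim_{n\to\infty}X_n=\infty$, $P_\omega^0$-a.s. Then $v>0$ if and only if $\mathbb E^0[N_0]=E[E_\omega^0[N_0]]<\infty$.
   Context: An environment on $\mathbb Z$ is a function $\omega:\mathbb Z\times\mathbb Z\to[0,1]$ with $\sum_y\omega(x,y)=1$ for all $x$; $\Omega_{\mathbb Z}$ is the space of environments (a product of spaces of probability measures on $\mathbb Z$, with its Borel sigma-field). For $x\in\mathbb Z$, $\omega^x$ is the probability measure $y\mapsto\omega(x,x+y)$ on $\mathbb Z$. $P_\omega^x$ (expectation $E_\omega^x$) is the law of the Markov chain $(X_n)_{n\ge0}$ with $X_0=x$ and transition probabilities $\omega$. The annealed law is $\mathbb P^x(\cdot)=E[P_\omega^x(\cdot)]$, with $E$ expectation under $P$, and $\mathbb E^x$ is the corresponding expectation. Under (i)-(iv) there is a deterministic $v$ with $\lim_{n\to\infty}X_n/n=v$, $\mathbb P^0$-a.s.; $v$ denotes this limiting velocity. $N_0=\#\{n\ge0:X_n=0\}$. *)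

theory Defs
  imports "HOL-Probability.Probability"
begin

type_synonym env = "int \<Rightarrow> int \<Rightarrow> real"

definition environments :: "env set" where
  "environments = {\<omega>. \<forall>x. (\<forall>y. \<omega> x y \<in> {0..1}) \<and> (\<omega> x has_sum 1) UNIV}"

text \<open>On probability vectors over a countable discrete set the weak topology is the topology of
  pointwise convergence, so the product of these spaces is the subspace of the function space
  \<^typ>\<open>env\<close> (with its product topology) carried by the environments.\<close>

definition env_space :: "env measure" where
  "env_space = restrict_space borel environments"

definition jump_law :: "env \<Rightarrow> int \<Rightarrow> int \<Rightarrow> real" where
  "jump_law \<omega> x = (\<lambda>y. \<omega> x (x + y))"

abbreviation path_space :: "(nat \<Rightarrow> int) measure" where
  "path_space \<equiv> Pi\<^sub>M UNIV (\<lambda>_. count_space UNIV)"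

text \<open>The kernel giving the conditional law of the state at time \<open>n\<close>, given the history
  \<open>h\<close> of the states at the times before \<open>n\<close>.\<close>

definition chain_kernel :: "env \<Rightarrow> int \<Rightarrow> nat \<Rightarrow> (nat \<Rightarrow> int) \<Rightarrow> int measure" where
  "chain_kernel \<omega> x n h =
     (if n = 0 then return (count_space UNIV) x
      else point_measure UNIV (\<lambda>y. ennreal (\<omega> (h (n - 1)) y)))"

text \<open>The Ionescu-Tulcea measure of these kernels; it is meaningful for \<open>\<omega> \<in> environments\<close>,
  where \<open>emeasure_path_law\<close> below identifies it through its cylinder probabilities.\<close>

definition path_law :: "env \<Rightarrow> int \<Rightarrow> (nat \<Rightarrow> int) measure" where
  "path_law \<omega> x = projective_family.lim UNIV
     (Ionescu_Tulcea.CI (chain_kernel \<omega> x) (\<lambda>_. count_space UNIV)) (\<lambda>_. count_space UNIV)"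

definition annealed_law :: "env measure \<Rightarrow> int \<Rightarrow> (nat \<Rightarrow> int) measure" where
  "annealed_law P x = P \<bind> (\<lambda>\<omega>. path_law \<omega> x)"

definition irreducible_chain :: "env \<Rightarrow> bool" where
  "irreducible_chain \<omega> \<longleftrightarrow> (\<forall>x y. \<exists>n. measure (path_law \<omega> x) {X. X n = y} > 0)"

definition limiting_velocity :: "env measure \<Rightarrow> real \<Rightarrow> bool" where
  "limiting_velocity P v \<longleftrightarrow>
     (AE X in annealed_law P 0. (\<lambda>n. real_of_int (X n) / real n) \<longlonglongrightarrow> v)"

definition visits0 :: "(nat \<Rightarrow> int) \<Rightarrow> ennreal" where
  "visits0 X = emeasure (count_space UNIV) {n. X n = 0}"

lemma prob_space_chain_kernel:
  assumes "\<omega> \<in> environments"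
  shows "prob_space (chain_kernel \<omega> x n h)"
proof (cases "n = 0")
  case False
  let ?p = "\<omega> (h (n - 1))"
  have p: "\<And>y. ?p y \<ge> 0" "(?p has_sum 1) UNIV"
    using assms by (auto simp: environments_def)
  have abs: "Infinite_Set_Sum.abs_summable_on ?p UNIV"
    using p(1) has_sum_imp_summable[OF p(2)] unfolding abs_summable_equivalent[symmetric]
    by simp
  have "(\<integral>\<^sup>+ y. ennreal (?p y) \<partial>count_space UNIV) = ennreal (\<Sum>\<^sub>\<infinity>y. ?p y)"
    using p(1) abs by (subst nn_integral_conv_infsetsum) (auto simp: infsetsum_infsum)
  also have "\<dots> = 1"
    using infsumI[OF p(2)] by simp
  finally show ?thesis
    using False
    by (intro prob_spaceI) (simp add: chain_kernel_def point_measure_def emeasure_density)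
qed (auto simp: chain_kernel_def intro: prob_space_return)

lemma sets_chain_kernel [simp]: "sets (chain_kernel \<omega> x n h) = UNIV"
  by (simp add: chain_kernel_def sets_point_measure)

lemma space_chain_kernel [simp]: "space (chain_kernel \<omega> x n h) = UNIV"
  by (simp add: chain_kernel_def space_point_measure)

lemma Ionescu_Tulcea_chain_kernel:
  assumes "\<omega> \<in> environments"
  shows "Ionescu_Tulcea (chain_kernel \<omega> x) (\<lambda>_. count_space UNIV)"
proof (rule Ionescu_Tulcea.intro)
  fix i :: nat
  show "chain_kernel \<omega> x i
    \<in> Pi\<^sub>M {0..<i} (\<lambda>_. count_space UNIV) \<rightarrow>\<^sub>M subprob_algebra (count_space UNIV)"
  proof (cases "i = 0")
    case True
    then show ?thesis
      using prob_space_chain_kernel[OF assms, of x 0]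
      by (intro measurable_subprob_algebra)
        (auto intro: prob_space_imp_subprob_space simp: chain_kernel_def)
  next
    case False
    have "chain_kernel \<omega> x i = (\<lambda>s. chain_kernel \<omega> x i (\<lambda>_. s)) \<circ> (\<lambda>h. h (i - 1))"
      using False by (auto simp: chain_kernel_def)
    moreover have "(\<lambda>h. h (i - 1)) \<in> Pi\<^sub>M {0..<i} (\<lambda>_. count_space UNIV) \<rightarrow>\<^sub>M
        (count_space UNIV :: int measure)"
      using False by (intro measurable_component_singleton) auto
    moreover have "(\<lambda>s. chain_kernel \<omega> x i (\<lambda>_. s)) \<in> count_space UNIV \<rightarrow>\<^sub>M
        subprob_algebra (count_space UNIV)"
      using prob_space_chain_kernel[OF assms]
      by (auto simp: space_subprob_algebra intro: prob_space_imp_subprob_space)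
    ultimately show ?thesis
      by (metis measurable_comp)
  qed
qed (rule prob_space_chain_kernel[OF assms])

lemma
  assumes "\<omega> \<in> environments"
  shows prob_space_path_law: "prob_space (path_law \<omega> x)"
    and sets_path_law: "sets (path_law \<omega> x) = sets path_space"
    and emeasure_path_law: "emeasure (path_law \<omega> x) {X. \<forall>i\<le>n. X i = a i} =
      (if a 0 = x then \<Prod>i<n. ennreal (\<omega> (a i) (a (Suc i))) else 0)"
proof -
  interpret I: Ionescu_Tulcea "chain_kernel \<omega> x" "\<lambda>_. count_space UNIV"
    by (rule Ionescu_Tulcea_chain_kernel[OF assms])
  let ?M = "\<lambda>_::nat. count_space (UNIV :: int set)"
  let ?S = "\<lambda>n. {restrict a {0..<n}}"
  show "sets (path_law \<omega> x) = sets path_space"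
    by (simp add: path_law_def)
  show "prob_space (path_law \<omega> x)"
    unfolding path_law_def
  proof
    have "emeasure I.PF.lim (I.PF.emb UNIV {} (space (Pi\<^sub>M {} ?M))) = emeasure (I.CI {}) (space (Pi\<^sub>M {} ?M))"
      by (rule I.lim) auto
    moreover have "emeasure (I.CI {}) (space (Pi\<^sub>M {} ?M)) = 1"
      using prob_space.emeasure_space_1[OF I.PF.prob_space_P[of "{}"]] by (simp add: I.CI_def)
    moreover have "I.PF.emb UNIV {} (space (Pi\<^sub>M {} ?M)) = space I.PF.lim"
      by (auto simp: prod_emb_def space_PiM restrict_def)
    ultimately show "emeasure I.PF.lim (space I.PF.lim) = 1"
      by simp
  qed
  have S [measurable]: "?S k \<in> sets (Pi\<^sub>M {0..<k} ?M)" for k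
  proof -
    have "?S k = Pi\<^sub>E {0..<k} (\<lambda>i. {a i})"
      by (auto simp: PiE_iff extensional_def fun_eq_iff)
    then show ?thesis
      by (auto intro!: sets_PiM_I_finite)
  qed
  have C: "emeasure (I.C 0 (Suc n) (\<lambda>_. undefined)) (?S (Suc n)) =
      (if a 0 = x then \<Prod>i<n. ennreal (\<omega> (a i) (a (Suc i))) else 0)" for n
  proof (induction n)
    have eP: "emeasure (I.eP k h) (?S (Suc k)) =
        emeasure (chain_kernel \<omega> x k (restrict a {0..<k})) {a k} * indicator (?S k) h"
      if h: "h \<in> space (Pi\<^sub>M {0..<k} ?M)" for k h
    proof -
      have "(\<lambda>y. h(k := y)) -` ?S (Suc k) = (if h \<in> ?S k then {a k} else {})"
      proof -
        have "h(k := y) = restrict a {0..<Suc k} \<longleftrightarrow> h = restrict a {0..<k} \<and> y = a k" for y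
        proof
          assume eq: "h(k := y) = restrict a {0..<Suc k}"
          have "h i = restrict a {0..<k} i" for i
            using fun_cong[OF eq, of i] h
            by (cases "i = k") (auto simp: space_PiM PiE_iff extensional_def split: if_splits)
          moreover have "y = a k"
            using fun_cong[OF eq, of k] by simp
          ultimately show "h = restrict a {0..<k} \<and> y = a k"
            by auto
        qed (auto simp: fun_eq_iff)
        then show ?thesis
          by (simp add: vimage_def)
      qed
      then show ?thesis
        using h S[of "Suc k"] by (subst I.emeasure_eP) auto
    qed
    {
      fix k
      have "emeasure (I.C 0 (Suc k) (\<lambda>_. undefined)) (?S (Suc k)) =
          (\<integral>\<^sup>+ h. emeasure (I.eP k h) (?S (Suc k)) \<partial>I.C 0 k (\<lambda>_. undefined))"
        using I.measurable_eP[of k] I.space_C[of "\<lambda>_. undefined" 0 k]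
          I.sets_C[of "\<lambda>_. undefined" 0 k] S[of "Suc k"]
        by (simp, subst emeasure_bind[where N = "Pi\<^sub>M {0..<Suc k} ?M"])
          (auto cong: measurable_cong_sets simp: space_PiM PiE_iff)
      also have "\<dots> = (\<integral>\<^sup>+ h. emeasure (chain_kernel \<omega> x k (restrict a {0..<k})) {a k} *
          indicator (?S k) h \<partial>I.C 0 k (\<lambda>_. undefined))"
        using I.space_C[of "\<lambda>_. undefined" 0 k] by (intro nn_integral_cong eP) simp
      also have "\<dots> = emeasure (chain_kernel \<omega> x k (restrict a {0..<k})) {a k} *
          emeasure (I.C 0 k (\<lambda>_. undefined)) (?S k)"
        using I.sets_C[of "\<lambda>_. undefined" 0 k] S[of k]
        by (subst nn_integral_cmult_indicator) auto
      finally have "emeasure (I.C 0 (Suc k) (\<lambda>_. undefined)) (?S (Suc k)) = \<dots>" .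
    }
    note step = this
    {
      case 0
      have "emeasure (I.C 0 0 (\<lambda>_. undefined)) (?S 0) = 1"
        using S[of 0] by (simp add: restrict_def)
      moreover have "emeasure (chain_kernel \<omega> x 0 (restrict a {0..<0})) {a 0} = indicator {a 0} x"
        by (simp add: chain_kernel_def)
      ultimately show ?case
        unfolding step by (simp del: I.C.simps)
    next
      case (Suc n)
      have "emeasure (chain_kernel \<omega> x (Suc n) (restrict a {0..<Suc n})) {a (Suc n)} =
          ennreal (\<omega> (a n) (a (Suc n)))"
        by (simp add: chain_kernel_def emeasure_point_measure_finite2)
      then show ?case
        unfolding step[of "Suc n"] Suc by (simp add: mult.commute del: I.C.simps)
    }
  qed
  have "{X. \<forall>i\<le>n. X i = a i} = I.PF.emb UNIV {0..<Suc n} (?S (Suc n))"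
    by (auto simp: prod_emb_def space_PiM fun_eq_iff less_Suc_eq_le restrict_def) metis
  then show "emeasure (path_law \<omega> x) {X. \<forall>i\<le>n. X i = a i} =
      (if a 0 = x then \<Prod>i<n. ennreal (\<omega> (a i) (a (Suc i))) else 0)"
    unfolding path_law_def using I.lim[of "{0..<Suc n}" "?S (Suc n)"] S[of "Suc n"]
      I.emeasure_CI[of "{0..<Suc n}" "Suc n" "?S (Suc n)"] C[of n]
    by (simp add: prod_emb_id sets.sets_into_space del: I.C.simps)
qed

lemma path_law_measurable: "(\<lambda>\<omega>. path_law \<omega> x) \<in> env_space \<rightarrow>\<^sub>M prob_algebra path_space"
proof -
  let ?cyl = "\<lambda>n a. {X :: nat \<Rightarrow> int. \<forall>i\<le>n. X i = a i}"
  let ?G = "insert {} {?cyl n a | n a. True}"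
  have "(\<lambda>X. X i) -` B \<in> sigma_sets UNIV ?G" for i B
  proof -
    have "(\<lambda>X. X i) -` B =
        (\<Union>l\<in>{l. length l = Suc i \<and> l ! i \<in> B}. ?cyl i (\<lambda>j. l ! j))" (is "_ = ?U")
    proof (intro equalityI subsetI)
      fix X :: "nat \<Rightarrow> int" assume "X \<in> (\<lambda>X. X i) -` B"
      then show "X \<in> ?U"
        by (intro UN_I[of "map X [0..<Suc i]"]) (auto simp: nth_append le_less simp del: upt_Suc)
    qed auto
    also have "?U \<in> sigma_sets UNIV ?G"
      by (intro sigma_sets_UNION) auto
    finally show ?thesis .
  qed
  then have "sets path_space \<subseteq> sigma_sets UNIV ?G"
    unfolding sets_PiM_single space_count_space PiE_UNIV_domain Pi_UNIV
    by (intro sigma_sets_mono) (auto simp: vimage_def)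
  moreover have cyl: "?cyl n a \<in> sets path_space" for n a
  proof -
    have "Measurable.pred path_space (\<lambda>X. \<forall>i\<in>{..n}. X i = a i)"
      by measurable
    then show ?thesis
      by (simp add: pred_def space_PiM Ball_def)
  qed
  then have "sigma_sets UNIV ?G \<subseteq> sets path_space"
    using sets.sigma_sets_subset[of ?G path_space] by (auto simp: space_PiM)
  ultimately have eq: "sets path_space = sigma_sets UNIV ?G"
    by blast
  have stable: "Int_stable ?G"
  proof -
    have "?cyl n a \<inter> ?cyl m b \<in> ?G" for n m a b
    proof (cases "\<exists>X. X \<in> ?cyl n a \<inter> ?cyl m b")
      case True
      then obtain X where "\<forall>i\<le>n. X i = a i" "\<forall>i\<le>m. X i = b i"
        by auto
      then have "?cyl n a \<inter> ?cyl m b = ?cyl (max n m) X"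
        by (auto simp: le_max_iff_disj)
      then show ?thesis
        by blast
    qed auto
    then show ?thesis
      by (intro Int_stableI) (elim insertE CollectE exE conjE; simp)
  qed
  have space: "space env_space = environments"
    by (simp add: env_space_def space_restrict_space)
  have coord: "(\<lambda>\<omega>. \<omega> a b) \<in> borel_measurable env_space" for a b
    unfolding env_space_def
    using measurable_product_then_coordinatewise[OF
        measurable_product_then_coordinatewise[OF measurable_ident[of borel]]]
    by (intro measurable_restrict_space1) (simp add: id_def)
  show ?thesis
  proof (rule measurable_prob_algebra_generated[OF eq stable])
    fix A assume "A \<in> ?G"
    then consider "A = {}" | n a where "A = ?cyl n a"
      by blast
    then show "(\<lambda>\<omega>. emeasure (path_law \<omega> x) A) \<in> borel_measurable env_space"
    proof cases
      case 2
      then show ?thesis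
        using coord emeasure_path_law[of _ x n a]
        by (subst measurable_cong[where g = "\<lambda>\<omega>. if a 0 = x then \<Prod>i<n. ennreal (\<omega> (a i) (a (Suc i))) else 0"])
          (auto simp: space)
    qed simp
  qed (auto simp: space prob_space_path_law sets_path_law)
qed

lemma emeasure_annealed_law:
  assumes "prob_space P" "sets P = sets env_space" "A \<in> sets path_space"
  shows "emeasure (annealed_law P x) A = (\<integral>\<^sup>+ \<omega>. emeasure (path_law \<omega> x) A \<partial>P)"
proof -
  have "(\<lambda>\<omega>. path_law \<omega> x) \<in> P \<rightarrow>\<^sub>M subprob_algebra path_space"
    using measurable_prob_algebraD[OF path_law_measurable]
    by (simp cong: measurable_cong_sets add: assms(2))
  then show ?thesis
    unfolding annealed_law_def
    using assms prob_space.not_empty[OF assms(1)] by (intro emeasure_bind)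
qed

end

theory Submission
  imports Defs
begin

text \<open>
  Let \<open>G\<close> be the quenched expected number of visits to \<open>0\<close>. If \<open>E[G] < \<infinity>\<close>, then by stationarity the
  expected number of visits to every site is at most \<open>E[G]\<close>, so that the walk cannot spend a time of
  order \<open>n\<close> in an interval of length \<open>\<epsilon> n\<close> for small \<open>\<epsilon>\<close>; hence \<open>v > 0\<close>.

  Let now \<open>v > 0\<close>. Counting the time spent in \<open>{1..n}\<close> shows that \<open>E[F\<^sub>n G]\<close> remains bounded, where
  \<open>F\<^sub>n\<close> is the probability of hitting \<open>0\<close>, averaged over the starting points \<open>- 1, \<dots>, - n\<close>. It remains
  to bound \<open>E[G]\<close> by \<open>E[F\<^sub>n G]\<close>. Explore the environment from \<open>0\<close> to the left and let \<open>g\<^sub>k\<close> be the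
  expected number of visits to \<open>0\<close> before going below \<open>- k\<close>. Call \<open>k\<close> bad if the conditional
  expectation of \<open>F\<^sub>n\<close> given the environment on \<open>{- k..}\<close> is less than \<open>\<delta>\<close> (and a further probability,
  controlled by \<open>F\<^sub>n\<close>, is small). The environment to the left of \<open>- k\<close> is independent of the explored
  part and lets the walk from the left reach the sites just below the explored part. Hence at a bad
  level \<open>g\<close> grows by a factor close to \<open>1\<close> only, and a return to \<open>0\<close> from the left of \<open>- k - m\<close> is so
  unlikely that \<open>G \<le> 2 g\<^bsub>k + m\<^esub>\<close> up to an event of small conditional probability. Therefore \<open>G\<close>
  rarely grows from \<open>t\<close> to \<open>4 t\<close> through bad levels alone, which gives
  \<open>P(G > 4 t) \<le> C E[F\<^sub>n; G > t] + P(G > t) / 8\<close>. Integrating over \<open>t\<close> yields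
  \<open>E[G] \<le> 8 C E[F\<^sub>n G]\<close>.
\<close>

section \<open>Taboo probabilities and Green functions\<close>

text \<open>\<open>F\<^sub>n\<close> and \<open>G\<close> depend on the same environment, so a bound
  on \<open>E[F\<^sub>n G]\<close> does not by itself bound \<open>E[G]\<close>: the exploration has
  to show that \<open>F\<^sub>n\<close> keeps a conditional mean of order \<delta> on most of the
  event that \<open>G\<close> is large. Jumps longer than 1 are the obstacle. The walk can pass a
  site without visiting it, and the sites where it enters from the left differ from those where it
  lands when leaving to the left. A gap of \<open>m\<close> levels connects the two; irreducibility
  is only qualitative, so \<open>m\<close> is chosen to make this succeed outside an event of
  probability 1/16. The factor 4 is 2 from at most \<open>m + 1\<close> bad steps
  (\<open>c ^ Suc m \<le> 2\<close>) times 2 from returns from beyond the gap. In the integrated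
  tail bound \<open>E[G] / 8\<close> is absorbed into \<open>E[G] / 4\<close>, which presupposes a
  finite mean, the very claim. Hence everything is done for a discounted walk killed below
  \<open>- N\<close>, with constants that depend on neither.\<close>

abbreviation zsum :: "(int \<Rightarrow> ennreal) \<Rightarrow> ennreal" where
  "zsum f \<equiv> \<integral>\<^sup>+ z. f z \<partial>count_space UNIV"

lemma zsum_add: "zsum (\<lambda>z. f z + g z) = zsum f + zsum g"
  by (rule nn_integral_add) auto

lemma zsum_cmult: "zsum (\<lambda>z. c * f z) = c * zsum f"
  by (rule nn_integral_cmult) auto

lemma zsum_multc: "zsum (\<lambda>z. f z * c) = zsum f * c"
  by (rule nn_integral_multc) auto

lemma zsum_swap: "zsum (\<lambda>x. zsum (\<lambda>y. f x y)) = zsum (\<lambda>y. zsum (\<lambda>x. f x y))"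
  using nn_integral_fst_count_space[of "\<lambda>(x, y). f x y"]
    nn_integral_snd_count_space[of "\<lambda>(x, y). f x y"] by simp

lemma zsum_delta: "zsum (\<lambda>z. (if x = z then 1 else 0) * f z) = f x"
  by (subst nn_integral_count_space'[of "{x}"]) auto

lemma zsum_suminf: "zsum (\<lambda>z. \<Sum>n. f n z) = (\<Sum>n. zsum (f n))"
  by (rule nn_integral_suminf) auto

lemma suminf_shift_ennreal:
  fixes f :: "nat \<Rightarrow> ennreal"
  shows "(\<Sum>n. if h \<le> n then f (n - h) else 0) = (\<Sum>n. f n)"
proof -
  have b: "bij_betw (\<lambda>m. m + h) UNIV {h..}"
    by (rule bij_betwI[where g = "\<lambda>n. n - h"]) auto
  have "(\<Sum>n. if h \<le> n then f (n - h) else 0) =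
      (\<integral>\<^sup>+ n. f (n - h) * indicator {h..} n \<partial>count_space UNIV)"
    by (subst nn_integral_count_space_nat) (auto intro!: suminf_cong simp: indicator_def)
  also have "\<dots> = (\<integral>\<^sup>+ n. f (n - h) \<partial>count_space {h..})"
    by (rule nn_integral_count_space_indicator[symmetric]) simp
  also have "\<dots> = (\<integral>\<^sup>+ n. f n \<partial>count_space UNIV)"
    using nn_integral_bij_count_space[OF b, of "\<lambda>n. f (n - h)"] by simp
  finally show ?thesis
    by (simp add: nn_integral_count_space_nat)
qed

lemma suminf_swap_ennreal:
  fixes f :: "nat \<Rightarrow> nat \<Rightarrow> ennreal"
  shows "(\<Sum>n. \<Sum>h. f n h) = (\<Sum>h. \<Sum>n. f n h)"
  using nn_integral_fst_count_space[of "\<lambda>(x, y). f x y"]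
    nn_integral_snd_count_space[of "\<lambda>(x, y). f x y"]
  by (simp add: nn_integral_count_space_nat)

lemma suminf_convolution_ennreal:
  fixes f :: "nat \<Rightarrow> nat \<Rightarrow> ennreal"
  shows "(\<Sum>n. \<Sum>h\<le>n. f h (n - h)) = (\<Sum>h. \<Sum>m. f h m)"
proof -
  have "(\<Sum>n. \<Sum>h\<le>n. f h (n - h)) = (\<Sum>n. \<Sum>h. if h \<le> n then f h (n - h) else 0)"
  proof (rule suminf_cong)
    fix n
    show "(\<Sum>h\<le>n. f h (n - h)) = (\<Sum>h. if h \<le> n then f h (n - h) else 0)"
      by (subst suminf_finite[of "{..n}"]) auto
  qed
  also have "\<dots> = (\<Sum>h. \<Sum>n. if h \<le> n then f h (n - h) else 0)"
    by (rule suminf_swap_ennreal)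
  also have "\<dots> = (\<Sum>h. \<Sum>m. f h m)"
    by (simp add: suminf_shift_ennreal)
  finally show ?thesis .
qed

lemma suminf_add_ennreal:
  fixes f g :: "nat \<Rightarrow> ennreal"
  shows "(\<Sum>n. f n + g n) = (\<Sum>n. f n) + (\<Sum>n. g n)"
  by (rule suminf_add[symmetric]) auto

text \<open>The taboo probability of being in \<open>y\<close> at time \<open>n\<close> when all earlier states lie in \<open>D\<close>.
  Since \<open>y\<close> itself is unconstrained, the sum over \<open>n\<close> is the probability of hitting \<open>y\<close> through
  \<open>D\<close> if \<open>y \<notin> D\<close>, and the Green function of the walk killed outside \<open>D\<close> if \<open>y \<in> D\<close>.\<close>

primrec taboo :: "(int \<Rightarrow> int \<Rightarrow> ennreal) \<Rightarrow> int set \<Rightarrow> nat \<Rightarrow> int \<Rightarrow> int \<Rightarrow> ennreal" where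
  "taboo \<kappa> D 0 x y = (if x = y then 1 else 0)"
| "taboo \<kappa> D (Suc n) x y = zsum (\<lambda>w. taboo \<kappa> D n x w * indicator D w * \<kappa> w y)"

definition green :: "(int \<Rightarrow> int \<Rightarrow> ennreal) \<Rightarrow> int set \<Rightarrow> int \<Rightarrow> int \<Rightarrow> ennreal" where
  "green \<kappa> D x y = (\<Sum>n. taboo \<kappa> D n x y)"

definition substochastic :: "(int \<Rightarrow> int \<Rightarrow> ennreal) \<Rightarrow> bool" where
  "substochastic \<kappa> \<longleftrightarrow> (\<forall>x. zsum (\<kappa> x) \<le> 1)"

text \<open>First-exit decomposition: a path through \<open>D\<close> either is still inside
  \<open>E\<close> at time \<open>n\<close>, or has a first time \<open>h\<close> outside
  \<open>E\<close>, at \<open>z\<close>, from where it continues through \<open>D\<close>. The end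
  state may itself be the exit, hence the indicator in the first term and the range up to
  \<open>h = n\<close>. Induction appends one last step, so no path measure is involved.\<close>

lemma taboo_split:
  assumes "E \<subseteq> D"
  shows "taboo \<kappa> D n x y = indicator E y * taboo \<kappa> E n x y +
    (\<Sum>h\<le>n. zsum (\<lambda>z. indicator (- E) z * taboo \<kappa> E h x z * taboo \<kappa> D (n - h) z y))"
proof (induction n arbitrary: y)
  case 0
  have "zsum (\<lambda>z. indicator (- E) z * (if x = z then 1 else 0) * (if z = y then 1 else 0)) =
      (if x = y then indicator (- E) y else (0::ennreal))"
    using zsum_delta[of x "\<lambda>z. indicator (- E) z * (if z = y then 1 else 0)"]
    by (auto simp: mult_ac)
  then show ?case
    by (auto simp: indicator_def)
next
  case (Suc n)
  let ?c = "\<lambda>h z. indicator (- E) z * taboo \<kappa> E h x z :: ennreal"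
  have ED: "indicator E w * indicator D w = (indicator E w :: ennreal)" for w
    using assms by (auto simp: indicator_def)
  have "taboo \<kappa> D (Suc n) x y =
      zsum (\<lambda>w. taboo \<kappa> E n x w * indicator E w * \<kappa> w y +
        (\<Sum>h\<le>n. zsum (\<lambda>z. ?c h z * (taboo \<kappa> D (n - h) z w * indicator D w * \<kappa> w y))))"
    unfolding taboo.simps Suc.IH
  proof (intro nn_integral_cong)
    fix w
    let ?d = "indicator D w * \<kappa> w y"
    have "(\<Sum>h\<le>n. zsum (\<lambda>z. ?c h z * taboo \<kappa> D (n - h) z w)) * ?d =
        (\<Sum>h\<le>n. zsum (\<lambda>z. ?c h z * (taboo \<kappa> D (n - h) z w * ?d)))"
      by (simp only: sum_distrib_right mult.assoc zsum_multc[symmetric])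
    moreover have "indicator E w * taboo \<kappa> E n x w * ?d = taboo \<kappa> E n x w * indicator E w * \<kappa> w y"
      using ED[of w] by (metis mult.assoc mult.commute)
    ultimately show "(indicator E w * taboo \<kappa> E n x w +
        (\<Sum>h\<le>n. zsum (\<lambda>z. ?c h z * taboo \<kappa> D (n - h) z w))) * indicator D w * \<kappa> w y =
        taboo \<kappa> E n x w * indicator E w * \<kappa> w y +
        (\<Sum>h\<le>n. zsum (\<lambda>z. ?c h z * (taboo \<kappa> D (n - h) z w * indicator D w * \<kappa> w y)))"
      by (simp only: mult.assoc distrib_right)
  qed
  also have "\<dots> = taboo \<kappa> E (Suc n) x y +
      (\<Sum>h\<le>n. zsum (\<lambda>w. zsum (\<lambda>z. ?c h z * (taboo \<kappa> D (n - h) z w * indicator D w * \<kappa> w y))))"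
    by (subst zsum_add, subst nn_integral_sum) auto
  also have "(\<Sum>h\<le>n. zsum (\<lambda>w. zsum (\<lambda>z. ?c h z * (taboo \<kappa> D (n - h) z w * indicator D w * \<kappa> w y)))) =
      (\<Sum>h\<le>n. zsum (\<lambda>z. ?c h z * taboo \<kappa> D (Suc n - h) z y))"
    by (intro sum.cong refl, subst zsum_swap)
      (simp add: Suc_diff_le zsum_cmult)
  also have "taboo \<kappa> E (Suc n) x y = indicator E y * taboo \<kappa> E (Suc n) x y + ?c (Suc n) y"
    by (auto simp: indicator_def)
  also have "?c (Suc n) y = zsum (\<lambda>z. ?c (Suc n) z * taboo \<kappa> D (Suc n - Suc n) z y)"
    using zsum_delta[of y "\<lambda>z. ?c (Suc n) z"] by (simp add: mult_ac eq_commute[of y] del: taboo.simps(2))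
  finally show ?case
    by (simp add: add_ac del: taboo.simps(2))
qed

text \<open>Summed over \<open>n\<close>, the convolution in \<open>taboo_split\<close> becomes a
  product. This identity plays the part of the strong Markov property at the exit time of
  \<open>E\<close>.\<close>

lemma green_split:
  assumes "E \<subseteq> D"
  shows "green \<kappa> D x y = indicator E y * green \<kappa> E x y +
    zsum (\<lambda>z. indicator (- E) z * green \<kappa> E x z * green \<kappa> D z y)"
proof -
  have "green \<kappa> D x y = (\<Sum>n. indicator E y * taboo \<kappa> E n x y) +
      (\<Sum>n. \<Sum>h\<le>n. zsum (\<lambda>z. indicator (- E) z * taboo \<kappa> E h x z * taboo \<kappa> D (n - h) z y))"
    unfolding green_def suminf_add_ennreal[symmetric]
    by (rule suminf_cong, rule taboo_split[OF assms])
  also have "\<dots> = indicator E y * green \<kappa> E x y +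
      (\<Sum>h. \<Sum>m. zsum (\<lambda>z. indicator (- E) z * taboo \<kappa> E h x z * taboo \<kappa> D m z y))"
    by (simp add: suminf_convolution_ennreal[where f = "\<lambda>h m. zsum (\<lambda>z. indicator (- E) z * taboo \<kappa> E h x z * taboo \<kappa> D m z y)"] green_def)
  also have "(\<Sum>h. \<Sum>m. zsum (\<lambda>z. indicator (- E) z * taboo \<kappa> E h x z * taboo \<kappa> D m z y)) =
      zsum (\<lambda>z. \<Sum>h. \<Sum>m. indicator (- E) z * taboo \<kappa> E h x z * taboo \<kappa> D m z y)"
    by (simp only: zsum_suminf)
  also have "\<dots> = zsum (\<lambda>z. indicator (- E) z * green \<kappa> E x z * green \<kappa> D z y)"
    by (simp only: green_def ennreal_suminf_cmult ennreal_suminf_multc)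
  finally show ?thesis .
qed

text \<open>For \<open>n > 0\<close> the start is itself an earlier state and would have to lie in
  \<open>D\<close>, so only the term \<open>n = 0\<close> survives.\<close>

lemma green_outside:
  assumes "x \<notin> D"
  shows "green \<kappa> D x y = (if x = y then 1 else 0)"
proof -
  have "taboo \<kappa> D n x w = 0" if "n \<noteq> 0" for n w
    using that
  proof (induction n arbitrary: w)
    case (Suc n)
    show ?case
    proof (cases "n = 0")
      case True
      then show ?thesis
        using assms zsum_delta[of x "\<lambda>w'. indicator D w' * \<kappa> w' w"] by (simp add: mult_ac)
    next
      case False
      then show ?thesis
        using Suc by simp
    qed
  qed simp
  then have "green \<kappa> D x y = (\<Sum>n\<in>{0}. taboo \<kappa> D n x y)"
    unfolding green_def by (intro suminf_finite) auto
  then show ?thesis by simp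
qed

lemma green_mult_le:
  assumes "E \<subseteq> D" "z \<notin> E"
  shows "green \<kappa> E x z * green \<kappa> D z y \<le> green \<kappa> D x y"
proof -
  have "green \<kappa> E x z * green \<kappa> D z y = zsum (\<lambda>w. (if z = w then 1 else 0) * (green \<kappa> E x z * green \<kappa> D z y))"
    by (rule zsum_delta[symmetric])
  also have "\<dots> \<le> zsum (\<lambda>w. indicator (- E) w * green \<kappa> E x w * green \<kappa> D w y)"
    using assms by (intro nn_integral_mono) auto
  also have "\<dots> \<le> green \<kappa> D x y"
    unfolding green_split[OF assms(1), of \<kappa> x y] by simp
  finally show ?thesis .
qed

text \<open>Apply \<open>green_split\<close> to \<open>D - {y}\<close>: the walk leaves this set at
  \<open>y\<close> or outside \<open>D\<close>, and from outside \<open>D\<close> it never gets to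
  \<open>y\<close>.\<close>

lemma green_hit:
  assumes "y \<in> D"
  shows "green \<kappa> D x y = green \<kappa> (D - {y}) x y * green \<kappa> D y y"
proof -
  let ?E = "D - {y}"
  have "zsum (\<lambda>z. indicator (- ?E) z * green \<kappa> ?E x z * green \<kappa> D z y) =
      zsum (\<lambda>z. (if y = z then 1 else 0) * (green \<kappa> ?E x z * green \<kappa> D z y))"
    by (intro nn_integral_cong) (auto simp: indicator_def green_outside assms)
  also have "\<dots> = green \<kappa> ?E x y * green \<kappa> D y y"
    by (rule zsum_delta)
  finally show ?thesis
    using green_split[of ?E D \<kappa> x y] by auto
qed

section \<open>Comparison, translation and discounting of Green functions\<close>

lemma taboo_mono:
  assumes "D \<subseteq> D'" "\<And>u v. \<kappa> u v \<le> \<kappa>' u v"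
  shows "taboo \<kappa> D n x y \<le> taboo \<kappa>' D' n x y"
proof (induction n arbitrary: y)
  case (Suc n)
  have "indicator D w \<le> (indicator D' w :: ennreal)" for w
    using assms(1) by (auto simp: indicator_def)
  then show ?case
    by (auto intro!: nn_integral_mono mult_mono Suc assms)
qed simp

lemma green_mono:
  assumes "D \<subseteq> D'" "\<And>u v. \<kappa> u v \<le> \<kappa>' u v"
  shows "green \<kappa> D x y \<le> green \<kappa>' D' x y"
  unfolding green_def by (intro suminf_le taboo_mono assms) auto

lemma zsum_shift: "zsum (\<lambda>z. f (z + a)) = zsum f"
proof -
  have "bij_betw (\<lambda>z::int. z + a) UNIV UNIV"
    by (rule bij_betwI[where g = "\<lambda>n. n - a"]) auto
  then show ?thesis
    by (rule nn_integral_bij_count_space)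
qed

lemma taboo_shift:
  "taboo (\<lambda>u v. \<kappa> (u + a) (v + a)) {d. d + a \<in> D} n x y = taboo \<kappa> D n (x + a) (y + a)"
proof (induction n arbitrary: y)
  case (Suc n)
  have "indicator {d. d + a \<in> D} w = (indicator D (w + a) :: ennreal)" for w
    by (auto simp: indicator_def)
  then show ?case
    using zsum_shift[of "\<lambda>w. taboo \<kappa> D n (x + a) w * indicator D w * \<kappa> w (y + a)" a]
    by (simp add: Suc)
qed simp

lemma green_shift:
  "green (\<lambda>u v. \<kappa> (u + a) (v + a)) {d. d + a \<in> D} x y = green \<kappa> D (x + a) (y + a)"
  unfolding green_def taboo_shift ..

lemma taboo_scale: "taboo (\<lambda>u v. s * \<kappa> u v) D n x y = s ^ n * taboo \<kappa> D n x y"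
proof (induction n arbitrary: y)
  case (Suc n)
  then show ?case
    by (simp add: mult_ac flip: zsum_cmult)
qed simp

text \<open>Mass balance of the walk stopped on leaving \<open>E\<close>: what left before time
  \<open>n\<close> plus what is present at time \<open>n\<close>, whether inside \<open>E\<close> or
  just arrived outside, never grows.\<close>

lemma zsum_taboo_le_1:
  assumes "substochastic \<kappa>"
  shows "(\<Sum>k<n. zsum (\<lambda>z. indicator (- E) z * taboo \<kappa> E k x z)) + zsum (taboo \<kappa> E n x) \<le> 1"
proof (induction n)
  case 0
  show ?case
    using zsum_delta[of x "\<lambda>_. 1"] by simp
next
  case (Suc n)
  have "zsum (taboo \<kappa> E (Suc n) x) = zsum (\<lambda>w. taboo \<kappa> E n x w * indicator E w * zsum (\<kappa> w))"
    unfolding taboo.simps by (subst zsum_swap) (simp add: zsum_cmult)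
  also have "\<dots> \<le> zsum (\<lambda>w. taboo \<kappa> E n x w * indicator E w * 1)"
    using assms by (intro nn_integral_mono mult_left_mono) (auto simp: substochastic_def)
  finally have "zsum (\<lambda>z. indicator (- E) z * taboo \<kappa> E n x z) + zsum (taboo \<kappa> E (Suc n) x) \<le>
      zsum (\<lambda>z. indicator (- E) z * taboo \<kappa> E n x z + taboo \<kappa> E n x z * indicator E z)"
    by (subst zsum_add) (auto intro: add_left_mono simp del: taboo.simps)
  also have "\<dots> = zsum (taboo \<kappa> E n x)"
    by (intro nn_integral_cong) (auto simp: indicator_def)
  finally show ?case
    using Suc by (simp add: add.assoc del: taboo.simps) (meson add_left_mono order_trans)
qed

lemma zsum_taboo_le:
  assumes "substochastic \<kappa>"
  shows "zsum (taboo \<kappa> E n x) \<le> 1"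
  using order_trans[OF _ zsum_taboo_le_1[OF assms, of E x n]] by simp

lemma taboo_le_1:
  assumes "substochastic \<kappa>"
  shows "taboo \<kappa> E n x y \<le> 1"
proof -
  have "taboo \<kappa> E n x y = zsum (\<lambda>z. (if y = z then 1 else 0) * taboo \<kappa> E n x z)"
    by (rule zsum_delta[symmetric])
  also have "\<dots> \<le> zsum (taboo \<kappa> E n x)"
    by (intro nn_integral_mono) auto
  also have "\<dots> \<le> 1"
    by (rule zsum_taboo_le[OF assms])
  finally show ?thesis .
qed

lemma zsum_green_exit_le_1:
  assumes "substochastic \<kappa>"
  shows "zsum (\<lambda>z. indicator (- E) z * green \<kappa> E x z) \<le> 1"
proof -
  have "zsum (\<lambda>z. indicator (- E) z * green \<kappa> E x z) =
      (\<Sum>n. zsum (\<lambda>z. indicator (- E) z * taboo \<kappa> E n x z))"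
    by (simp only: green_def zsum_suminf[symmetric] ennreal_suminf_cmult)
  also have "\<dots> \<le> 1"
    by (intro suminf_le_const order_trans[OF _ zsum_taboo_le_1[OF assms, of E x]])
      (auto intro: add_increasing2 simp del: taboo.simps)
  finally show ?thesis .
qed

lemma green_exit_le_1:
  assumes "substochastic \<kappa>" "y \<notin> E"
  shows "green \<kappa> E x y \<le> 1"
proof -
  have "green \<kappa> E x y = zsum (\<lambda>z. (if y = z then 1 else 0) * green \<kappa> E x z)"
    by (rule zsum_delta[symmetric])
  also have "\<dots> \<le> zsum (\<lambda>z. indicator (- E) z * green \<kappa> E x z)"
    using assms(2) by (intro nn_integral_mono) auto
  also have "\<dots> \<le> 1"
    by (rule zsum_green_exit_le_1[OF assms(1)])
  finally show ?thesis .
qed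

section \<open>Laws of the quenched walk\<close>

text \<open>Discounting by \<open>s < 1\<close> makes all Green functions finite; the discount is removed at the very
  end by monotone convergence.\<close>

lemma green_discount_le:
  assumes "substochastic \<kappa>" "0 \<le> s" "s < 1"
  shows "green (\<lambda>u v. ennreal s * \<kappa> u v) D x y \<le> ennreal (1 / (1 - s))"
proof -
  have "green (\<lambda>u v. ennreal s * \<kappa> u v) D x y = (\<Sum>n. ennreal s ^ n * taboo \<kappa> D n x y)"
    by (simp only: green_def taboo_scale)
  also have "\<dots> \<le> (\<Sum>n. ennreal (s ^ n))"
  proof (rule suminf_le)
    fix n
    have "ennreal s ^ n * taboo \<kappa> D n x y \<le> ennreal s ^ n * 1"
      by (intro mult_left_mono taboo_le_1 assms) auto
    then show "ennreal s ^ n * taboo \<kappa> D n x y \<le> ennreal (s ^ n)"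
      using assms(2) by (simp add: ennreal_power)
  qed auto
  also have "\<dots> = ennreal (1 / (1 - s))"
    using assms(2,3) by (subst suminf_ennreal2) (auto simp: suminf_geometric)
  finally show ?thesis .
qed

section \<open>Monotone limits in the discount and in the set of allowed sites\<close>

lemma incseq_discount: "incseq (\<lambda>m. ennreal (real m / real (Suc m)) ^ n)"
  by (intro monoI power_mono ennreal_leI) (auto simp: field_simps)

lemma SUP_discount: "(SUP m. ennreal (real m / real (Suc m)) ^ n) = 1"
proof -
  have "(\<lambda>m. real m / real (Suc m)) \<longlonglongrightarrow> 1"
    by (rule LIMSEQ_n_over_Suc_n)
  then have "(\<lambda>m. ennreal ((real m / real (Suc m)) ^ n)) \<longlonglongrightarrow> ennreal (1 ^ n)"
    by (intro tendsto_ennrealI tendsto_power)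
  then have "(\<lambda>m. ennreal (real m / real (Suc m)) ^ n) \<longlonglongrightarrow> 1"
    by (simp add: ennreal_power)
  then show ?thesis
    using LIMSEQ_SUP[OF incseq_discount[of n]] LIMSEQ_unique by blast
qed

lemma green_SUP_discount:
  "green \<kappa> D x y = (SUP m. green (\<lambda>u v. ennreal (real m / real (Suc m)) * \<kappa> u v) D x y)"
proof -
  have "(SUP m. green (\<lambda>u v. ennreal (real m / real (Suc m)) * \<kappa> u v) D x y) =
      (SUP m. \<Sum>n. ennreal (real m / real (Suc m)) ^ n * taboo \<kappa> D n x y)"
    by (simp only: green_def taboo_scale)
  also have "\<dots> = (\<Sum>n. SUP m. ennreal (real m / real (Suc m)) ^ n * taboo \<kappa> D n x y)"
    using incseq_discount
    by (intro ennreal_suminf_SUP_eq[symmetric]) (auto simp: mono_def intro: mult_right_mono)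
  also have "\<dots> = green \<kappa> D x y"
    by (simp only: SUP_mult_right_ennreal[symmetric] SUP_discount green_def mult_1)
  finally show ?thesis ..
qed

lemma taboo_SUP_sets:
  assumes "incseq D"
  shows "taboo \<kappa> (\<Union>m. D m) n x y = (SUP m. taboo \<kappa> (D m) n x y)"
proof (induction n arbitrary: y)
  case (Suc n)
  have le: "taboo \<kappa> (D i) n x w \<le> taboo \<kappa> (D j) n x w" if "i \<le> j" for i j w
    using that assms by (intro taboo_mono) (auto simp: mono_def)
  have ind: "indicator (D i) w \<le> (indicator (D j) w :: ennreal)" if "i \<le> j" for i j w
    using that assms by (auto simp: indicator_def mono_def)
  have "(SUP m. taboo \<kappa> (D m) n x w) * indicator (\<Union>m. D m) w * \<kappa> w y =
      (SUP m. taboo \<kappa> (D m) n x w * indicator (D m) w * \<kappa> w y)" for w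
  proof (cases "w \<in> (\<Union>m. D m)")
    case True
    then obtain k where k: "w \<in> D k" by auto
    show ?thesis
    proof (rule antisym)
      \<comment> \<open>Passing from \<open>m\<close> to \<open>max m k\<close> puts
        \<open>w\<close> into the set and only increases the taboo probability.\<close>
      have "taboo \<kappa> (D m) n x w * \<kappa> w y \<le>
          taboo \<kappa> (D (max m k)) n x w * indicator (D (max m k)) w * \<kappa> w y" for m
      proof -
        have "w \<in> D (max m k)"
          using k monoD[OF assms, of k "max m k"] by auto
        then show ?thesis
          using le[of m "max m k" w] by (auto intro: mult_right_mono)
      qed
      then have "(SUP m. taboo \<kappa> (D m) n x w * \<kappa> w y) \<le>
          (SUP m. taboo \<kappa> (D m) n x w * indicator (D m) w * \<kappa> w y)"
        by (intro SUP_mono) blast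
      then show "(SUP m. taboo \<kappa> (D m) n x w) * indicator (\<Union>m. D m) w * \<kappa> w y \<le>
          (SUP m. taboo \<kappa> (D m) n x w * indicator (D m) w * \<kappa> w y)"
        using True by (simp add: SUP_mult_right_ennreal)
      show "(SUP m. taboo \<kappa> (D m) n x w * indicator (D m) w * \<kappa> w y) \<le>
          (SUP m. taboo \<kappa> (D m) n x w) * indicator (\<Union>m. D m) w * \<kappa> w y"
        using True
        by (intro SUP_least mult_mono SUP_upper) (auto simp: indicator_def)
    qed
  qed (auto simp: indicator_def)
  then have "taboo \<kappa> (\<Union>m. D m) (Suc n) x y =
      zsum (\<lambda>w. SUP m. taboo \<kappa> (D m) n x w * indicator (D m) w * \<kappa> w y)"
    by (simp add: Suc)
  also have "\<dots> = (SUP m. taboo \<kappa> (D m) (Suc n) x y)"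
    unfolding taboo.simps
    by (intro nn_integral_monotone_convergence_SUP)
      (auto simp: mono_def le_fun_def intro!: mult_mono le ind)
  finally show ?case .
qed simp

lemma green_SUP_sets:
  assumes "incseq D"
  shows "green \<kappa> (\<Union>m. D m) x y = (SUP m. green \<kappa> (D m) x y)"
  unfolding green_def taboo_SUP_sets[OF assms]
  using assms by (intro ennreal_suminf_SUP_eq) (auto simp: mono_def intro!: taboo_mono)

section \<open>Taboo probabilities as probabilities under the path law\<close>

definition kern :: "env \<Rightarrow> int \<Rightarrow> int \<Rightarrow> ennreal" where
  "kern \<omega> u v = ennreal (\<omega> u v)"

lemma zsum_kern:
  assumes "\<omega> \<in> environments"
  shows "zsum (kern \<omega> u) = 1"
proof -
  interpret prob_space "chain_kernel \<omega> x 1 (\<lambda>_. u)"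
    by (rule prob_space_chain_kernel[OF assms])
  show ?thesis
    using emeasure_space_1 by (simp add: chain_kernel_def point_measure_def emeasure_density kern_def)
qed

lemma substochastic_kern: "\<omega> \<in> environments \<Longrightarrow> substochastic (kern \<omega>)"
  by (simp add: substochastic_def zsum_kern)

lemma coordinate_sets_path_space [measurable]: "{X. X i \<in> B} \<in> sets path_space"
proof -
  have "(\<lambda>X. X i) -` B \<inter> space path_space \<in> sets path_space"
    by (rule measurable_sets[of _ _ "count_space UNIV"]) auto
  then show ?thesis
    by (simp add: space_PiM vimage_def)
qed

lemma state_sets_path_space [measurable]: "{X. X i = w} \<in> sets path_space"
  using coordinate_sets_path_space[of i "{w}"] by simp

lemma path_space_sets_conj:
  assumes "{X. Q X} \<in> sets path_space" "{X. R X} \<in> sets path_space"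
  shows "{X. Q X \<and> R X} \<in> sets path_space"
  using sets.Int[OF assms] by (simp add: Collect_conj_eq)

lemma path_space_sets_all:
  assumes "\<And>i::nat. {X. Q i X} \<in> sets path_space"
  shows "{X. \<forall>i. Q i X} \<in> sets path_space"
  using sets.countable_INT'[of UNIV "\<lambda>i. {X. Q i X}" path_space] assms
  by (auto simp: Collect_all_eq)

lemma path_space_sets_imp:
  assumes "{X. R X} \<in> sets path_space"
  shows "{X. b \<longrightarrow> R X} \<in> sets path_space"
  using assms sets.top[of path_space] by (cases b) (auto simp: space_PiM)

lemma emeasure_partition_state:
  assumes "sets M = sets path_space" "A \<in> sets path_space"
  shows "emeasure M A = zsum (\<lambda>w. emeasure M (A \<inter> {X. X n = w}))"
proof -
  have "emeasure M (\<Union>w\<in>UNIV. A \<inter> {X. X n = w}) = zsum (\<lambda>w. emeasure M (A \<inter> {X. X n = w}))"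
    using assms by (intro emeasure_UN_countable) (auto simp: disjoint_family_on_def)
  also have "(\<Union>w\<in>UNIV. A \<inter> {X. X n = w}) = A"
    by auto
  finally show ?thesis .
qed

text \<open>Takes the place of a filtration: there are only countably many initial segments, so a
  set saturated in this sense is a countable union of cylinders.\<close>

definition upto_time :: "nat \<Rightarrow> (nat \<Rightarrow> int) set \<Rightarrow> bool" where
  "upto_time h A \<longleftrightarrow> (\<forall>X Y. (\<forall>i\<le>h. X i = Y i) \<longrightarrow> X \<in> A \<longrightarrow> Y \<in> A)"

lemma upto_timeD: "upto_time h A \<Longrightarrow> (\<And>i. i \<le> h \<Longrightarrow> X i = Y i) \<Longrightarrow> X \<in> A \<longleftrightarrow> Y \<in> A"
  unfolding upto_time_def by metis

text \<open>The Markov property at a fixed time: the event splits into the cylinders of the lists in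
  \<open>S\<close>, and by the cylinder formula each gains the same factor.\<close>

lemma emeasure_path_law_step:
  assumes \<omega>: "\<omega> \<in> environments" and A: "upto_time h A"
  shows "emeasure (path_law \<omega> x) (A \<inter> {X. X h = y \<and> X (Suc h) = z}) =
    emeasure (path_law \<omega> x) (A \<inter> {X. X h = y}) * kern \<omega> y z"
proof -
  define S where "S = {l. length l = Suc h \<and> l ! h = y \<and> (\<lambda>i. l ! i) \<in> A}"
  define cyl where "cyl n l = {X :: nat \<Rightarrow> int. \<forall>i\<le>n. X i = l ! i}" for n l
  note sets_path_law[OF \<omega>, simp]
  have cyl: "cyl n l \<in> sets (path_law \<omega> x)" for n l
  proof -
    have "{X. \<forall>i. i \<le> n \<longrightarrow> X i = l ! i} \<in> sets path_space"
      by (intro path_space_sets_all path_space_sets_imp state_sets_path_space)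
    then show ?thesis
      by (simp add: cyl_def)
  qed
  have mem: "X \<in> A \<longleftrightarrow> (\<lambda>i. map X [0..<Suc h] ! i) \<in> A" for X
    using A by (intro upto_timeD[of h]) (auto simp: nth_append le_less simp del: upt_Suc)
  have memL: "(\<lambda>i. l ! i) \<in> A \<longleftrightarrow> X \<in> A" if "X \<in> cyl h l" for X l
    using A that by (intro upto_timeD[of h]) (auto simp: cyl_def)
  have eqlist: "l = map X [0..<Suc h]" if "X \<in> cyl h l" "length l = Suc h" for X l
    using that by (intro nth_equalityI) (auto simp: cyl_def less_Suc_eq_le simp del: upt_Suc)
  have 1: "A \<inter> {X. X h = y} = (\<Union>l\<in>S. cyl h l)"
  proof (intro set_eqI iffI)
    fix X assume "X \<in> A \<inter> {X. X h = y}"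
    then show "X \<in> (\<Union>l\<in>S. cyl h l)"
      using mem[of X]
      by (intro UN_I[of "map X [0..<Suc h]"]) (auto simp: S_def cyl_def nth_append le_less simp del: upt_Suc)
  next
    fix X assume "X \<in> (\<Union>l\<in>S. cyl h l)"
    then show "X \<in> A \<inter> {X. X h = y}"
      using memL by (auto simp: S_def cyl_def)
  qed
  have 2: "A \<inter> {X. X h = y \<and> X (Suc h) = z} = (\<Union>l\<in>S. cyl (Suc h) (l @ [z]))"
  proof (intro set_eqI)
    fix X
    have "X \<in> cyl (Suc h) (l @ [z]) \<longleftrightarrow> X \<in> cyl h l \<and> X (Suc h) = z" if "l \<in> S" for l
      using that by (auto simp: cyl_def S_def nth_append less_Suc_eq_le le_Suc_eq)
    then have "X \<in> (\<Union>l\<in>S. cyl (Suc h) (l @ [z])) \<longleftrightarrow> X \<in> (\<Union>l\<in>S. cyl h l) \<and> X (Suc h) = z"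
      by auto
    then show "X \<in> A \<inter> {X. X h = y \<and> X (Suc h) = z} \<longleftrightarrow> X \<in> (\<Union>l\<in>S. cyl (Suc h) (l @ [z]))"
      unfolding 1[symmetric] by auto
  qed
  have val: "emeasure (path_law \<omega> x) (cyl (Suc h) (l @ [z])) =
      emeasure (path_law \<omega> x) (cyl h l) * kern \<omega> y z" if "l \<in> S" for l
  proof -
    have "length l = Suc h" "l ! h = y"
      using that by (auto simp: S_def)
    then show ?thesis
      unfolding cyl_def emeasure_path_law[OF \<omega>]
      by (auto simp: nth_append kern_def intro!: prod.cong)
  qed
  have d1: "disjoint_family_on (cyl h) S"
    using eqlist by (auto simp: disjoint_family_on_def S_def)
  have "cyl (Suc h) (l @ [z]) \<subseteq> cyl h l" if "l \<in> S" for l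
    using that by (auto simp: cyl_def S_def nth_append less_Suc_eq_le)
  then have d2: "disjoint_family_on (\<lambda>l. cyl (Suc h) (l @ [z])) S"
    using d1 unfolding disjoint_family_on_def by blast
  have "emeasure (path_law \<omega> x) (A \<inter> {X. X h = y \<and> X (Suc h) = z}) =
      (\<integral>\<^sup>+ l. emeasure (path_law \<omega> x) (cyl (Suc h) (l @ [z])) \<partial>count_space S)"
    unfolding 2 by (intro emeasure_UN_countable cyl d2) auto
  also have "\<dots> = (\<integral>\<^sup>+ l. emeasure (path_law \<omega> x) (cyl h l) * kern \<omega> y z \<partial>count_space S)"
    by (intro nn_integral_cong val) auto
  also have "\<dots> = (\<integral>\<^sup>+ l. emeasure (path_law \<omega> x) (cyl h l) \<partial>count_space S) * kern \<omega> y z"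
    by (rule nn_integral_multc) auto
  also have "(\<integral>\<^sup>+ l. emeasure (path_law \<omega> x) (cyl h l) \<partial>count_space S) =
      emeasure (path_law \<omega> x) (A \<inter> {X. X h = y})"
    unfolding 1 by (intro emeasure_UN_countable[symmetric] cyl d1) auto
  finally show ?thesis .
qed

text \<open>The one-step property iterated \<open>j\<close> times. The past \<open>A\<close> is kept
  general because it is later the event that a site was not visited before time
  \<open>h\<close>.\<close>

lemma emeasure_path_law_taboo:
  assumes \<omega>: "\<omega> \<in> environments" and A: "upto_time h A" "A \<in> sets path_space"
  shows "emeasure (path_law \<omega> x)
      (A \<inter> {X. X h = y \<and> (\<forall>i. h \<le> i \<and> i < h + j \<longrightarrow> X i \<in> D) \<and> X (h + j) = z}) =
    emeasure (path_law \<omega> x) (A \<inter> {X. X h = y}) * taboo (kern \<omega>) D j y z"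
proof (induction j arbitrary: z)
  case 0
  show ?case
  proof (cases "y = z")
    case True
    then have "A \<inter> {X. X h = y \<and> (\<forall>i. h \<le> i \<and> i < h + 0 \<longrightarrow> X i \<in> D) \<and> X (h + 0) = z} =
        A \<inter> {X. X h = y}"
      by auto
    then show ?thesis
      using True by simp
  next
    case False
    then have "A \<inter> {X. X h = y \<and> (\<forall>i. h \<le> i \<and> i < h + 0 \<longrightarrow> X i \<in> D) \<and> X (h + 0) = z} = {}"
      by auto
    then show ?thesis
      using False by simp
  qed
next
  case (Suc j)
  let ?M = "path_law \<omega> x"
  let ?B = "A \<inter> {X. X h = y \<and> (\<forall>i. h \<le> i \<and> i < h + j \<longrightarrow> X i \<in> D)}"
  let ?T = "A \<inter> {X. X h = y \<and> (\<forall>i. h \<le> i \<and> i < h + Suc j \<longrightarrow> X i \<in> D) \<and> X (h + Suc j) = z}"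
  have B: "upto_time (h + j) ?B"
    unfolding upto_time_def
  proof (intro allI impI)
    fix X Y :: "nat \<Rightarrow> int" assume eq: "\<forall>i\<le>h + j. X i = Y i" and "X \<in> ?B"
    then show "Y \<in> ?B"
      using upto_timeD[OF A(1), of X Y] by auto
  qed
  have T: "?T \<in> sets path_space"
    by (intro sets.Int A(2) path_space_sets_conj path_space_sets_all path_space_sets_imp
        coordinate_sets_path_space state_sets_path_space)
  have "emeasure ?M ?T = zsum (\<lambda>w. emeasure ?M (?T \<inter> {X. X (h + j) = w}))"
    by (rule emeasure_partition_state[OF sets_path_law[OF \<omega>] T])
  also have "\<dots> = zsum (\<lambda>w. emeasure ?M (A \<inter> {X. X h = y}) * (taboo (kern \<omega>) D j y w * indicator D w * kern \<omega> w z))"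
  proof (intro nn_integral_cong)
    fix w
    show "emeasure ?M (?T \<inter> {X. X (h + j) = w}) =
        emeasure ?M (A \<inter> {X. X h = y}) * (taboo (kern \<omega>) D j y w * indicator D w * kern \<omega> w z)"
    proof (cases "w \<in> D")
      case True
      have iff: "(\<forall>i. h \<le> i \<and> i < h + Suc j \<longrightarrow> X i \<in> D) \<longleftrightarrow>
          (\<forall>i. h \<le> i \<and> i < h + j \<longrightarrow> X i \<in> D) \<and> X (h + j) \<in> D" for X :: "nat \<Rightarrow> int"
        by (auto simp: less_Suc_eq)
      have "?T \<inter> {X. X (h + j) = w} = ?B \<inter> {X. X (h + j) = w \<and> X (Suc (h + j)) = z}"
        unfolding iff using True by auto
      also have "emeasure ?M \<dots> = emeasure ?M (?B \<inter> {X. X (h + j) = w}) * kern \<omega> w z"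
        by (rule emeasure_path_law_step[OF \<omega> B])
      also have "?B \<inter> {X. X (h + j) = w} =
          A \<inter> {X. X h = y \<and> (\<forall>i. h \<le> i \<and> i < h + j \<longrightarrow> X i \<in> D) \<and> X (h + j) = w}"
        by auto
      finally show ?thesis
        using Suc.IH[of w] True by (simp add: mult.assoc)
    next
      case False
      then have "?T \<inter> {X. X (h + j) = w} = {}"
        by auto
      then show ?thesis
        using False by (simp only: emeasure_empty) simp
    qed
  qed
  also have "\<dots> = emeasure ?M (A \<inter> {X. X h = y}) * taboo (kern \<omega>) D (Suc j) y z"
    by (simp add: zsum_cmult)
  finally show ?case .
qed

lemma emeasure_path_law_start:
  assumes "\<omega> \<in> environments"
  shows "emeasure (path_law \<omega> x) {X. X 0 = x} = 1"
  using emeasure_path_law[OF assms, of x 0 "\<lambda>_. x"] by simp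

lemma emeasure_path_law_taboo0:
  assumes \<omega>: "\<omega> \<in> environments"
  shows "emeasure (path_law \<omega> x) {X. (\<forall>i<n. X i \<in> D) \<and> X n = y} = taboo (kern \<omega>) D n x y"
proof -
  interpret prob_space "path_law \<omega> x"
    by (rule prob_space_path_law[OF \<omega>])
  have AE: "AE X in path_law \<omega> x. X 0 = x"
    using AE_in_set_eq_1[of "{X. X 0 = x}"] emeasure_path_law_start[OF \<omega>, of x] state_sets_path_space
    by (simp add: emeasure_eq_measure sets_path_law[OF \<omega>])
  have sT: "{X. (\<forall>i<n. X i \<in> D) \<and> X n = y} \<in> sets (path_law \<omega> x)"
    "{X. X 0 = x \<and> (\<forall>i. 0 \<le> i \<and> i < 0 + n \<longrightarrow> X i \<in> D) \<and> X (0 + n) = y} \<in> sets (path_law \<omega> x)"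
    unfolding sets_path_law[OF \<omega>]
    by (intro path_space_sets_conj path_space_sets_all path_space_sets_imp
        coordinate_sets_path_space state_sets_path_space)+
  have "emeasure (path_law \<omega> x) {X. (\<forall>i<n. X i \<in> D) \<and> X n = y} =
      emeasure (path_law \<omega> x) {X. X 0 = x \<and> (\<forall>i. 0 \<le> i \<and> i < 0 + n \<longrightarrow> X i \<in> D) \<and> X (0 + n) = y}"
    using AE by (intro emeasure_eq_AE sT) auto
  also have "\<dots> = taboo (kern \<omega>) D n x y"
    using emeasure_path_law_taboo[OF \<omega>, of 0 UNIV x x n D y] emeasure_path_law_start[OF \<omega>, of x]
      sets.top[of path_space]
    by (simp add: upto_time_def space_PiM)
  finally show ?thesis .
qed

lemma emeasure_path_law_exit:
  assumes \<omega>: "\<omega> \<in> environments"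
  shows "emeasure (path_law \<omega> x) {X. \<exists>n. X n \<notin> E} = zsum (\<lambda>z. indicator (- E) z * green (kern \<omega>) E x z)"
proof -
  let ?M = "path_law \<omega> x"
  define T where "T n = {X :: nat \<Rightarrow> int. (\<forall>i<n. X i \<in> E) \<and> X n \<in> - E}" for n
  have T: "T n \<in> sets path_space" for n
    unfolding T_def by (intro path_space_sets_conj path_space_sets_all path_space_sets_imp coordinate_sets_path_space)
  have eq: "{X. \<exists>n. X n \<notin> E} = (\<Union>n. T n)"
  proof (intro set_eqI iffI)
    fix X :: "nat \<Rightarrow> int" assume "X \<in> {X. \<exists>n. X n \<notin> E}"
    then obtain n where "X n \<notin> E" by auto
    then have "X (LEAST n. X n \<notin> E) \<notin> E"
      by (rule LeastI)
    moreover have "X i \<in> E" if "i < (LEAST n. X n \<notin> E)" for i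
      using not_less_Least[OF that] by simp
    ultimately have "X \<in> T (LEAST n. X n \<notin> E)"
      unfolding T_def by blast
    then show "X \<in> (\<Union>n. T n)"
      by blast
  qed (auto simp: T_def)
  have disj: "disjoint_family T"
    unfolding disjoint_family_on_def
  proof (intro ballI impI)
    fix m n :: nat assume "m \<noteq> n"
    then consider "m < n" | "n < m" by linarith
    then show "T m \<inter> T n = {}"
      by cases (auto simp: T_def)
  qed
  have "emeasure ?M {X. \<exists>n. X n \<notin> E} = (\<Sum>n. emeasure ?M (T n))"
    unfolding eq using T by (intro suminf_emeasure[symmetric] disj) (auto simp: sets_path_law[OF \<omega>])
  also have "\<dots> = (\<Sum>n. zsum (\<lambda>z. indicator (- E) z * taboo (kern \<omega>) E n x z))"
  proof (rule suminf_cong)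
    fix n
    have "emeasure ?M (T n) = zsum (\<lambda>z. emeasure ?M (T n \<inter> {X. X n = z}))"
      by (rule emeasure_partition_state[OF sets_path_law[OF \<omega>] T])
    also have "\<dots> = zsum (\<lambda>z. indicator (- E) z * taboo (kern \<omega>) E n x z)"
    proof (intro nn_integral_cong)
      fix z
      show "emeasure ?M (T n \<inter> {X. X n = z}) = indicator (- E) z * taboo (kern \<omega>) E n x z"
      proof (cases "z \<in> E")
        case True
        then have "T n \<inter> {X. X n = z} = {}"
          by (auto simp: T_def)
        then show ?thesis
          using True by simp
      next
        case False
        then have "T n \<inter> {X. X n = z} = {X. (\<forall>i<n. X i \<in> E) \<and> X n = z}"
          by (auto simp: T_def)
        then show ?thesis
          using False by (simp add: emeasure_path_law_taboo0[OF \<omega>])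
      qed
    qed
    finally show "emeasure ?M (T n) = zsum (\<lambda>z. indicator (- E) z * taboo (kern \<omega>) E n x z)" .
  qed
  also have "\<dots> = zsum (\<lambda>z. indicator (- E) z * green (kern \<omega>) E x z)"
    by (simp only: green_def zsum_suminf[symmetric] ennreal_suminf_cmult)
  finally show ?thesis .
qed

lemma emeasure_path_law_state:
  assumes \<omega>: "\<omega> \<in> environments"
  shows "emeasure (path_law \<omega> x) {X. X n = y} = taboo (kern \<omega>) UNIV n x y"
  using emeasure_path_law_taboo0[OF \<omega>, of x n UNIV y] by simp

section \<open>Levels of an adapted sequence\<close>

lemma ennreal_layer_cake:
  fixes x :: ennreal
  shows "x = (\<integral>\<^sup>+ t. indicator {t. 0 < t \<and> ennreal t < x} t \<partial>lborel)"
proof (cases x)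
  case (real r)
  then have "{t. 0 < t \<and> ennreal t < x} = {0<..<r}"
    by (auto simp: ennreal_less_iff)
  then show ?thesis
    using real by simp
next
  case top
  have "(\<Union>n. {0<..<real n}) = {t. 0 < t}"
    using reals_Archimedean2 by fastforce
  moreover have "emeasure lborel (\<Union>n. {0<..<real n}) = (SUP n. emeasure lborel {0<..<real n})"
    by (rule SUP_emeasure_incseq[symmetric]) (auto simp: mono_def)
  ultimately have "emeasure lborel {t. 0 < (t::real)} = (SUP n. of_nat n)"
    by (simp add: ennreal_of_nat_eq_real_of_nat)
  then show ?thesis
    using top by (simp add: ennreal_SUP_of_nat_eq_top)
qed

text \<open>Used with the weights 1 and \<open>F\<close>, so that a tail inequality between the two
  integrates to an inequality between means.\<close>

lemma (in sigma_finite_measure) nn_integral_layer_cake: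
  assumes [measurable]: "\<phi> \<in> borel_measurable M" "H \<in> borel_measurable M"
  shows "(\<integral>\<^sup>+ x. \<phi> x * H x \<partial>M) =
    (\<integral>\<^sup>+ t. indicator {0<..} t * (\<integral>\<^sup>+ x. \<phi> x * indicator {x \<in> space M. ennreal t < H x} x \<partial>M) \<partial>lborel)"
proof -
  interpret pair_sigma_finite M lborel ..
  have "(\<integral>\<^sup>+ x. \<phi> x * H x \<partial>M) =
      (\<integral>\<^sup>+ x. \<integral>\<^sup>+ t. \<phi> x * (if 0 < t \<and> ennreal t < H x then 1 else 0) \<partial>lborel \<partial>M)"
  proof (rule nn_integral_cong)
    fix x
    have "H x = (\<integral>\<^sup>+ t. (if 0 < t \<and> ennreal t < H x then 1 else 0) \<partial>lborel)"
      by (subst ennreal_layer_cake, rule nn_integral_cong) (auto simp: indicator_def)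
    then show "\<phi> x * H x = (\<integral>\<^sup>+ t. \<phi> x * (if 0 < t \<and> ennreal t < H x then 1 else 0) \<partial>lborel)"
      by (subst nn_integral_cmult) auto
  qed
  also have "\<dots> = (\<integral>\<^sup>+ t. \<integral>\<^sup>+ x. \<phi> x * (if 0 < t \<and> ennreal t < H x then 1 else 0) \<partial>M \<partial>lborel)"
    by (rule Fubini'[symmetric]) measurable
  also have "\<dots> = (\<integral>\<^sup>+ t. indicator {0<..} t * (\<integral>\<^sup>+ x. \<phi> x * indicator {x \<in> space M. ennreal t < H x} x \<partial>M) \<partial>lborel)"
  proof (rule nn_integral_cong)
    fix t :: real
    show "(\<integral>\<^sup>+ x. \<phi> x * (if 0 < t \<and> ennreal t < H x then 1 else 0) \<partial>M) =
        indicator {0<..} t * (\<integral>\<^sup>+ x. \<phi> x * indicator {x \<in> space M. ennreal t < H x} x \<partial>M)"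
      by (cases "0 < t") (auto intro!: nn_integral_cong simp: indicator_def)
  qed
  finally show ?thesis .
qed

lemma measurable_less_ennreal:
  fixes f :: "'a \<Rightarrow> ennreal"
  assumes "f \<in> borel_measurable N"
  shows "{x \<in> space N. s < f x} \<in> sets N" "{x \<in> space N. f x \<le> s} \<in> sets N"
  using assms by measurable

text \<open>In the application, \<open>g k\<close> is the expected number of visits to \<open>0\<close> before the walk goes below
  \<open>- k\<close>, \<open>\<F> k\<close> is generated by the environment on \<open>{- k..}\<close>, and \<open>F\<close> is the probability that the
  walk coming from far left hits \<open>0\<close>.\<close>

locale good_levels = prob_space M for M :: "'a measure" +
  fixes \<F> :: "nat \<Rightarrow> 'a measure" and good :: "nat \<Rightarrow> 'a set" and g :: "nat \<Rightarrow> 'a \<Rightarrow> ennreal"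
    and F :: "'a \<Rightarrow> ennreal" and \<delta> \<epsilon> c :: ennreal and m N :: nat
  assumes space_\<F>: "\<And>k. space (\<F> k) = space M"
    and sets_\<F>: "\<And>k. sets (\<F> k) \<subseteq> sets M"
    and mono_\<F>: "\<And>i j. i \<le> j \<Longrightarrow> sets (\<F> i) \<subseteq> sets (\<F> j)"
    and measurable_F [measurable]: "F \<in> borel_measurable M"
    and measurable_g: "\<And>k. k \<le> N \<Longrightarrow> g k \<in> borel_measurable (\<F> k)"
    and good_\<F>: "\<And>k. k \<le> N \<Longrightarrow> good k \<in> sets (\<F> k)"
    and mono_g: "\<And>i j x. x \<in> space M \<Longrightarrow> i \<le> j \<Longrightarrow> j \<le> N \<Longrightarrow> g i x \<le> g j x"
    and good_0: "good 0 = space M"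
    and good_mass: "\<And>k B. k \<le> N \<Longrightarrow> B \<in> sets (\<F> k) \<Longrightarrow> B \<subseteq> good k \<Longrightarrow>
      \<delta> * emeasure M B \<le> (\<integral>\<^sup>+ x. F x * indicator B x \<partial>M)"
    and bad_step: "\<And>k x. Suc k \<le> N \<Longrightarrow> x \<in> space M \<Longrightarrow> x \<notin> good (Suc k) \<Longrightarrow> g (Suc k) x \<le> c * g k x"
    and bad_jump: "\<And>k B. k \<le> N \<Longrightarrow> B \<in> sets (\<F> k) \<Longrightarrow> B \<inter> good k = {} \<Longrightarrow>
      emeasure M (B \<inter> {x \<in> space M. 2 * g (min (k + m) N) x < g N x}) \<le> \<epsilon> * emeasure M B"
    and c: "1 \<le> c" "c ^ Suc m \<le> 2"
begin

text \<open>The crossing level is a stopping time of the exploration: these events are disjoint in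
  \<open>k\<close> and belong to \<open>\<F> k\<close>, so the level-wise assumptions apply to them
  and can be summed.\<close>

definition crossing :: "ennreal \<Rightarrow> nat \<Rightarrow> 'a set" where
  "crossing s k = {x \<in> space M. s < g k x \<and> (\<forall>j<k. g j x \<le> s)}"

lemma crossing_\<F>:
  assumes "k \<le> N"
  shows "crossing s k \<in> sets (\<F> k)"
proof -
  have "{x \<in> space (\<F> k). g j x \<le> s} \<in> sets (\<F> k)" if "j < k" for j
    using measurable_less_ennreal(2)[OF measurable_g[of j], of s] mono_\<F>[of j k] that assms
    by (auto simp: space_\<F>)
  then have "{x \<in> space (\<F> k). \<forall>j\<in>{..<k}. g j x \<le> s} \<in> sets (\<F> k)"
    by (intro sets.sets_Collect_finite_All) auto
  moreover have "{x \<in> space (\<F> k). s < g k x} \<in> sets (\<F> k)"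
    using measurable_less_ennreal(1)[OF measurable_g[OF assms]] .
  ultimately have "{x \<in> space (\<F> k). s < g k x} \<inter> {x \<in> space (\<F> k). \<forall>j\<in>{..<k}. g j x \<le> s} \<in> sets (\<F> k)"
    by blast
  also have "{x \<in> space (\<F> k). s < g k x} \<inter> {x \<in> space (\<F> k). \<forall>j\<in>{..<k}. g j x \<le> s} = crossing s k"
    by (auto simp: crossing_def space_\<F>)
  finally show ?thesis .
qed

lemma crossing_sets: "k \<le> N \<Longrightarrow> crossing s k \<in> sets M"
  using crossing_\<F> sets_\<F> by blast

lemma good_sets: "k \<le> N \<Longrightarrow> good k \<in> sets M"
  using good_\<F> sets_\<F> by blast

lemma disjoint_crossing: "disjoint_family_on (crossing s) A"
  unfolding disjoint_family_on_def
proof (intro ballI impI)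
  fix i j :: nat assume "i \<noteq> j"
  then consider "i < j" | "j < i" by linarith
  then show "crossing s i \<inter> crossing s j = {}"
    by cases (auto simp: crossing_def leD)
qed

lemma crossing_above: "k \<le> N \<Longrightarrow> x \<in> crossing s k \<Longrightarrow> s < g N x"
  using mono_g[of x k N] by (auto simp: crossing_def intro: less_le_trans)

lemma ex_crossing:
  assumes "x \<in> space M" "s < g l x"
  obtains k where "k \<le> l" "x \<in> crossing s k"
proof
  let ?k = "LEAST k. s < g k x"
  show "?k \<le> l"
    using assms(2) by (rule Least_le)
  have "s < g ?k x"
    using assms(2) by (rule LeastI)
  moreover have "g j x \<le> s" if "j < ?k" for j
    using not_less_Least[OF that] by (simp add: not_less)
  ultimately show "x \<in> crossing s ?k"
    using assms(1) by (simp add: crossing_def)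
qed

lemma G_measurable [measurable]: "g N \<in> borel_measurable M"
  using measurable_g[of N] sets_\<F>[of N] space_\<F>[of N]
  by (auto simp: measurable_def)

lemma disjoint_sum_le:
  assumes f [measurable]: "f \<in> borel_measurable M"
  assumes "\<And>k. k \<le> N \<Longrightarrow> A k \<in> sets M" "\<And>k. A k \<subseteq> crossing s k"
  shows "(\<Sum>k\<le>N. \<integral>\<^sup>+ x. f x * indicator (A k) x \<partial>M) \<le> (\<integral>\<^sup>+ x. f x * indicator {x \<in> space M. s < g N x} x \<partial>M)"
proof -
  have "(\<Sum>k\<le>N. \<integral>\<^sup>+ x. f x * indicator (A k) x \<partial>M) = (\<integral>\<^sup>+ x. (\<Sum>k\<le>N. f x * indicator (A k) x) \<partial>M)"
    using assms(2) by (intro nn_integral_sum[symmetric]) auto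
  also have "\<dots> \<le> (\<integral>\<^sup>+ x. f x * indicator {x \<in> space M. s < g N x} x \<partial>M)"
  proof (rule nn_integral_mono)
    fix x assume x: "x \<in> space M"
    have "disjoint_family_on A {..N}"
      using disjoint_crossing[of s "{..N}"] assms(3) unfolding disjoint_family_on_def by blast
    then have "(\<Sum>k\<le>N. f x * indicator (A k) x) = f x * indicator (\<Union>k\<le>N. A k) x"
      by (simp add: indicator_UN_disjoint sum_distrib_left)
    also have "\<dots> \<le> f x * indicator {x \<in> space M. s < g N x} x"
      using crossing_above[of _ x s] assms(3) x by (force simp: indicator_def)
    finally show "(\<Sum>k\<le>N. f x * indicator (A k) x) \<le> f x * indicator {x \<in> space M. s < g N x} x" .
  qed
  finally show ?thesis .
qed

text \<open>Only levels at which some value \<open>t * c ^ r\<close> is crossed are known to be bad.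
  That is enough: at the next level \<open>g\<close> either stays below the current value, or
  crosses it there and then grows by at most the factor \<open>c\<close>.\<close>

lemma bad_crossings_bound:
  assumes x: "x \<in> space M" and k: "k \<le> N" "x \<in> crossing t k"
    and bad: "\<And>r j. r \<le> m \<Longrightarrow> j \<le> N \<Longrightarrow> x \<in> crossing (t * c ^ r) j \<Longrightarrow> x \<notin> good j"
  shows "p \<le> m \<Longrightarrow> k + p \<le> N \<Longrightarrow> g (k + p) x \<le> t * c ^ Suc p"
proof (induction p)
  case 0
  have "x \<notin> good k"
    using bad[of 0 k] k by simp
  \<comment> \<open>Level 0 is good, so a bad level has a predecessor, where \<open>g\<close> is
    still at most \<open>t\<close>.\<close>
  then have "k \<noteq> 0"
    using good_0 x by metis
  then obtain i where i: "k = Suc i"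
    using not0_implies_Suc by blast
  have "g k x \<le> c * g i x"
    using bad_step[of i x] k(1) x \<open>x \<notin> good k\<close> i by auto
  also have "\<dots> \<le> c * t"
    using k(2) i by (intro mult_left_mono) (auto simp: crossing_def)
  finally show ?case
    by (simp add: mult.commute)
next
  case (Suc p)
  then have IH: "g (k + p) x \<le> t * c ^ Suc p"
    by auto
  have c1: "t * c ^ Suc p \<le> t * c ^ Suc (Suc p)"
    using c(1) mult_right_mono[OF c(1), of "c ^ Suc p"] by (intro mult_left_mono) auto
  show ?case
  proof (cases "g (k + Suc p) x \<le> t * c ^ Suc p")
    case True
    then show ?thesis
      using c1 by (rule order_trans)
  next
    case False
    \<comment> \<open>Monotonicity bounds all earlier levels, so \<open>k + Suc p\<close> is the
      very level at which \<open>t * c ^ Suc p\<close> is crossed.\<close>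
    have "g j x \<le> t * c ^ Suc p" if "j < k + Suc p" for j
      using mono_g[OF x, of j "k + p"] that Suc.prems(2) IH by (auto intro: order_trans)
    then have "x \<in> crossing (t * c ^ Suc p) (k + Suc p)"
      using False x by (auto simp: crossing_def not_le)
    then have "x \<notin> good (k + Suc p)"
      using Suc.prems by (intro bad[of "Suc p"]) auto
    then have "g (k + Suc p) x \<le> c * g (k + p) x"
      using bad_step[of "k + p" x] Suc.prems x by auto
    also have "\<dots> \<le> c * (t * c ^ Suc p)"
      using IH by (rule mult_left_mono) simp
    finally show ?thesis
      by (simp add: mult_ac)
  qed
qed

text \<open>If \<open>g N\<close> exceeds \<open>4 t\<close>, then outside a small event \<open>g\<close> exceeds \<open>2 t\<close> at most \<open>m\<close> levels after
  it exceeded \<open>t\<close>. Bad steps alone cannot achieve this, so that one of the values \<open>t * c ^ r\<close>,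
  \<open>r \<le> m\<close>, is crossed at a good level.\<close>

lemma tail_bound:
  assumes "0 < t"
  shows "\<delta> * emeasure M {x \<in> space M. 4 * t < g N x} \<le>
    of_nat (Suc m) * (\<integral>\<^sup>+ x. F x * indicator {x \<in> space M. t < g N x} x \<partial>M) +
    \<delta> * (\<epsilon> * emeasure M {x \<in> space M. t < g N x})"
proof -
  let ?G = "\<lambda>s. \<Union>k\<le>N. crossing s k \<inter> good k"
  let ?J = "\<lambda>k. (crossing t k - good k) \<inter> {x \<in> space M. 2 * g (min (k + m) N) x < g N x}"
  note [measurable] = crossing_sets good_sets
  have gM: "g j \<in> borel_measurable M" if "j \<le> N" for j
    using measurable_g[OF that] sets_\<F>[of j] space_\<F>[of j] by (auto simp: measurable_def)
  have J: "?J k \<in> sets M" if "k \<le> N" for k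
    using crossing_sets[OF that] good_sets[OF that] gM[of "min (k + m) N"]
    by (intro sets.Int sets.Diff) auto
  \<comment> \<open>In the first union some value \<open>t * c ^ r\<close> is crossed at a good
    level; in \<open>?J k\<close> the value \<open>t\<close> is crossed at a bad level
    \<open>k\<close> and \<open>g\<close> still more than doubles after level
    \<open>min (k + m) N\<close>.\<close>
  have "{x \<in> space M. 4 * t < g N x} \<subseteq> (\<Union>r\<le>m. ?G (t * c ^ r)) \<union> (\<Union>k\<le>N. ?J k)"
  proof (rule subsetI, rule ccontr)
    fix x
    assume "x \<in> {x \<in> space M. 4 * t < g N x}" and "x \<notin> (\<Union>r\<le>m. ?G (t * c ^ r)) \<union> (\<Union>k\<le>N. ?J k)"
    then have x: "x \<in> space M" "4 * t < g N x"
      and G: "\<And>r j. r \<le> m \<Longrightarrow> j \<le> N \<Longrightarrow> x \<in> crossing (t * c ^ r) j \<Longrightarrow> x \<notin> good j"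
      and nJ: "\<And>k. k \<le> N \<Longrightarrow> x \<notin> ?J k"
      by auto
    have "t \<le> 4 * t"
      using mult_right_mono[of 1 4 t] by simp
    then have "t < g N x"
      using x(2) by (rule le_less_trans)
    then obtain k where k: "k \<le> N" "x \<in> crossing t k"
      using ex_crossing[OF x(1)] by blast
    define l where "l = min (k + m) N"
    have "l = k + (l - k)" "l - k \<le> m" "l \<le> N"
      using k(1) by (auto simp: l_def)
    then have "g l x \<le> t * c ^ Suc (l - k)"
      using bad_crossings_bound[where p = "l - k", OF x(1) k G] by simp
    \<comment> \<open>At most \<open>Suc m\<close> factors \<open>c\<close> occur. The other factor
      2 comes from being outside \<open>?J k\<close>.\<close>
    also have "\<dots> \<le> t * 2"
      using power_increasing[OF _ c(1), of "Suc (l - k)" "Suc m"] c(2) \<open>l - k \<le> m\<close>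
      by (intro mult_left_mono) auto
    finally have "2 * g l x \<le> 2 * (t * 2)"
      by (intro mult_left_mono) auto
    also have "\<dots> = 4 * t"
      by (simp add: mult_ac flip: mult.assoc)
    finally have "2 * g l x < g N x"
      using x(2) by (rule le_less_trans)
    moreover have "x \<notin> good k"
      using G[of 0 k] k by simp
    ultimately show False
      using nJ[OF k(1)] k x(1) by (simp add: l_def)
  qed
  then have "emeasure M {x \<in> space M. 4 * t < g N x} \<le>
      emeasure M ((\<Union>r\<le>m. ?G (t * c ^ r)) \<union> (\<Union>k\<le>N. ?J k))"
    using J by (intro emeasure_mono) (auto intro!: sets.finite_UN crossing_sets good_sets)
  also have "\<dots> \<le> emeasure M (\<Union>r\<le>m. ?G (t * c ^ r)) + emeasure M (\<Union>k\<le>N. ?J k)"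
    using J by (intro emeasure_subadditive sets.finite_UN) (auto intro!: crossing_sets good_sets)
  also have "\<dots> \<le> (\<Sum>r\<le>m. emeasure M (?G (t * c ^ r))) + (\<Sum>k\<le>N. emeasure M (?J k))"
    using J by (intro add_mono emeasure_subadditive_finite) (auto intro!: sets.finite_UN crossing_sets good_sets)
  finally have "\<delta> * emeasure M {x \<in> space M. 4 * t < g N x} \<le>
      (\<Sum>r\<le>m. \<delta> * emeasure M (?G (t * c ^ r))) + \<delta> * (\<Sum>k\<le>N. emeasure M (?J k))"
    unfolding sum_distrib_left[symmetric] distrib_left[symmetric] by (intro mult_left_mono) auto
  also have "(\<Sum>r\<le>m. \<delta> * emeasure M (?G (t * c ^ r))) \<le>
      (\<Sum>r\<le>m. \<integral>\<^sup>+ x. F x * indicator {x \<in> space M. t < g N x} x \<partial>M)"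
  proof (rule sum_mono)
    fix r
    define s where "s = t * c ^ r"
    \<comment> \<open>Every threshold is at least \<open>t\<close>, so each of the
      \<open>Suc m\<close> terms is bounded by the same integral.\<close>
    have "t * 1 \<le> s"
      unfolding s_def using c(1) by (intro mult_left_mono one_le_power) auto
    then have ts: "t \<le> s"
      by simp
    have "\<delta> * emeasure M (?G s) \<le> \<delta> * (\<Sum>k\<le>N. emeasure M (crossing s k \<inter> good k))"
      by (intro mult_left_mono emeasure_subadditive_finite) (auto intro!: crossing_sets good_sets)
    also have "\<dots> \<le> (\<Sum>k\<le>N. \<integral>\<^sup>+ x. F x * indicator (crossing s k \<inter> good k) x \<partial>M)"
      unfolding sum_distrib_left using crossing_\<F> good_\<F>
      by (intro sum_mono good_mass sets.Int) auto
    also have "\<dots> \<le> (\<integral>\<^sup>+ x. F x * indicator {x \<in> space M. s < g N x} x \<partial>M)"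
      by (rule disjoint_sum_le) (auto intro!: crossing_sets good_sets)
    also have "\<dots> \<le> (\<integral>\<^sup>+ x. F x * indicator {x \<in> space M. t < g N x} x \<partial>M)"
      using ts by (intro nn_integral_mono mult_left_mono) (auto simp: indicator_def)
    finally show "\<delta> * emeasure M (?G (t * c ^ r)) \<le> \<dots>"
      unfolding s_def .
  qed
  also have "(\<Sum>k\<le>N. emeasure M (?J k)) \<le> (\<Sum>k\<le>N. \<epsilon> * emeasure M (crossing t k - good k))"
    using crossing_\<F> good_\<F> by (intro sum_mono bad_jump sets.Diff) auto
  also have "\<dots> = \<epsilon> * (\<Sum>k\<le>N. \<integral>\<^sup>+ x. 1 * indicator (crossing t k - good k) x \<partial>M)"
    by (simp add: sum_distrib_left sets.Diff crossing_sets good_sets)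
  also have "\<dots> \<le> \<epsilon> * (\<integral>\<^sup>+ x. 1 * indicator {x \<in> space M. t < g N x} x \<partial>M)"
    by (intro mult_left_mono disjoint_sum_le) (auto intro!: crossing_sets good_sets)
  finally show ?thesis
    by (simp add: mult_left_mono add_left_mono)
qed

text \<open>Integrating \<open>tail_bound\<close> over \<open>t\<close> gives a quarter of the mean
  on the left and an eighth on the right. Being finite, the eighth can be subtracted; the eighth
  that remains accounts for the factor 8.\<close>

lemma mean_bound:
  assumes "\<epsilon> = 1 / 8" "(\<integral>\<^sup>+ x. g N x \<partial>M) < \<infinity>" "\<delta> < \<infinity>"
  shows "\<delta> * (\<integral>\<^sup>+ x. g N x \<partial>M) \<le> of_nat (8 * Suc m) * (\<integral>\<^sup>+ x. F x * g N x \<partial>M)"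
proof -
  let ?L = "\<lambda>\<phi> H. \<integral>\<^sup>+ t. indicator {0<..} t * (\<integral>\<^sup>+ x. \<phi> x * indicator {x \<in> space M. ennreal t < H x} x \<partial>M) \<partial>lborel"
  have lt4: "4 * ennreal t < y \<longleftrightarrow> ennreal t < y / 4" if "0 < t" for y t
  proof (cases y)
    case (real r)
    have "4 * ennreal t = ennreal (4 * t)"
      using that by (subst ennreal_mult) auto
    moreover have "y / 4 = ennreal (r / 4)"
      using real divide_ennreal[of r 4] by simp
    ultimately show ?thesis
      using real that by (auto simp: ennreal_less_iff)
  qed (use that in \<open>simp add: ennreal_mult_less_top ennreal_top_divide\<close>)
  have "\<delta> * (\<integral>\<^sup>+ x. g N x / 4 \<partial>M) = \<delta> * ?L (\<lambda>_. 1) (\<lambda>x. g N x / 4)"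
    using nn_integral_layer_cake[of "\<lambda>_. 1" "\<lambda>x. g N x / 4"] by simp
  also have "\<dots> = (\<integral>\<^sup>+ t. indicator {0<..} t * (\<delta> * emeasure M {x \<in> space M. 4 * ennreal t < g N x}) \<partial>lborel)"
    by (subst nn_integral_cmult[symmetric]) (auto intro!: nn_integral_cong simp: lt4 split: split_indicator)
  also have "\<dots> \<le> (\<integral>\<^sup>+ t. indicator {0<..} t * (of_nat (Suc m) * (\<integral>\<^sup>+ x. F x * indicator {x \<in> space M. ennreal t < g N x} x \<partial>M) +
      \<delta> * (\<epsilon> * (\<integral>\<^sup>+ x. 1 * indicator {x \<in> space M. ennreal t < g N x} x \<partial>M))) \<partial>lborel)"
  proof (rule nn_integral_mono, goal_cases)
    case (1 t)
    show ?case
      using tail_bound[of "ennreal t"] by (cases "0 < t") (simp_all del: of_nat_Suc)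
  qed
  also have "\<dots> = of_nat (Suc m) * ?L F (g N) + \<delta> * (\<epsilon> * ?L (\<lambda>_. 1) (g N))"
  proof -
    have alg: "a * (b * p + d * (e * q)) = b * (a * p) + d * (e * (a * q))" for a b d e p q :: ennreal
      by (simp add: distrib_left mult_ac)
    have lin: "(\<integral>\<^sup>+ t. b * u t + d * (e * w t) \<partial>lborel) = b * (\<integral>\<^sup>+ t. u t \<partial>lborel) + d * (e * (\<integral>\<^sup>+ t. w t \<partial>lborel))"
      if [measurable]: "u \<in> borel_measurable lborel" "w \<in> borel_measurable lborel" for b d e and u w :: "real \<Rightarrow> ennreal"
      by (simp add: nn_integral_add nn_integral_cmult)
    show ?thesis
      unfolding alg by (rule lin) measurable
  qed
  also have "?L F (g N) = (\<integral>\<^sup>+ x. F x * g N x \<partial>M)"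
    by (rule nn_integral_layer_cake[symmetric]) auto
  also have "?L (\<lambda>_. 1) (g N) = (\<integral>\<^sup>+ x. g N x \<partial>M)"
    using nn_integral_layer_cake[of "\<lambda>_. 1" "g N"] by simp
  finally have *: "\<delta> * ((\<integral>\<^sup>+ x. g N x \<partial>M) / 4) \<le>
      of_nat (Suc m) * (\<integral>\<^sup>+ x. F x * g N x \<partial>M) + \<delta> * (\<epsilon> * (\<integral>\<^sup>+ x. g N x \<partial>M))"
    by (simp add: nn_integral_divide)
  obtain a where a: "0 \<le> a" "\<delta> * (\<integral>\<^sup>+ x. g N x \<partial>M) = ennreal a"
    using assms(2,3) by (cases "\<delta> * (\<integral>\<^sup>+ x. g N x \<partial>M)") (auto simp: ennreal_mult_eq_top_iff)
  have "\<delta> * ((\<integral>\<^sup>+ x. g N x \<partial>M) / 4) = ennreal (a / 4)"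
    using a divide_ennreal[of a 4] by (simp add: ennreal_times_divide)
  moreover have "\<delta> * (\<epsilon> * (\<integral>\<^sup>+ x. g N x \<partial>M)) = ennreal (a / 8)"
  proof -
    have "\<delta> * (\<epsilon> * (\<integral>\<^sup>+ x. g N x \<partial>M)) = \<delta> * (\<integral>\<^sup>+ x. g N x \<partial>M) / 8"
      by (simp add: assms(1) divide_ennreal_def mult_ac)
    then show ?thesis
      using a divide_ennreal[of a 8] by simp
  qed
  ultimately have **: "ennreal (a / 4) \<le> of_nat (Suc m) * (\<integral>\<^sup>+ x. F x * g N x \<partial>M) + ennreal (a / 8)"
    using * by simp
  show ?thesis
  proof (cases "of_nat (Suc m) * (\<integral>\<^sup>+ x. F x * g N x \<partial>M)")
    case (real b)
    then have "a \<le> 8 * b"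
      using ** a(1) by (auto simp flip: ennreal_plus)
    then have "ennreal a \<le> 8 * ennreal b"
      using real(1) by (metis ennreal_leI ennreal_mult ennreal_numeral zero_le_numeral)
    then show ?thesis
      unfolding a(2) of_nat_mult of_nat_numeral mult.assoc real(2) .
  next
    case top
    then have "(\<integral>\<^sup>+ x. F x * g N x \<partial>M) = \<top>"
      by (simp add: ennreal_mult_eq_top_iff del: of_nat_Suc)
    then show ?thesis
      by (simp add: ennreal_mult_top del: of_nat_Suc)
  qed
qed

end

section \<open>Independent and identically distributed environments\<close>

lemma measurable_zsum:
  assumes "\<And>w. (\<lambda>x. f x w) \<in> borel_measurable N"
  shows "(\<lambda>x. zsum (f x)) \<in> borel_measurable N"
proof -
  have "(\<lambda>(w, x). f x w) \<in> borel_measurable (count_space UNIV \<Otimes>\<^sub>M N)"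
    using assms by (intro measurable_pair_measure_countable1) auto
  then have "(\<lambda>(x, w). f x w) \<in> borel_measurable (N \<Otimes>\<^sub>M count_space UNIV)"
    using measurable_pair_swap[of "\<lambda>(w, x). f x w"] by simp
  then show ?thesis
    by (intro sigma_finite_measure.borel_measurable_nn_integral sigma_finite_measure_count_space) simp
qed

text \<open>The indicator of \<open>D\<close> removes all transition vectors outside
  \<open>D\<close>. This is what places Green functions in the sigma-field of the explored
  sites.\<close>

lemma measurable_taboo:
  assumes "\<And>u v. u \<in> D \<Longrightarrow> (\<lambda>\<omega>. \<kappa> \<omega> u v) \<in> borel_measurable N"
  shows "(\<lambda>\<omega>. taboo (\<kappa> \<omega>) D n x y) \<in> borel_measurable N"
proof (induction n arbitrary: y)
  case (Suc n)
  have "(\<lambda>\<omega>. taboo (\<kappa> \<omega>) D n x w * indicator D w * \<kappa> \<omega> w y) \<in> borel_measurable N" for w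
    using Suc assms[of w y] by (cases "w \<in> D") auto
  then show ?case
    by (simp add: measurable_zsum)
qed simp

lemma measurable_green:
  assumes "\<And>u v. u \<in> D \<Longrightarrow> (\<lambda>\<omega>. \<kappa> \<omega> u v) \<in> borel_measurable N"
  shows "(\<lambda>\<omega>. green (\<kappa> \<omega>) D x y) \<in> borel_measurable N"
  unfolding green_def using measurable_taboo[OF assms] by measurable

text \<open>The sigma-field generated by the environment at the sites of \<open>A\<close>, as a
  pullback from the restricted product: the form in which independence of disjoint blocks is
  stated.\<close>

definition rows :: "int set \<Rightarrow> env measure" where
  "rows A = vimage_algebra environments (\<lambda>\<omega>. \<lambda>x\<in>A. jump_law \<omega> x) (Pi\<^sub>M A (\<lambda>_. borel))"

lemma space_rows [simp]: "space (rows A) = environments"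
  by (simp add: rows_def)

lemma rows_sets_eq:
  "sets (rows A) = {(\<lambda>\<omega>. \<lambda>x\<in>A. jump_law \<omega> x) -` S \<inter> environments | S. S \<in> sets (Pi\<^sub>M A (\<lambda>_. borel))}"
  unfolding rows_def by (rule sets_vimage_algebra2) (auto simp: space_PiM)

lemma measurable_jump_law_rows:
  assumes "u \<in> A"
  shows "(\<lambda>\<omega>. jump_law \<omega> u) \<in> borel_measurable (rows A)"
proof -
  have "(\<lambda>\<omega>. \<lambda>x\<in>A. jump_law \<omega> x) \<in> rows A \<rightarrow>\<^sub>M Pi\<^sub>M A (\<lambda>_. borel)"
    unfolding rows_def by (rule measurable_vimage_algebra1) (auto simp: space_PiM)
  from measurable_compose[OF this measurable_component_singleton[OF assms]]
  show ?thesis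
    using assms by simp
qed

lemma measurable_kern_rows:
  assumes "u \<in> A"
  shows "(\<lambda>\<omega>. kern \<omega> u v) \<in> borel_measurable (rows A)"
proof -
  have "(\<lambda>\<omega>. jump_law \<omega> u (v - u)) \<in> borel_measurable (rows A)"
    by (rule measurable_product_then_coordinatewise, rule measurable_jump_law_rows[OF assms])
  then show ?thesis
    by (simp add: kern_def jump_law_def)
qed

lemma rows_mono:
  assumes "A \<subseteq> B"
  shows "sets (rows A) \<subseteq> sets (rows B)"
proof -
  have "(\<lambda>\<omega>. \<lambda>x\<in>A. jump_law \<omega> x) \<in> rows B \<rightarrow>\<^sub>M Pi\<^sub>M A (\<lambda>_. borel)"
    using assms by (intro measurable_restrict measurable_jump_law_rows) auto
  from measurable_sets[OF this]
  have "(\<lambda>\<omega>. \<lambda>x\<in>A. jump_law \<omega> x) -` S \<inter> environments \<in> sets (rows B)"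
    if "S \<in> sets (Pi\<^sub>M A (\<lambda>_. borel))" for S
    using that by simp
  then show ?thesis
    by (auto simp: rows_sets_eq[of A])
qed

lemma measurable_green_rows:
  assumes "D \<subseteq> A"
  shows "(\<lambda>\<omega>. green (kern \<omega>) D x y) \<in> borel_measurable (rows A)"
    and "(\<lambda>\<omega>. green (\<lambda>u v. s * kern \<omega> u v) D x y) \<in> borel_measurable (rows A)"
  using assms by (auto intro!: measurable_green measurable_kern_rows borel_measurable_times_ennreal)

lemma kern_shift: "(\<lambda>u v. ennreal (jump_law \<omega> (u + a) (v - u))) = (\<lambda>u v. kern \<omega> (u + a) (v + a))"
  by (auto simp: kern_def jump_law_def algebra_simps)

locale iid_env = prob_space P for P :: "env measure" +
  assumes sets_P: "sets P = sets env_space"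
    and indep: "indep_vars (\<lambda>_. borel) (\<lambda>x \<omega>. jump_law \<omega> x) UNIV"
    and ident: "\<And>x y. distr P borel (\<lambda>\<omega>. jump_law \<omega> x) = distr P borel (\<lambda>\<omega>. jump_law \<omega> y)"
begin

lemma space_P: "space P = environments"
  using sets_eq_imp_space_eq[OF sets_P] by (simp add: env_space_def space_restrict_space)

lemma jump_law_measurable [measurable]: "(\<lambda>\<omega>. jump_law \<omega> x) \<in> borel_measurable P"
  using indep by (auto simp: indep_vars_def)

lemma rows_subset: "sets (rows A) \<subseteq> sets P"
proof -
  have "(\<lambda>\<omega>. \<lambda>x\<in>A. jump_law \<omega> x) \<in> P \<rightarrow>\<^sub>M Pi\<^sub>M A (\<lambda>_. borel)"
    by (intro measurable_restrict jump_law_measurable)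
  from measurable_sets[OF this]
  have "(\<lambda>\<omega>. \<lambda>x\<in>A. jump_law \<omega> x) -` S \<inter> environments \<in> sets P"
    if "S \<in> sets (Pi\<^sub>M A (\<lambda>_. borel))" for S
    using that by (simp add: space_P)
  then show ?thesis
    by (auto simp: rows_sets_eq[of A])
qed

lemma measurable_rows: "f \<in> rows A \<rightarrow>\<^sub>M N \<Longrightarrow> f \<in> P \<rightarrow>\<^sub>M N"
  using rows_subset[of A] by (auto simp: measurable_def space_P)

lemma green_measurable [measurable]:
  "(\<lambda>\<omega>. green (kern \<omega>) D x y) \<in> borel_measurable P"
  "(\<lambda>\<omega>. green (\<lambda>u v. s * kern \<omega> u v) D x y) \<in> borel_measurable P"
  by (auto intro!: measurable_rows[of _ D] measurable_green_rows)

text \<open>The two blocks of transition vectors are independent, hence so are the sigma-fields they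
  generate and all functions measurable for these.\<close>

lemma nn_integral_rows_mult:
  assumes AB: "A \<inter> B = {}"
    and f: "f \<in> borel_measurable (rows A)" and h: "h \<in> borel_measurable (rows B)"
  shows "(\<integral>\<^sup>+ \<omega>. f \<omega> * h \<omega> \<partial>P) = (\<integral>\<^sup>+ \<omega>. f \<omega> \<partial>P) * (\<integral>\<^sup>+ \<omega>. (h \<omega> :: ennreal) \<partial>P)"
proof -
  let ?X = "\<lambda>A \<omega>. \<lambda>x\<in>A. jump_law \<omega> x"
  have "indep_var (Pi\<^sub>M A (\<lambda>_. borel)) (?X A) (Pi\<^sub>M B (\<lambda>_. borel)) (?X B)"
    by (rule indep_var_restrict[OF indep AB]) auto
  then have "indep_sets (\<lambda>b. {case_bool (?X A) (?X B) b -` S \<inter> space P | S.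
      S \<in> sets (case_bool (Pi\<^sub>M A (\<lambda>_. borel)) (Pi\<^sub>M B (\<lambda>_. borel)) b)}) UNIV"
    unfolding indep_var_def indep_vars_def2 by blast
  moreover have "{case_bool (?X A) (?X B) b -` S \<inter> space P | S.
      S \<in> sets (case_bool (Pi\<^sub>M A (\<lambda>_. borel)) (Pi\<^sub>M B (\<lambda>_. borel)) b)} = sets (rows (if b then A else B))" for b
    by (cases b) (auto simp: rows_sets_eq space_P)
  ultimately have "indep_sets (\<lambda>b. sets (rows (if b then A else B))) UNIV"
    by simp
  then have "indep_sets (\<lambda>b. {(if b then f else h) -` S \<inter> space P | S. S \<in> sets borel}) UNIV"
  proof (rule indep_sets_mono_sets)
    fix b :: bool
    show "{(if b then f else h) -` S \<inter> space P | S. S \<in> sets borel} \<subseteq> sets (rows (if b then A else B))"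
      using measurable_sets[OF f] measurable_sets[OF h] by (auto simp: space_P)
  qed
  then have "indep_vars (\<lambda>_. borel) (\<lambda>b. if b then f else h) UNIV"
    unfolding indep_vars_def2 using measurable_rows[OF f] measurable_rows[OF h] by auto
  then have "(\<integral>\<^sup>+ \<omega>. (\<Prod>b\<in>UNIV. (if b then f else h) \<omega>) \<partial>P) =
      (\<Prod>b\<in>UNIV. \<integral>\<^sup>+ \<omega>. (if b then f else h) \<omega> \<partial>P)"
    by (intro indep_vars_nn_integral) auto
  then show ?thesis
    by (simp add: UNIV_bool mult.commute)
qed

text \<open>By independence and equal marginals this is a product measure with one repeated factor,
  which reindexing by a translation preserves.\<close>

lemma distr_jump_laws_shift:
  "distr P (Pi\<^sub>M UNIV (\<lambda>_. borel)) (\<lambda>\<omega> x. jump_law \<omega> (x + a)) =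
   distr P (Pi\<^sub>M UNIV (\<lambda>_. borel)) (\<lambda>\<omega> x. jump_law \<omega> x)"
proof -
  let ?S = "Pi\<^sub>M UNIV (\<lambda>_::int. borel :: (int \<Rightarrow> real) measure)"
  define \<mu> where "\<mu> = distr P borel (\<lambda>\<omega>. jump_law \<omega> 0)"
  interpret \<mu>: prob_space \<mu>
    unfolding \<mu>_def by (rule prob_space_distr) simp
  have m: "(\<lambda>\<omega> x. jump_law \<omega> x) \<in> P \<rightarrow>\<^sub>M ?S"
    by (rule measurable_PiM_single') (auto simp: space_PiM)
  have S: "sets (Pi\<^sub>M UNIV (\<lambda>_::int. \<mu>)) = sets ?S"
    by (intro sets_PiM_cong) (auto simp: \<mu>_def)
  have shift: "(\<lambda>\<rho> x. \<rho> (x + a)) \<in> ?S \<rightarrow>\<^sub>M ?S"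
    by (rule measurable_PiM_single') (auto simp: space_PiM)
  have law: "distr P ?S (\<lambda>\<omega> x. jump_law \<omega> x) = Pi\<^sub>M UNIV (\<lambda>_. \<mu>)"
  proof -
    have "distr P borel (\<lambda>\<omega>. jump_law \<omega> x) = \<mu>" for x
      unfolding \<mu>_def by (rule ident)
    moreover have "distr P ?S (\<lambda>\<omega>. \<lambda>x\<in>UNIV. jump_law \<omega> x) = (\<Pi>\<^sub>M x\<in>UNIV. distr P borel (\<lambda>\<omega>. jump_law \<omega> x))"
      using indep by (subst (asm) indep_vars_iff_distr_eq_PiM) auto
    ultimately show ?thesis
      by (simp add: restrict_UNIV)
  qed
  have "distr P ?S (\<lambda>\<omega> x. jump_law \<omega> (x + a)) = distr (distr P ?S (\<lambda>\<omega> x. jump_law \<omega> x)) ?S (\<lambda>\<rho> x. \<rho> (x + a))"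
    by (subst distr_distr[OF shift m]) (simp add: comp_def)
  also have "\<dots> = distr (Pi\<^sub>M UNIV (\<lambda>_. \<mu>)) (Pi\<^sub>M UNIV (\<lambda>_. \<mu>)) (\<lambda>\<rho>. \<lambda>x\<in>UNIV. \<rho> (x + a))"
    unfolding law by (intro distr_cong) (auto simp: S)
  also have "\<dots> = Pi\<^sub>M UNIV (\<lambda>_. \<mu>)"
    by (rule distr_PiM_reindex[where M = "\<lambda>_. \<mu>"]) (auto simp: inj_on_def \<mu>.prob_space_axioms)
  finally show ?thesis
    unfolding law .
qed

text \<open>Stationarity for functionals of the kernel. Here \<open>\<rho> u (v - u)\<close>
  rebuilds the kernel from a family of jump laws, so that both sides become integrals over laws of
  such families.\<close>

lemma nn_integral_shift:
  assumes \<Phi>: "(\<lambda>\<rho>. \<Phi> (\<lambda>u v. ennreal (\<rho> u (v - u)))) \<in> borel_measurable (Pi\<^sub>M UNIV (\<lambda>_. borel))"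
  shows "(\<integral>\<^sup>+ \<omega>. \<Phi> (\<lambda>u v. kern \<omega> (u + a) (v + a)) \<partial>P) = (\<integral>\<^sup>+ \<omega>. \<Phi> (kern \<omega>) \<partial>P)"
proof -
  have m: "(\<lambda>\<omega> x. jump_law \<omega> (x + b)) \<in> P \<rightarrow>\<^sub>M Pi\<^sub>M UNIV (\<lambda>_. borel)" for b :: int
    by (rule measurable_PiM_single') (auto simp: space_PiM)
  have "(\<integral>\<^sup>+ \<omega>. \<Phi> (\<lambda>u v. kern \<omega> (u + b) (v + b)) \<partial>P) =
      (\<integral>\<^sup>+ \<rho>. \<Phi> (\<lambda>u v. ennreal (\<rho> u (v - u))) \<partial>distr P (Pi\<^sub>M UNIV (\<lambda>_. borel)) (\<lambda>\<omega> x. jump_law \<omega> (x + b)))" for b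
    by (subst nn_integral_distr[OF m]) (simp_all add: \<Phi> kern_shift)
  from this[of a] this[of 0] distr_jump_laws_shift[of a] show ?thesis
    by simp
qed

lemma measurable_krho [measurable]:
  "(\<lambda>\<rho>. ennreal (\<rho> u (v - u))) \<in> borel_measurable (Pi\<^sub>M UNIV (\<lambda>_::int. borel :: (int \<Rightarrow> real) measure))"
proof -
  have "(\<lambda>\<rho>. \<rho> u) \<in> Pi\<^sub>M UNIV (\<lambda>_::int. borel :: (int \<Rightarrow> real) measure) \<rightarrow>\<^sub>M borel"
    by (rule measurable_component_singleton) simp
  then have "(\<lambda>\<rho>. \<rho> u (v - u)) \<in> borel_measurable (Pi\<^sub>M UNIV (\<lambda>_::int. borel :: (int \<Rightarrow> real) measure))"
    by (rule measurable_product_then_coordinatewise)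
  then show ?thesis
    by measurable
qed

lemma green_krho_measurable [measurable]:
  "(\<lambda>\<rho>. green (\<lambda>u v. ennreal (\<rho> u (v - u))) D x y) \<in> borel_measurable (Pi\<^sub>M UNIV (\<lambda>_::int. borel :: (int \<Rightarrow> real) measure))"
  by (rule measurable_green, rule measurable_krho)

lemma green_discount_krho_measurable [measurable]:
  "(\<lambda>\<rho>. green (\<lambda>u v. s * ennreal (\<rho> u (v - u))) D x y) \<in> borel_measurable (Pi\<^sub>M UNIV (\<lambda>_::int. borel :: (int \<Rightarrow> real) measure))"
  by (rule measurable_green, intro borel_measurable_times_ennreal measurable_const measurable_krho) simp

lemma nn_integral_green_shift:
  "(\<integral>\<^sup>+ \<omega>. green (kern \<omega>) D (x + a) (y + a) \<partial>P) =
   (\<integral>\<^sup>+ \<omega>. green (kern \<omega>) {d. d + a \<in> D} x y \<partial>P)"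
proof -
  have "(\<integral>\<^sup>+ \<omega>. green (\<lambda>u v. kern \<omega> (u + a) (v + a)) {d. d + a \<in> D} x y \<partial>P) =
      (\<integral>\<^sup>+ \<omega>. green (kern \<omega>) {d. d + a \<in> D} x y \<partial>P)"
    by (rule nn_integral_shift) (rule green_krho_measurable)
  moreover have "green (\<lambda>u v. kern \<omega> (u + a) (v + a)) {d. d + a \<in> D} x y = green (kern \<omega>) D (x + a) (y + a)" for \<omega>
    by (rule green_shift)
  ultimately show ?thesis
    by simp
qed

end

section \<open>Visits of the annealed walk\<close>

lemma space_path_space: "space path_space = UNIV"
  by (simp add: space_PiM)

context iid_env
begin

lemma path_law_kernel: "(\<lambda>\<omega>. path_law \<omega> x) \<in> P \<rightarrow>\<^sub>M subprob_algebra path_space"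
  using measurable_prob_algebraD[OF path_law_measurable]
  by (simp cong: measurable_cong_sets add: sets_P)

lemma sets_annealed_law: "sets (annealed_law P x) = sets path_space"
  unfolding annealed_law_def by (rule sets_bind) (use not_empty in \<open>auto simp: space_P sets_path_law\<close>)

lemma nn_integral_annealed_law:
  assumes "f \<in> borel_measurable path_space"
  shows "(\<integral>\<^sup>+ X. f X \<partial>annealed_law P x) = (\<integral>\<^sup>+ \<omega>. \<integral>\<^sup>+ X. f X \<partial>path_law \<omega> x \<partial>P)"
  unfolding annealed_law_def by (rule nn_integral_bind[OF assms path_law_kernel])

lemma prob_space_annealed_law: "prob_space (annealed_law P x)"
proof
  have "emeasure (annealed_law P x) UNIV = (\<integral>\<^sup>+ \<omega>. emeasure (path_law \<omega> x) UNIV \<partial>P)"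
    using sets.top[of path_space] prob_space_axioms sets_P
    by (intro emeasure_annealed_law) (auto simp: space_path_space)
  also have "\<dots> = (\<integral>\<^sup>+ \<omega>. 1 \<partial>P)"
  proof (rule nn_integral_cong)
    fix \<omega> assume "\<omega> \<in> space P"
    then have \<omega>: "\<omega> \<in> environments"
      by (simp add: space_P)
    show "emeasure (path_law \<omega> x) UNIV = 1"
      using prob_space.emeasure_space_1[OF prob_space_path_law[OF \<omega>]]
        sets_eq_imp_space_eq[OF sets_path_law[OF \<omega>]] by (simp add: space_path_space)
  qed
  finally show "emeasure (annealed_law P x) (space (annealed_law P x)) = 1"
    using sets_eq_imp_space_eq[OF sets_annealed_law] by (simp add: space_path_space emeasure_space_1)
qed

end

lemma visits0_suminf: "visits0 X = (\<Sum>n. indicator {X. X n = 0} X)"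
proof -
  have "visits0 X = (\<integral>\<^sup>+ n. indicator {n. X n = 0} n \<partial>count_space UNIV)"
    by (simp add: visits0_def)
  also have "\<dots> = (\<Sum>n. indicator {X. X n = 0} X)"
    by (simp add: nn_integral_count_space_nat indicator_def)
  finally show ?thesis .
qed

lemma visits0_measurable: "visits0 \<in> borel_measurable path_space"
proof -
  have eq: "visits0 = (\<lambda>X. \<Sum>n. indicator {X. X n = 0} X)"
    by (rule ext) (rule visits0_suminf)
  show ?thesis
    by (subst eq) (intro borel_measurable_suminf_order borel_measurable_indicator state_sets_path_space)
qed

lemma nn_integral_path_law_indicator:
  assumes "\<omega> \<in> environments" "A \<in> sets path_space"
  shows "(\<integral>\<^sup>+ X. indicator A X \<partial>path_law \<omega> x) = emeasure (path_law \<omega> x) A"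
  using assms by (intro nn_integral_indicator) (simp add: sets_path_law)

lemma nn_integral_visits0:
  assumes "\<omega> \<in> environments"
  shows "(\<integral>\<^sup>+ X. visits0 X \<partial>path_law \<omega> 0) = green (kern \<omega>) UNIV 0 0"
proof -
  have "(\<integral>\<^sup>+ X. visits0 X \<partial>path_law \<omega> 0) = (\<Sum>n. \<integral>\<^sup>+ X. indicator {X. X n = 0} X \<partial>path_law \<omega> 0)"
    unfolding visits0_suminf using assms
    by (intro nn_integral_suminf) (simp add: sets_path_law cong: measurable_cong_sets)
  also have "\<dots> = green (kern \<omega>) UNIV 0 0"
    using assms by (simp add: nn_integral_path_law_indicator emeasure_path_law_state green_def)
  finally show ?thesis .
qed

text \<open>The visits to \<open>x\<close>, discounted by the time since the first one: only the first hitting time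
  \<open>h\<close> contributes to the outer sum. This bounded version of the number of visits makes it possible
  to exchange expectation and limit.\<close>

definition late_visits :: "real \<Rightarrow> int \<Rightarrow> (nat \<Rightarrow> int) \<Rightarrow> ennreal" where
  "late_visits s x X = (\<Sum>h. \<Sum>j. ennreal s ^ j * indicator {X. (\<forall>i<h. X i \<in> - {x}) \<and> X h = x \<and> X (h + j) = x} X)"

lemma late_visits_event_sets: "{X. (\<forall>i<h. X i \<in> - {x}) \<and> X h = x \<and> X (h + j) = x} \<in> sets path_space"
  by (intro path_space_sets_conj path_space_sets_all path_space_sets_imp coordinate_sets_path_space state_sets_path_space)

lemma late_visits_measurable: "late_visits s x \<in> borel_measurable path_space"
  unfolding late_visits_def
  by (intro borel_measurable_suminf_order borel_measurable_times_ennreal measurable_const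
      borel_measurable_indicator late_visits_event_sets) simp

text \<open>Markov property at the first visit to \<open>x\<close>: the sums over \<open>h\<close>
  and \<open>j\<close> separate into a hitting probability and a discounted number of visits. This
  product is the source of \<open>F\<^sub>n G\<close>.\<close>

lemma nn_integral_late_visits:
  assumes \<omega>: "\<omega> \<in> environments"
  shows "(\<integral>\<^sup>+ X. late_visits s x X \<partial>path_law \<omega> 0) =
    green (kern \<omega>) (- {x}) 0 x * green (\<lambda>u v. ennreal s * kern \<omega> u v) UNIV x x"
proof -
  let ?A = "\<lambda>h j. {X. (\<forall>i<h. X i \<in> - {x}) \<and> X h = x \<and> X (h + j) = x}"
  have m: "(\<lambda>X. ennreal s ^ j * indicator (?A h j) X) \<in> borel_measurable (path_law \<omega> 0)" for h j
    unfolding measurable_cong_sets[OF sets_path_law[OF \<omega>] refl]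
    by (intro borel_measurable_times_ennreal measurable_const borel_measurable_indicator late_visits_event_sets) simp
  have "(\<integral>\<^sup>+ X. late_visits s x X \<partial>path_law \<omega> 0) =
      (\<Sum>h. \<Sum>j. \<integral>\<^sup>+ X. ennreal s ^ j * indicator (?A h j) X \<partial>path_law \<omega> 0)"
    unfolding late_visits_def
    by (simp only: nn_integral_suminf[OF m] nn_integral_suminf[OF borel_measurable_suminf_order[OF m]])
  also have "\<dots> = (\<Sum>h. \<Sum>j. taboo (kern \<omega>) (- {x}) h 0 x * (ennreal s ^ j * taboo (kern \<omega>) UNIV j x x))"
  proof (intro suminf_cong)
    fix h j
    let ?B = "{X :: nat \<Rightarrow> int. \<forall>i<h. X i \<in> - {x}}"
    have B: "?B \<in> sets path_space"
      by (intro path_space_sets_all path_space_sets_imp coordinate_sets_path_space)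
    have "?A h j = ?B \<inter> {X. X h = x \<and> (\<forall>i. h \<le> i \<and> i < h + j \<longrightarrow> X i \<in> UNIV) \<and> X (h + j) = x}"
      by auto
    moreover have "?B \<inter> {X. X h = x} = {X. (\<forall>i<h. X i \<in> - {x}) \<and> X h = x}"
      by auto
    moreover have "upto_time h ?B"
      by (auto simp: upto_time_def)
    ultimately have "emeasure (path_law \<omega> 0) (?A h j) = taboo (kern \<omega>) (- {x}) h 0 x * taboo (kern \<omega>) UNIV j x x"
      using emeasure_path_law_taboo[OF \<omega> _ B, of h 0 x j UNIV x] emeasure_path_law_taboo0[OF \<omega>, of 0 h "- {x}" x]
      by simp
    then show "(\<integral>\<^sup>+ X. ennreal s ^ j * indicator (?A h j) X \<partial>path_law \<omega> 0) =
        taboo (kern \<omega>) (- {x}) h 0 x * (ennreal s ^ j * taboo (kern \<omega>) UNIV j x x)"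
      using late_visits_event_sets[of h x j]
      by (subst nn_integral_cmult_indicator) (auto simp: sets_path_law[OF \<omega>] mult_ac)
  qed
  also have "\<dots> = green (kern \<omega>) (- {x}) 0 x * green (\<lambda>u v. ennreal s * kern \<omega> u v) UNIV x x"
    unfolding green_def taboo_scale by (simp only: ennreal_suminf_cmult ennreal_suminf_multc)
  finally show ?thesis .
qed

text \<open>The constant is the dominating function for a limsup; the true number of visits then
  bounds that limsup without reference to \<open>s\<close>.\<close>

lemma late_visits_le:
  assumes s: "0 \<le> s" "s < 1"
  shows "late_visits s x X \<le> ennreal (1 / (1 - s))" (is ?bounded)
    and "late_visits s x X \<le> (\<Sum>n. indicator {X. X n = x} X)" (is ?visits)
proof -
  have s1: "ennreal s ^ j \<le> 1" for j
    using s by (simp add: ennreal_power ennreal_le_1 power_le_one)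
  have "?bounded \<and> ?visits"
  proof (cases "\<exists>h. X h = x")
    case False
    then have "late_visits s x X = 0"
      unfolding late_visits_def by (simp add: indicator_def)
    then show ?thesis
      by simp
  next
    case True
    define h where "h = (LEAST h. X h = x)"
    have h: "X h = x"
      unfolding h_def using LeastI_ex[OF True] .
    have lt: "X i \<noteq> x" if "i < h" for i
      using not_less_Least[of i "\<lambda>i. X i = x"] that by (simp add: h_def)
    have "(\<forall>i<k. X i \<in> - {x}) \<and> X k = x \<longleftrightarrow> k = h" for k
      using h lt by (metis ComplD ComplI insertI1 linorder_neqE_nat singletonD)
    then have "indicator {X. (\<forall>i<k. X i \<in> - {x}) \<and> X k = x \<and> X (k + j) = x} X =
        (if k = h then indicator {X. X (h + j) = x} X else (0::ennreal))" for k j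
      by (auto simp: indicator_def)
    then have "late_visits s x X = (\<Sum>k. if k = h then \<Sum>j. ennreal s ^ j * indicator {X. X (h + j) = x} X else 0)"
      unfolding late_visits_def by (intro suminf_cong) auto
    also have "\<dots> = (\<Sum>j. ennreal s ^ j * indicator {X. X (h + j) = x} X)"
      by (subst suminf_finite[of "{h}"]) auto
    finally have eq: "late_visits s x X = (\<Sum>j. ennreal s ^ j * indicator {X. X (h + j) = x} X)" .
    also have "\<dots> \<le> (\<Sum>j. ennreal (s ^ j))"
      using s by (intro suminf_le) (auto simp: indicator_def ennreal_power)
    also have "\<dots> = ennreal (1 / (1 - s))"
      using s by (subst suminf_ennreal2) (auto simp: suminf_geometric)
    finally have "?bounded" .
    moreover have "(\<Sum>j. ennreal s ^ j * indicator {X. X (h + j) = x} X) \<le> (\<Sum>j. indicator {X. X (j + h) = x} X)"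
      using s1 by (intro suminf_le) (auto simp: indicator_def add.commute)
    moreover have "(\<Sum>j. indicator {X. X (j + h) = x} X) = (\<Sum>n. if h \<le> n then indicator {X. X n = x} X else (0::ennreal))"
    proof -
      have "(\<Sum>n. if h \<le> n then indicator {X. X n = x} X else (0::ennreal)) =
          (\<Sum>n. if h \<le> n then indicator {X. X (n - h + h) = x} X else 0)"
        by (intro suminf_cong) simp
      then show ?thesis
        using suminf_shift_ennreal[of h "\<lambda>j. indicator {X. X (j + h) = x} X"] by simp
    qed
    moreover have "(\<Sum>n. if h \<le> n then indicator {X. X n = x} X else (0::ennreal)) \<le> (\<Sum>n. indicator {X. X n = x} X)"
      by (intro suminf_le) auto
    ultimately have "(\<Sum>j. ennreal s ^ j * indicator {X. X (h + j) = x} X) \<le> (\<Sum>n. indicator {X. X n = x} X)"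
      by (simp only:)
    with \<open>?bounded\<close> show ?thesis
      unfolding eq by blast
  qed
  then show ?bounded ?visits
    by auto
qed

lemma sum_visits:
  "(\<Sum>x=1..n. \<Sum>k. indicator {X. X k = int x} X) = emeasure (count_space UNIV) {k. 1 \<le> X k \<and> X k \<le> int n}"
proof -
  have "(\<Sum>x=1..n. \<Sum>k. indicator {X. X k = int x} X) = (\<Sum>k. \<Sum>x=1..n. indicator {X. X k = int x} X :: ennreal)"
    by (rule suminf_sum[symmetric]) simp
  also have "\<dots> = (\<Sum>k. indicator {k. 1 \<le> X k \<and> X k \<le> int n} k)"
  proof (intro suminf_cong)
    fix k
    have "(\<Sum>x=1..n. indicator {X. X k = int x} X) = (\<Sum>x=1..n. if x = nat (X k) then (if 1 \<le> X k then 1 else 0) else (0::ennreal))"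
      by (intro sum.cong) (auto simp: indicator_def)
    also have "\<dots> = indicator {k. 1 \<le> X k \<and> X k \<le> int n} k"
      by (subst sum.delta) (auto simp: indicator_def)
    finally show "(\<Sum>x=1..n. indicator {X. X k = int x} X) = (indicator {k. 1 \<le> X k \<and> X k \<le> int n} k :: ennreal)" .
  qed
  also have "\<dots> = emeasure (count_space UNIV) {k. 1 \<le> X k \<and> X k \<le> int n}"
    by (simp flip: nn_integral_count_space_nat)
  finally show ?thesis .
qed

text \<open>From some time \<open>m\<close> on \<open>X k > v * k / 2\<close>, so
  \<open>X k \<le> n\<close> forces \<open>k \<le> 2 * n / v\<close>. The \<open>m\<close> earlier
  times and the time 0 are paid for by the extra \<open>n\<close>.\<close>

lemma ballistic_visits:
  assumes lim: "(\<lambda>n. real_of_int (X n) / real n) \<longlonglongrightarrow> v" and v: "0 < v"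
  shows "eventually (\<lambda>n. emeasure (count_space UNIV) {k. 1 \<le> X k \<and> X k \<le> int n} \<le> ennreal ((2 / v + 1) * real n)) sequentially"
proof -
  obtain m where m: "\<And>k. m \<le> k \<Longrightarrow> v / 2 < real_of_int (X k) / real k"
    using order_tendstoD(1)[OF lim, of "v / 2"] v by (auto simp: eventually_sequentially)
  show ?thesis
  proof (rule eventually_sequentiallyI)
    fix n assume n: "Suc m \<le> n"
    let ?c = "nat \<lfloor>2 * real n / v\<rfloor>"
    have "{k. 1 \<le> X k \<and> X k \<le> int n} \<subseteq> {..<m} \<union> {..?c}"
    proof
      fix k assume "k \<in> {k. 1 \<le> X k \<and> X k \<le> int n}"
      then have k: "X k \<le> int n" by simp
      show "k \<in> {..<m} \<union> {..?c}"
      proof (cases "k < m \<or> k = 0")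
        case False
        then have "v / 2 * real k < real_of_int (X k)"
          using m[of k] by (simp add: field_simps)
        also have "\<dots> \<le> real n"
          using k by linarith
        finally have "real k \<le> 2 * real n / v"
          using v by (simp add: field_simps)
        then show ?thesis
          by (simp add: le_nat_floor)
      qed auto
    qed
    then have "emeasure (count_space UNIV) {k. 1 \<le> X k \<and> X k \<le> int n} \<le> emeasure (count_space UNIV) ({..<m} \<union> {..?c})"
      by (intro emeasure_mono) auto
    also have "\<dots> = of_nat (card ({..<m} \<union> {..?c}))"
      by simp
    also have "\<dots> \<le> of_nat (m + Suc ?c)"
      using card_Un_le[of "{..<m}" "{..?c}"] by (intro of_nat_mono) simp
    also have "\<dots> = ennreal (real (m + Suc ?c))"
      by (simp only: ennreal_of_nat_eq_real_of_nat)
    also have "\<dots> \<le> ennreal ((2 / v + 1) * real n)"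
    proof (rule ennreal_leI)
      have "real ?c \<le> 2 * real n / v"
        using v by simp
      then show "real (m + Suc ?c) \<le> (2 / v + 1) * real n"
        using n by (simp add: field_simps)
    qed
    finally show "emeasure (count_space UNIV) {k. 1 \<le> X k \<and> X k \<le> int n} \<le> ennreal ((2 / v + 1) * real n)" .
  qed
qed

section \<open>Boundedness of the mean product of hitting average and visits\<close>

context iid_env
begin

text \<open>Translation by \<open>x\<close> turns the walk from 0 that visits \<open>x\<close> into
  a walk from \<open>- x\<close> that visits 0.\<close>

lemma nn_integral_hit_green_shift:
  "(\<integral>\<^sup>+ \<omega>. green (kern \<omega>) (- {x}) 0 x * green (\<lambda>u v. ennreal s * kern \<omega> u v) UNIV x x \<partial>P) =
   (\<integral>\<^sup>+ \<omega>. green (kern \<omega>) (- {0}) (- x) 0 * green (\<lambda>u v. ennreal s * kern \<omega> u v) UNIV 0 0 \<partial>P)"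
proof -
  let ?\<Phi> = "\<lambda>\<kappa>. green \<kappa> (- {0}) (- x) 0 * green (\<lambda>u v. ennreal s * \<kappa> u v) UNIV 0 0"
  have "(\<integral>\<^sup>+ \<omega>. ?\<Phi> (\<lambda>u v. kern \<omega> (u + x) (v + x)) \<partial>P) = (\<integral>\<^sup>+ \<omega>. ?\<Phi> (kern \<omega>) \<partial>P)"
    by (rule nn_integral_shift)
      (intro borel_measurable_times_ennreal green_krho_measurable green_discount_krho_measurable)
  moreover have "green (\<lambda>u v. kern \<omega> (u + x) (v + x)) (- {0}) (- x) 0 = green (kern \<omega>) (- {x}) 0 x" for \<omega>
  proof -
    have "{d. d + x \<in> - {x}} = - {0}"
      by auto
    then show ?thesis
      using green_shift[of "kern \<omega>" x "- {x}" "- x" 0] by simp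
  qed
  moreover have "green (\<lambda>u v. ennreal s * kern \<omega> (u + x) (v + x)) UNIV 0 0 =
      green (\<lambda>u v. ennreal s * kern \<omega> u v) UNIV x x" for \<omega>
    using green_shift[of "\<lambda>u v. ennreal s * kern \<omega> u v" x UNIV 0 0] by simp
  ultimately show ?thesis
    by simp
qed

text \<open>This is \<open>F\<^sub>n\<close>. Averaging over starting points matters because a
  single site may be jumped over; only sums over \<open>R\<close> consecutive sites are bounded
  below.\<close>

definition hit_average :: "nat \<Rightarrow> env \<Rightarrow> ennreal" where
  "hit_average n \<omega> = (\<Sum>x=1..n. green (kern \<omega>) (- {0}) (- int x) 0) / of_nat n"

lemma hit_average_measurable [measurable]: "hit_average n \<in> borel_measurable P"
  unfolding hit_average_def by measurable

text \<open>Reverse Fatou for the discounted visits to \<open>{1..n}\<close> divided by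
  \<open>n\<close>. The bound does not depend on \<open>s\<close>, which later permits the removal
  of the discount.\<close>

lemma eventually_hit_average_green:
  assumes vel: "limiting_velocity P v" and v: "0 < v" and s: "0 \<le> s" "s < 1"
  shows "eventually (\<lambda>n. (\<integral>\<^sup>+ \<omega>. hit_average n \<omega> * green (\<lambda>u v. ennreal s * kern \<omega> u v) UNIV 0 0 \<partial>P)
    \<le> ennreal (2 / v + 2)) sequentially"
proof -
  let ?A = "annealed_law P 0"
  interpret A: prob_space ?A
    by (rule prob_space_annealed_law)
  define f where "f n X = (\<Sum>x=1..n. late_visits s (int x) X) / of_nat n" for n X
  have f [measurable]: "f n \<in> borel_measurable path_space" for n
    unfolding f_def using late_visits_measurable by measurable
  have fA [measurable]: "f n \<in> borel_measurable ?A" for n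
    using f by (simp cong: measurable_cong_sets add: sets_annealed_law)
  have int_f: "(\<integral>\<^sup>+ X. f n X \<partial>?A) = (\<integral>\<^sup>+ \<omega>. hit_average n \<omega> * green (\<lambda>u v. ennreal s * kern \<omega> u v) UNIV 0 0 \<partial>P)" for n
  proof -
    let ?I = "\<lambda>\<omega> x. green (kern \<omega>) (- {int x}) 0 (int x) * green (\<lambda>u v. ennreal s * kern \<omega> u v) UNIV (int x) (int x)"
    let ?J = "\<lambda>\<omega> x. green (kern \<omega>) (- {0}) (- int x) 0 * green (\<lambda>u v. ennreal s * kern \<omega> u v) UNIV 0 0"
    have "(\<integral>\<^sup>+ X. f n X \<partial>?A) = (\<integral>\<^sup>+ \<omega>. \<integral>\<^sup>+ X. f n X \<partial>path_law \<omega> 0 \<partial>P)"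
      by (rule nn_integral_annealed_law[OF f])
    also have "\<dots> = (\<integral>\<^sup>+ \<omega>. (\<Sum>x=1..n. ?I \<omega> x) / of_nat n \<partial>P)"
    proof (rule nn_integral_cong)
      fix \<omega> assume "\<omega> \<in> space P"
      then have \<omega>: "\<omega> \<in> environments"
        by (simp add: space_P)
      have [measurable]: "late_visits s x \<in> borel_measurable (path_law \<omega> 0)" for x
        using late_visits_measurable by (simp cong: measurable_cong_sets add: sets_path_law[OF \<omega>])
      show "(\<integral>\<^sup>+ X. f n X \<partial>path_law \<omega> 0) = (\<Sum>x=1..n. ?I \<omega> x) / of_nat n"
        unfolding f_def
        by (subst nn_integral_divide, measurable, subst nn_integral_sum) (simp_all add: nn_integral_late_visits[OF \<omega>])
    qed
    also have "\<dots> = (\<Sum>x=1..n. \<integral>\<^sup>+ \<omega>. ?I \<omega> x \<partial>P) / of_nat n"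
      by (subst nn_integral_divide, measurable, subst nn_integral_sum) simp_all
    also have "\<dots> = (\<Sum>x=1..n. \<integral>\<^sup>+ \<omega>. ?J \<omega> x \<partial>P) / of_nat n"
      by (simp only: nn_integral_hit_green_shift)
    also have "\<dots> = (\<integral>\<^sup>+ \<omega>. (\<Sum>x=1..n. ?J \<omega> x) / of_nat n \<partial>P)"
      by (subst nn_integral_divide, measurable, subst nn_integral_sum) simp_all
    also have "\<dots> = (\<integral>\<^sup>+ \<omega>. hit_average n \<omega> * green (\<lambda>u v. ennreal s * kern \<omega> u v) UNIV 0 0 \<partial>P)"
      unfolding hit_average_def sum_distrib_right[symmetric] by (simp add: divide_ennreal_def mult_ac)
    finally show ?thesis .
  qed
  have bound: "f n X \<le> ennreal (1 / (1 - s))" for n X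
  proof (cases "n = 0")
    case False
    have "f n X \<le> (\<Sum>x=1..n. ennreal (1 / (1 - s))) / of_nat n"
      unfolding f_def by (intro divide_right_mono_ennreal sum_mono late_visits_le s)
    also have "\<dots> = of_nat n * ennreal (1 / (1 - s)) / of_nat n"
      by simp
    also have "\<dots> = ennreal (1 / (1 - s))"
      using False by (subst mult.commute, subst ennreal_mult_divide_eq) auto
    finally show ?thesis .
  qed (simp add: f_def)
  have "limsup (\<lambda>n. \<integral>\<^sup>+ X. f n X \<partial>?A) \<le> (\<integral>\<^sup>+ X. limsup (\<lambda>n. f n X) \<partial>?A)"
    by (rule nn_integral_limsup[where w = "\<lambda>_. ennreal (1 / (1 - s))"])
      (auto simp: bound A.emeasure_space_1)
  also have "\<dots> \<le> (\<integral>\<^sup>+ X. ennreal (2 / v + 1) \<partial>?A)"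
  proof (rule nn_integral_mono_AE)
    show "AE X in ?A. limsup (\<lambda>n. f n X) \<le> ennreal (2 / v + 1)"
      using vel unfolding limiting_velocity_def
    proof eventually_elim
      case (elim X)
      from ballistic_visits[OF this v] have "eventually (\<lambda>n. f n X \<le> ennreal (2 / v + 1)) sequentially"
        using eventually_gt_at_top[of 0]
      proof eventually_elim
        case (elim n)
        have "(\<Sum>x=1..n. late_visits s (int x) X) \<le> (\<Sum>x=1..n. \<Sum>k. indicator {X. X k = int x} X)"
          by (intro sum_mono late_visits_le s)
        also have "\<dots> \<le> ennreal ((2 / v + 1) * real n)"
          unfolding sum_visits by (rule elim(1))
        also have "\<dots> = ennreal (2 / v + 1) * of_nat n"
          using v by (subst ennreal_mult) (auto simp: ennreal_of_nat_eq_real_of_nat)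
        finally have "f n X \<le> ennreal (2 / v + 1) * of_nat n / of_nat n"
          unfolding f_def by (rule divide_right_mono_ennreal)
        also have "\<dots> = ennreal (2 / v + 1)"
          using elim(2) by (simp add: ennreal_mult_divide_eq)
        finally show ?case .
      qed
      then show ?case
        by (rule Limsup_bounded)
    qed
  qed
  also have "\<dots> = ennreal (2 / v + 1)"
    by (simp add: A.emeasure_space_1)
  \<comment> \<open>A strict inequality is required to pass from the limsup to all large
    \<open>n\<close>.\<close>
  also have "\<dots> < ennreal (2 / v + 2)"
    using v by (intro ennreal_lessI) (auto intro: add_pos_pos)
  finally have "eventually (\<lambda>n. (\<integral>\<^sup>+ X. f n X \<partial>?A) < ennreal (2 / v + 2)) sequentially"
    by (rule Limsup_lessD)
  then show ?thesis
    unfolding int_f by eventually_elim (rule less_imp_le)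
qed

end

section \<open>Transience and bounded jumps\<close>

lemma green_zero:
  assumes "x \<noteq> z" "\<And>w. w \<in> E \<Longrightarrow> \<kappa> w z = 0"
  shows "green \<kappa> E x z = 0"
proof -
  have "taboo \<kappa> E n x z = 0" for n
  proof (cases n)
    case (Suc k)
    have "taboo \<kappa> E k x w * indicator E w * \<kappa> w z = 0" for w
      using assms(2)[of w] by (cases "w \<in> E") auto
    then show ?thesis
      by (simp only: Suc taboo.simps) simp
  qed (use assms in simp)
  then show ?thesis
    by (simp add: green_def)
qed

locale rwre = iid_env +
  fixes L R :: int
  assumes L_pos: "0 < L" and R_pos: "0 < R"
    and irred: "AE \<omega> in P. irreducible_chain \<omega>"
    and bounded: "AE \<omega> in P. \<forall>a b. b \<notin> {a - L..a + R} \<longrightarrow> \<omega> a b = 0"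
    and transient: "AE \<omega> in P. AE X in path_law \<omega> 0. filterlim X at_top sequentially"
begin

lemma AE_kern_eq_0: "AE \<omega> in P. \<forall>a b. b \<notin> {a - L..a + R} \<longrightarrow> kern \<omega> a b = 0"
  using bounded by eventually_elim (simp add: kern_def)

lemma AE_environments: "AE \<omega> in P. \<omega> \<in> environments"
  by (rule AE_I2) (simp add: space_P)

text \<open>Irreducibility makes some \<open>n\<close>-step probability positive; it is bounded by a
  Green function of which, by \<open>green_hit\<close>, the hitting probability is a factor.\<close>

lemma AE_hit_pos: "AE \<omega> in P. \<forall>x y. 0 < green (kern \<omega>) (- {y}) x y"
  using irred AE_environments
proof eventually_elim
  case (elim \<omega>)
  show ?case
  proof (intro allI)
    fix x y
    obtain n where "measure (path_law \<omega> x) {X. X n = y} > 0"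
      using elim(1) unfolding irreducible_chain_def by blast
    then have "taboo (kern \<omega>) UNIV n x y \<noteq> 0"
      by (auto simp: measure_def emeasure_path_law_state[OF elim(2)])
    moreover have "taboo (kern \<omega>) UNIV n x y \<le> green (kern \<omega>) UNIV x y"
      using sum_le_suminf[of "\<lambda>n. taboo (kern \<omega>) UNIV n x y" "{n}"] by (simp add: green_def)
    moreover have "green (kern \<omega>) UNIV x y = green (kern \<omega>) (UNIV - {y}) x y * green (kern \<omega>) UNIV y y"
      by (rule green_hit) simp
    ultimately have "green (kern \<omega>) (UNIV - {y}) x y \<noteq> 0"
      by auto
    then show "0 < green (kern \<omega>) (- {y}) x y"
      by (simp add: Compl_eq_Diff_UNIV zero_less_iff_neq_zero)
  qed
qed

lemma AE_exit_0:
  assumes "0 < w"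
  shows "AE \<omega> in P. zsum (\<lambda>z. indicator (- {..<w}) z * green (kern \<omega>) {..<w} 0 z) = 1"
  using transient AE_environments
proof eventually_elim
  case (elim \<omega>)
  interpret Q: prob_space "path_law \<omega> 0"
    by (rule prob_space_path_law[OF elim(2)])
  have "{X. \<exists>n. X n \<notin> {..<w}} = (\<Union>n. {X. X n \<in> - {..<w}})"
    by blast
  also have "\<dots> \<in> sets (path_law \<omega> 0)"
    unfolding sets_path_law[OF elim(2)]
    by (intro sets.countable_UN) (use coordinate_sets_path_space in blast)
  finally have s: "{X. \<exists>n. X n \<notin> {..<w}} \<in> sets (path_law \<omega> 0)" .
  have "AE X in path_law \<omega> 0. X \<in> {X. \<exists>n. X n \<notin> {..<w}}"
    using elim(1)
  proof eventually_elim
    case (elim X)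
    then have "eventually (\<lambda>n. w \<le> X n) sequentially"
      by (simp add: filterlim_at_top)
    then show ?case
      by (auto simp: eventually_sequentially not_less)
  qed
  then have "emeasure (path_law \<omega> 0) {X. \<exists>n. X n \<notin> {..<w}} = 1"
    using s by (intro Q.emeasure_eq_1_AE)
  then show ?case
    by (simp only: emeasure_path_law_exit[OF elim(2)])
qed

lemma AE_eq_1:
  assumes [measurable]: "f \<in> borel_measurable P" and "AE \<omega> in P. f \<omega> \<le> 1" "(\<integral>\<^sup>+ \<omega>. f \<omega> \<partial>P) = (1 :: ennreal)"
  shows "AE \<omega> in P. f \<omega> = 1"
proof -
  have "(\<integral>\<^sup>+ \<omega>. 1 - f \<omega> \<partial>P) = (\<integral>\<^sup>+ \<omega>. 1 \<partial>P) - (\<integral>\<^sup>+ \<omega>. f \<omega> \<partial>P)"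
    using assms by (intro nn_integral_diff) auto
  then have "(\<integral>\<^sup>+ \<omega>. 1 - f \<omega> \<partial>P) = 0"
    by (simp add: assms emeasure_space_1)
  then have "AE \<omega> in P. 1 - f \<omega> = 0"
    by (subst (asm) nn_integral_0_iff_AE) auto
  then show ?thesis
    using assms(2) by eventually_elim (auto simp: diff_eq_0_iff_ennreal)
qed

text \<open>Transience is given for the start 0 only. By stationarity the exit probability from
  \<open>x\<close> has mean 1, and being at most 1 it equals 1 almost surely.\<close>

lemma AE_exit: "AE \<omega> in P. \<forall>x w. x < w \<longrightarrow> zsum (\<lambda>z. indicator (- {..<w}) z * green (kern \<omega>) {..<w} x z) = 1"
proof -
  have "AE \<omega> in P. zsum (\<lambda>z. indicator (- {..<w}) z * green (kern \<omega>) {..<w} x z) = 1" if "x < w" for x w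
  proof -
    let ?\<Phi> = "\<lambda>\<kappa>. zsum (\<lambda>z. indicator (- {..<w - x}) z * green \<kappa> {..<w - x} 0 z)"
    have "(\<integral>\<^sup>+ \<omega>. ?\<Phi> (\<lambda>u v. kern \<omega> (u + x) (v + x)) \<partial>P) = (\<integral>\<^sup>+ \<omega>. ?\<Phi> (kern \<omega>) \<partial>P)"
      by (rule nn_integral_shift, rule measurable_zsum) measurable
    moreover have "?\<Phi> (\<lambda>u v. kern \<omega> (u + x) (v + x)) =
        zsum (\<lambda>z. indicator (- {..<w}) z * green (kern \<omega>) {..<w} x z)" for \<omega>
    proof -
      have "{d. d + x \<in> {..<w}} = {..<w - x}"
        by auto
      then have "?\<Phi> (\<lambda>u v. kern \<omega> (u + x) (v + x)) =
          zsum (\<lambda>z. indicator (- {..<w}) (z + x) * green (kern \<omega>) {..<w} x (z + x))"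
        using green_shift[of "kern \<omega>" x "{..<w}" 0]
        by (intro nn_integral_cong) (auto simp: indicator_def)
      then show ?thesis
        by (simp only: zsum_shift[of "\<lambda>z. indicator (- {..<w}) z * green (kern \<omega>) {..<w} x z"])
    qed
    moreover have "(\<integral>\<^sup>+ \<omega>. ?\<Phi> (kern \<omega>) \<partial>P) = (\<integral>\<^sup>+ \<omega>. 1 \<partial>P)"
      using AE_exit_0[of "w - x"] that by (intro nn_integral_cong_AE) auto
    ultimately have "(\<integral>\<^sup>+ \<omega>. zsum (\<lambda>z. indicator (- {..<w}) z * green (kern \<omega>) {..<w} x z) \<partial>P) = 1"
      by (simp add: emeasure_space_1)
    moreover have "AE \<omega> in P. zsum (\<lambda>z. indicator (- {..<w}) z * green (kern \<omega>) {..<w} x z) \<le> 1"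
      using AE_environments by eventually_elim (intro zsum_green_exit_le_1 substochastic_kern)
    ultimately show ?thesis
      by (intro AE_eq_1 measurable_zsum) measurable
  qed
  then show ?thesis
    by (simp add: AE_all_countable)
qed

lemma zsum_window:
  assumes "\<And>z. z \<notin> {w..<w + R} \<Longrightarrow> f z = 0"
  shows "zsum f = (\<Sum>z\<in>{w..<w + R}. f z)"
  by (rule nn_integral_count_space') (use assms in auto)

lemma AE_exit_window:
  "AE \<omega> in P. \<forall>x w. x < w \<longrightarrow> (\<Sum>z\<in>{w..<w + R}. green (kern \<omega>) {..<w} x z) = 1"
  using AE_exit AE_kern_eq_0
proof eventually_elim
  case (elim \<omega>)
  show ?case
  proof (intro allI impI)
    fix x w :: int assume xw: "x < w"
    have "green (kern \<omega>) {..<w} x z = 0" if "w + R \<le> z" for z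
      using that elim(2) xw R_pos by (intro green_zero) auto
    then have "zsum (\<lambda>z. indicator (- {..<w}) z * green (kern \<omega>) {..<w} x z) =
        (\<Sum>z\<in>{w..<w + R}. indicator (- {..<w}) z * green (kern \<omega>) {..<w} x z)"
      by (intro zsum_window) (auto simp: indicator_def not_less)
    also have "\<dots> = (\<Sum>z\<in>{w..<w + R}. green (kern \<omega>) {..<w} x z)"
      by (intro sum.cong) auto
    finally show "(\<Sum>z\<in>{w..<w + R}. green (kern \<omega>) {..<w} x z) = 1"
      using elim(1) xw by simp
  qed
qed

text \<open>For \<open>y > 0\<close>, the annealed probability that the walk from 0 enters
  \<open>{y..}\<close> exactly at \<open>y\<close>, so that \<open>y\<close> is a record
  value.\<close>

definition record_prob :: "int \<Rightarrow> ennreal" where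
  "record_prob y = (\<integral>\<^sup>+ \<omega>. green (kern \<omega>) {..<y} 0 y \<partial>P)"

text \<open>A jump to the right has length at most \<open>R\<close>, so the walk enters
  \<open>{w..}\<close> inside the window, and its entrance point is a record.\<close>

lemma record_prob_window:
  assumes "0 < w"
  shows "1 \<le> (\<Sum>z\<in>{w..<w + R}. record_prob z)"
proof -
  have "1 = (\<integral>\<^sup>+ \<omega>. 1 \<partial>P)"
    by (simp add: emeasure_space_1)
  also have "\<dots> \<le> (\<integral>\<^sup>+ \<omega>. (\<Sum>z\<in>{w..<w + R}. green (kern \<omega>) {..<z} 0 z) \<partial>P)"
  proof (rule nn_integral_mono_AE)
    show "AE \<omega> in P. 1 \<le> (\<Sum>z\<in>{w..<w + R}. green (kern \<omega>) {..<z} 0 z)"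
      using AE_exit_window
    proof eventually_elim
      case (elim \<omega>)
      then have "1 = (\<Sum>z\<in>{w..<w + R}. green (kern \<omega>) {..<w} 0 z)"
        using assms by simp
      also have "\<dots> \<le> (\<Sum>z\<in>{w..<w + R}. green (kern \<omega>) {..<z} 0 z)"
        by (intro sum_mono green_mono) auto
      finally show ?case .
    qed
  qed
  also have "\<dots> = (\<Sum>z\<in>{w..<w + R}. record_prob z)"
    unfolding record_prob_def by (intro nn_integral_sum) simp
  finally show ?thesis .
qed

lemma record_prob_sum: "of_nat q \<le> (\<Sum>z\<in>{1..<1 + int q * R}. record_prob z)"
proof (induction q)
  case (Suc q)
  have "{1..<1 + int (Suc q) * R} = {1..<1 + int q * R} \<union> {1 + int q * R..<1 + int q * R + R}"
  proof -
    have "{1..<1 + a + R} = {1..<1 + a} \<union> {1 + a..<1 + a + R}" if "0 \<le> a" for a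
      using that R_pos by auto
    from this[of "int q * R"] show ?thesis
      using R_pos by (simp add: algebra_simps)
  qed
  moreover have "{1..<1 + int q * R} \<inter> {1 + int q * R..<1 + int q * R + R} = {}"
    by auto
  ultimately have split: "(\<Sum>z\<in>{1..<1 + int (Suc q) * R}. record_prob z) =
      (\<Sum>z\<in>{1..<1 + int q * R}. record_prob z) + (\<Sum>z\<in>{1 + int q * R..<1 + int q * R + R}. record_prob z)"
    by (simp add: sum.union_disjoint)
  have "1 \<le> (\<Sum>z\<in>{1 + int q * R..<1 + int q * R + R}. record_prob z)"
    using R_pos by (intro record_prob_window) (simp add: add_pos_nonneg)
  from add_mono[OF Suc this] show ?case
    unfolding split by (simp add: add.commute)
qed simp

section \<open>Finite expected visits force a positive velocity\<close>

lemma nn_integral_green_le: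
  "(\<integral>\<^sup>+ \<omega>. green (kern \<omega>) UNIV 0 x \<partial>P) \<le> (\<integral>\<^sup>+ \<omega>. green (kern \<omega>) UNIV 0 0 \<partial>P)"
proof -
  have "(\<integral>\<^sup>+ \<omega>. green (kern \<omega>) UNIV 0 x \<partial>P) \<le> (\<integral>\<^sup>+ \<omega>. green (kern \<omega>) UNIV x x \<partial>P)"
  proof (rule nn_integral_mono)
    fix \<omega> assume "\<omega> \<in> space P"
    then have "green (kern \<omega>) (UNIV - {x}) 0 x * green (kern \<omega>) UNIV x x \<le> 1 * green (kern \<omega>) UNIV x x"
      by (intro mult_right_mono green_exit_le_1 substochastic_kern) (auto simp: space_P)
    then show "green (kern \<omega>) UNIV 0 x \<le> green (kern \<omega>) UNIV x x"
      using green_hit[of x UNIV "kern \<omega>" 0] by simp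
  qed
  also have "\<dots> = (\<integral>\<^sup>+ \<omega>. green (kern \<omega>) UNIV 0 0 \<partial>P)"
    using nn_integral_green_shift[of UNIV 0 x 0] by simp
  finally show ?thesis .
qed

lemma AE_annealed_at_top: "AE X in annealed_law P 0. filterlim X at_top sequentially"
proof -
  have "{X :: nat \<Rightarrow> int. \<forall>n. N \<le> n \<longrightarrow> X n \<in> {Z..}} \<in> sets path_space" for N Z
    by (intro path_space_sets_all path_space_sets_imp coordinate_sets_path_space)
  then have "(\<Union>N. {X :: nat \<Rightarrow> int. \<forall>n. N \<le> n \<longrightarrow> X n \<in> {Z..}}) \<in> sets path_space" for Z
    by (intro sets.countable_UN) auto
  then have "(\<Inter>Z. \<Union>N. {X :: nat \<Rightarrow> int. \<forall>n. N \<le> n \<longrightarrow> X n \<in> {Z..}}) \<in> sets path_space"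
    using sets.top[of path_space] by (intro sets.countable_INT'') (auto simp: space_path_space)
  moreover have "{X :: nat \<Rightarrow> int. filterlim X at_top sequentially} =
      (\<Inter>Z. \<Union>N. {X. \<forall>n. N \<le> n \<longrightarrow> X n \<in> {Z..}})"
    by (auto simp: filterlim_at_top eventually_sequentially)
  ultimately have s: "{X :: nat \<Rightarrow> int. filterlim X at_top sequentially} \<in> sets path_space"
    by (simp only:)
  then have c: "- {X :: nat \<Rightarrow> int. filterlim X at_top sequentially} \<in> sets path_space"
    using sets.compl_sets[OF s] by (simp add: space_path_space Compl_eq_Diff_UNIV)
  have "emeasure (annealed_law P 0) (- {X. filterlim X at_top sequentially}) =
      (\<integral>\<^sup>+ \<omega>. emeasure (path_law \<omega> 0) (- {X. filterlim X at_top sequentially}) \<partial>P)"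
    by (rule emeasure_annealed_law[OF prob_space_axioms sets_P c])
  also have "\<dots> = (\<integral>\<^sup>+ \<omega>. 0 \<partial>P)"
  proof (rule nn_integral_cong_AE)
    show "AE \<omega> in P. emeasure (path_law \<omega> 0) (- {X. filterlim X at_top sequentially}) = 0"
      using transient AE_environments
    proof eventually_elim
      case (elim \<omega>)
      then have "AE X in path_law \<omega> 0. X \<notin> - {X. filterlim X at_top sequentially}"
        by simp
      then show ?case
        using c AE_iff_null_sets[of "- {X. filterlim X at_top sequentially}" "path_law \<omega> 0"]
        by (simp add: sets_path_law[OF elim(2)] null_sets_def)
    qed
  qed
  finally have "- {X. filterlim X at_top sequentially} \<in> null_sets (annealed_law P 0)"
    using c by (auto simp: sets_annealed_law)
  then show ?thesis
    by (rule AE_I') auto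
qed

text \<open>If \<open>v \<le> 0\<close>, the walk is eventually nonnegative and below
  \<open>\<epsilon> * k\<close>, so for large \<open>m\<close> it spends at least half of the first
  \<open>m\<close> steps in an interval of about \<open>\<epsilon> * m\<close> sites. Each site has
  at most \<open>c\<close> expected visits, so the mean fraction would be at most 1/4.\<close>

lemma velocity_pos:
  assumes vel: "limiting_velocity P v" and fin: "(\<integral>\<^sup>+ \<omega>. green (kern \<omega>) UNIV 0 0 \<partial>P) < \<infinity>"
  shows "0 < v"
proof (rule ccontr)
  assume "\<not> 0 < v"
  then have v: "v \<le> 0" by simp
  let ?A = "annealed_law P 0"
  interpret A: prob_space ?A
    by (rule prob_space_annealed_law)
  obtain c where c: "0 \<le> c" "(\<integral>\<^sup>+ \<omega>. green (kern \<omega>) UNIV 0 0 \<partial>P) = ennreal c"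
    using fin by (cases "\<integral>\<^sup>+ \<omega>. green (kern \<omega>) UNIV 0 0 \<partial>P") auto
  \<comment> \<open>Chosen so that \<open>\<epsilon> * c \<le> 1 / 8\<close>; the summand 1 covers
    \<open>c = 0\<close>.\<close>
  define \<epsilon> where "\<epsilon> = 1 / (8 * (c + 1))"
  have \<epsilon>: "0 < \<epsilon>"
    using c by (simp add: \<epsilon>_def)
  define S where "S m k = {X :: nat \<Rightarrow> int. X k \<in> {0..\<lfloor>\<epsilon> * real m\<rfloor>}}" for m k
  define u where "u m X = (\<Sum>k<m. indicator (S m k) X) / (of_nat m :: ennreal)" for m and X :: "nat \<Rightarrow> int"
  have S [measurable]: "S m k \<in> sets path_space" for m k
    unfolding S_def by (rule coordinate_sets_path_space)
  have u [measurable]: "u m \<in> borel_measurable ?A" for m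
    unfolding u_def using S by (simp cong: measurable_cong_sets add: sets_annealed_law)
  have "ennreal (1 / 2) = (\<integral>\<^sup>+ X. ennreal (1 / 2) \<partial>?A)"
    by (simp add: A.emeasure_space_1)
  also have "\<dots> \<le> (\<integral>\<^sup>+ X. liminf (\<lambda>m. u m X) \<partial>?A)"
  proof (rule nn_integral_mono_AE)
    show "AE X in ?A. ennreal (1 / 2) \<le> liminf (\<lambda>m. u m X)"
      using vel[unfolded limiting_velocity_def] AE_annealed_at_top
    proof eventually_elim
      case (elim X)
      have "eventually (\<lambda>k. real_of_int (X k) / real k < \<epsilon>) sequentially"
        using order_tendstoD(2)[OF elim(1), of \<epsilon>] v \<epsilon> by simp
      moreover have "eventually (\<lambda>k. 0 \<le> X k) sequentially"
        using elim(2) by (simp add: filterlim_at_top)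
      ultimately have "eventually (\<lambda>k. real_of_int (X k) / real k < \<epsilon> \<and> 0 \<le> X k \<and> 0 < k) sequentially"
        using eventually_gt_at_top[of "0::nat"] by eventually_elim auto
      then obtain M where M: "\<And>k. M \<le> k \<Longrightarrow> real_of_int (X k) / real k < \<epsilon> \<and> 0 \<le> X k \<and> 0 < k"
        by (auto simp: eventually_sequentially)
      have "eventually (\<lambda>m. ennreal (1 / 2) \<le> u m X) sequentially"
      proof (rule eventually_sequentiallyI)
        fix m assume m: "2 * M + 1 \<le> m"
        have ge: "indicator {M..<m} k \<le> (indicator (S m k) X :: ennreal)" for k
        proof (cases "k \<in> {M..<m}")
          case True
          then have "real_of_int (X k) < \<epsilon> * real k" "0 \<le> X k"
            using M[of k] by (auto simp: field_simps)
          moreover have "\<epsilon> * real k \<le> \<epsilon> * real m"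
            using True \<epsilon> by simp
          ultimately have "X \<in> S m k"
            by (auto simp: S_def le_floor_iff)
          then show ?thesis
            by (simp add: indicator_def)
        qed simp
        have "ennreal (real (m - M)) = (\<Sum>k<m. indicator {M..<m} k)"
        proof -
          have "(\<Sum>k<m. indicator {M..<m} k) = (\<Sum>k\<in>{M..<m}. 1 :: ennreal)"
            by (rule sum.mono_neutral_cong_right) auto
          then show ?thesis
            by (simp add: ennreal_of_nat_eq_real_of_nat)
        qed
        also have "\<dots> \<le> (\<Sum>k<m. indicator (S m k) X)"
          by (intro sum_mono ge)
        finally have "ennreal (real (m - M)) / of_nat m \<le> u m X"
          unfolding u_def by (rule divide_right_mono_ennreal)
        moreover have "ennreal (real (m - M)) / of_nat m = ennreal (real (m - M) / real m)"
          using m by (simp add: ennreal_of_nat_eq_real_of_nat divide_ennreal)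
        moreover have "1 / 2 \<le> real (m - M) / real m"
          using m by (simp add: field_simps of_nat_diff)
        ultimately show "ennreal (1 / 2) \<le> u m X"
          by (metis ennreal_leI order_trans)
      qed
      then show ?case
        by (rule Liminf_bounded)
    qed
  qed
  also have "\<dots> \<le> liminf (\<lambda>m. \<integral>\<^sup>+ X. u m X \<partial>?A)"
    by (rule nn_integral_liminf) simp
  also have "\<dots> \<le> limsup (\<lambda>m. \<integral>\<^sup>+ X. u m X \<partial>?A)"
    by (rule Liminf_le_Limsup) simp
  also have "\<dots> \<le> ennreal (1 / 4)"
  proof (rule Limsup_bounded, rule eventually_sequentiallyI)
    \<comment> \<open>For such \<open>m\<close> the additional end point of the interval costs at
      most another eighth.\<close>
    fix m assume m: "Suc (nat \<lceil>8 * (c + 1)\<rceil>) \<le> m"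
    then have m': "8 * (c + 1) \<le> real m"
      by linarith
    let ?N = "\<lfloor>\<epsilon> * real m\<rfloor>"
    have "(\<integral>\<^sup>+ X. (\<Sum>k<m. indicator (S m k) X) \<partial>?A) = (\<integral>\<^sup>+ \<omega>. (\<Sum>k<m. emeasure (path_law \<omega> 0) (S m k)) \<partial>P)"
    proof -
      have "(\<lambda>X. \<Sum>k<m. indicator (S m k) X :: ennreal) \<in> borel_measurable path_space"
        by measurable
      then have "(\<integral>\<^sup>+ X. (\<Sum>k<m. indicator (S m k) X) \<partial>?A) =
          (\<integral>\<^sup>+ \<omega>. \<integral>\<^sup>+ X. (\<Sum>k<m. indicator (S m k) X) \<partial>path_law \<omega> 0 \<partial>P)"
        by (rule nn_integral_annealed_law)
      also have "\<dots> = (\<integral>\<^sup>+ \<omega>. (\<Sum>k<m. emeasure (path_law \<omega> 0) (S m k)) \<partial>P)"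
        by (intro nn_integral_cong, subst nn_integral_sum)
          (auto simp: space_P sets_path_law nn_integral_path_law_indicator S intro!: borel_measurable_indicator)
      finally show ?thesis .
    qed
    also have "\<dots> \<le> (\<integral>\<^sup>+ \<omega>. (\<Sum>x\<in>{0..?N}. green (kern \<omega>) UNIV 0 x) \<partial>P)"
    proof (rule nn_integral_mono)
      fix \<omega> assume "\<omega> \<in> space P"
      then have \<omega>: "\<omega> \<in> environments"
        by (simp add: space_P)
      have "emeasure (path_law \<omega> 0) (S m k) \<le> (\<Sum>x\<in>{0..?N}. taboo (kern \<omega>) UNIV k 0 x)" for k
      proof -
        have "S m k = (\<Union>x\<in>{0..?N}. {X. X k = x})"
          by (auto simp: S_def)
        then have "emeasure (path_law \<omega> 0) (S m k) \<le> (\<Sum>x\<in>{0..?N}. emeasure (path_law \<omega> 0) {X. X k = x})"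
          by (simp only:) (rule emeasure_subadditive_finite, auto simp: sets_path_law[OF \<omega>])
        then show ?thesis
          by (simp add: emeasure_path_law_state[OF \<omega>])
      qed
      then have "(\<Sum>k<m. emeasure (path_law \<omega> 0) (S m k)) \<le> (\<Sum>k<m. \<Sum>x\<in>{0..?N}. taboo (kern \<omega>) UNIV k 0 x)"
        by (rule sum_mono)
      also have "\<dots> = (\<Sum>x\<in>{0..?N}. \<Sum>k<m. taboo (kern \<omega>) UNIV k 0 x)"
        by (rule sum.swap)
      also have "\<dots> \<le> (\<Sum>x\<in>{0..?N}. green (kern \<omega>) UNIV 0 x)"
        unfolding green_def by (intro sum_mono sum_le_suminf) auto
      finally show "(\<Sum>k<m. emeasure (path_law \<omega> 0) (S m k)) \<le> (\<Sum>x\<in>{0..?N}. green (kern \<omega>) UNIV 0 x)" .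
    qed
    also have "\<dots> = (\<Sum>x\<in>{0..?N}. \<integral>\<^sup>+ \<omega>. green (kern \<omega>) UNIV 0 x \<partial>P)"
      by (intro nn_integral_sum) simp
    also have "\<dots> \<le> (\<Sum>x\<in>{0..?N}. ennreal c)"
      unfolding c(2)[symmetric] by (intro sum_mono nn_integral_green_le)
    also have "\<dots> = ennreal (real (nat (?N + 1)) * c)"
      using c(1) by (simp add: ennreal_mult ennreal_of_nat_eq_real_of_nat)
    also have "\<dots> \<le> ennreal ((\<epsilon> * real m + 1) * c)"
    proof (intro ennreal_leI mult_right_mono c(1))
      have "0 \<le> ?N"
        using \<epsilon> by simp
      then show "real (nat (?N + 1)) \<le> \<epsilon> * real m + 1"
        by simp
    qed
    also have "\<dots> \<le> ennreal (1 / 4 * real m)"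
    proof (rule ennreal_leI)
      have "\<epsilon> * c \<le> 1 / 8"
        using c(1) by (simp add: \<epsilon>_def field_simps)
      then have "\<epsilon> * c * real m \<le> 1 / 8 * real m"
        by (rule mult_right_mono) simp
      moreover have "(\<epsilon> * real m + 1) * c = \<epsilon> * c * real m + c"
        by (simp add: algebra_simps)
      moreover have "a + c \<le> 1 / 4 * b" if "a \<le> 1 / 8 * b" "8 * (c + 1) \<le> b" for a b :: real
        using that by simp
      ultimately show "(\<epsilon> * real m + 1) * c \<le> 1 / 4 * real m"
        using m' by metis
    qed
    finally have *: "(\<integral>\<^sup>+ X. (\<Sum>k<m. indicator (S m k) X) \<partial>?A) \<le> ennreal (1 / 4 * real m)" .
    have "(\<integral>\<^sup>+ X. u m X \<partial>?A) = (\<integral>\<^sup>+ X. (\<Sum>k<m. indicator (S m k) X) \<partial>?A) / of_nat m"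
      unfolding u_def using S by (intro nn_integral_divide) (simp cong: measurable_cong_sets add: sets_annealed_law)
    also have "\<dots> \<le> ennreal (1 / 4 * real m) / of_nat m"
      by (rule divide_right_mono_ennreal[OF *])
    also have "\<dots> = ennreal (1 / 4)"
      using m by (simp add: ennreal_of_nat_eq_real_of_nat divide_ennreal)
    finally show "(\<integral>\<^sup>+ X. u m X \<partial>?A) \<le> ennreal (1 / 4)" .
  qed
  finally have "ennreal (1 / 2) \<le> ennreal (1 / 4)" .
  then have "1 / 2 \<le> (1 / 4 :: real)"
    by (subst (asm) ennreal_le_iff) auto
  then show False
    by simp
qed

text \<open>The walk from the left enters \<open>{w..}\<close> in \<open>{w..<w + R}\<close>, and a walk that leaves \<open>{w + L..}\<close> to the
  left lands in \<open>{w..<w + L}\<close>. The event only concerns the environment on \<open>{..<w + L + m}\<close>, so that it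
  is independent of what has been explored from the right.\<close>

definition stuck :: "ennreal \<Rightarrow> nat \<Rightarrow> int \<Rightarrow> env set" where
  "stuck c m w = {\<omega> \<in> space P. \<exists>z\<in>{w..<w + R}. \<exists>y\<in>{w..<w + L}. green (kern \<omega>) ({..<w + L + int m} - {y}) z y < c}"

lemma stuck_rows: "stuck c m w \<in> sets (rows {..<w + L + int m})"
proof -
  have "{\<omega> \<in> space (rows {..<w + L + int m}). \<exists>z\<in>{w..<w + R}. \<exists>y\<in>{w..<w + L}.
      green (kern \<omega>) ({..<w + L + int m} - {y}) z y < c} \<in> sets (rows {..<w + L + int m})"
    by (intro sets.sets_Collect_finite_Ex borel_measurable_less measurable_green_rows(1) measurable_const) auto
  then show ?thesis
    by (simp add: stuck_def space_P)
qed

lemma stuck_sets [measurable]: "stuck c m w \<in> sets P"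
  using stuck_rows rows_subset by blast

lemma emeasure_stuck: "emeasure P (stuck c m w) = emeasure P (stuck c m 0)"
proof -
  let ?\<Phi> = "\<lambda>\<kappa>. indicator {\<kappa>. \<exists>z\<in>{0..<R}. \<exists>y\<in>{0..<L}. green \<kappa> ({..<L + int m} - {y}) z y < c} \<kappa> :: ennreal"
  let ?S = "Pi\<^sub>M UNIV (\<lambda>_::int. borel :: (int \<Rightarrow> real) measure)"
  have "(\<lambda>\<rho>. ?\<Phi> (\<lambda>u v. ennreal (\<rho> u (v - u)))) = indicator {\<rho> \<in> space ?S. \<exists>z\<in>{0..<R}. \<exists>y\<in>{0..<L}.
      green (\<lambda>u v. ennreal (\<rho> u (v - u))) ({..<L + int m} - {y}) z y < c}"
    by (rule ext) (simp add: indicator_def space_PiM)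
  moreover have "{\<rho> \<in> space ?S. \<exists>z\<in>{0..<R}. \<exists>y\<in>{0..<L}.
      green (\<lambda>u v. ennreal (\<rho> u (v - u))) ({..<L + int m} - {y}) z y < c} \<in> sets ?S"
    by (intro sets.sets_Collect_finite_Ex borel_measurable_less) auto
  ultimately have "(\<integral>\<^sup>+ \<omega>. ?\<Phi> (\<lambda>u v. kern \<omega> (u + w) (v + w)) \<partial>P) = (\<integral>\<^sup>+ \<omega>. ?\<Phi> (kern \<omega>) \<partial>P)"
    by (intro nn_integral_shift) simp
  moreover have "?\<Phi> (\<lambda>u v. kern \<omega> (u + w) (v + w)) = indicator (stuck c m w) \<omega>" if "\<omega> \<in> space P" for \<omega>
  proof -
    have "green (\<lambda>u v. kern \<omega> (u + w) (v + w)) ({..<L + int m} - {y}) z y =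
        green (kern \<omega>) ({..<w + L + int m} - {y + w}) (z + w) (y + w)" for z y
    proof -
      have "{d. d + w \<in> {..<w + L + int m} - {y + w}} = {..<L + int m} - {y}"
        by auto
      then show ?thesis
        using green_shift[of "kern \<omega>" w "{..<w + L + int m} - {y + w}" z y] by simp
    qed
    moreover have "(\<exists>z\<in>U. \<exists>y\<in>V. Q (z + w) (y + w)) \<longleftrightarrow> (\<exists>z\<in>(\<lambda>z. z + w) ` U. \<exists>y\<in>(\<lambda>y. y + w) ` V. Q z y)"
      for U V and Q :: "int \<Rightarrow> int \<Rightarrow> bool"
      by simp
    ultimately have "(\<exists>z\<in>{0..<R}. \<exists>y\<in>{0..<L}. green (\<lambda>u v. kern \<omega> (u + w) (v + w)) ({..<L + int m} - {y}) z y < c) \<longleftrightarrow>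
        (\<exists>z\<in>(\<lambda>z. z + w) ` {0..<R}. \<exists>y\<in>(\<lambda>y. y + w) ` {0..<L}. green (kern \<omega>) ({..<w + L + int m} - {y}) z y < c)"
      by (simp only:)
    also have "(\<lambda>z. z + w) ` {0..<R} = {w..<w + R}"
      by (simp add: add.commute)
    also have "(\<lambda>y. y + w) ` {0..<L} = {w..<w + L}"
      by (simp add: add.commute)
    finally show ?thesis
      using that by (simp add: indicator_def stuck_def)
  qed
  moreover have "?\<Phi> (kern \<omega>) = indicator (stuck c m 0) \<omega>" if "\<omega> \<in> space P" for \<omega>
    using that by (simp add: indicator_def stuck_def)
  ultimately have "(\<integral>\<^sup>+ \<omega>. indicator (stuck c m w) \<omega> \<partial>P) = (\<integral>\<^sup>+ \<omega>. indicator (stuck c m 0) \<omega> \<partial>P)"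
    by (simp cong: nn_integral_cong)
  then show ?thesis
    by simp
qed

text \<open>Both parameters run along one index: \<open>m = i\<close> and
  \<open>c = 1 / (i + 1)\<close>. The events decrease, and their intersection is null because the
  finitely many hitting probabilities increase to limits that irreducibility makes positive.
  Stationarity makes the bound uniform in \<open>w\<close>.\<close>

lemma ex_stuck_small:
  assumes "0 < \<theta>"
  obtains m and c :: real where "0 < c" "\<And>w. emeasure P (stuck (ennreal c) m w) \<le> ennreal \<theta>"
proof -
  define c where "c i = 1 / real (Suc i)" for i
  define A where "A i = stuck (ennreal (c i)) i 0" for i
  have A [measurable]: "A i \<in> sets P" for i
    unfolding A_def by measurable
  have dec: "A (Suc i) \<subseteq> A i" for i
  proof -
    have "green (kern \<omega>) ({..<0 + L + int i} - {y}) z y \<le> green (kern \<omega>) ({..<0 + L + int (Suc i)} - {y}) z y" for \<omega> z y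
      by (intro green_mono) auto
    moreover have "ennreal (c (Suc i)) \<le> ennreal (c i)"
      unfolding c_def by (intro ennreal_leI frac_le) auto
    ultimately show ?thesis
      unfolding A_def stuck_def by (blast intro: le_less_trans less_le_trans)
  qed
  then have "decseq A"
    by (rule decseq_SucI)
  have "AE \<omega> in P. \<omega> \<notin> (\<Inter>i. A i)"
    using AE_hit_pos
  proof eventually_elim
    case (elim \<omega>)
    have ev: "eventually (\<lambda>i. ennreal (c i) \<le> green (kern \<omega>) ({..<0 + L + int i} - {y}) z y) sequentially" for z y
    proof -
      have inc: "incseq (\<lambda>i. {..<0 + L + int i} - {y})"
        by (auto simp: mono_def)
      have "(\<Union>i. {..<0 + L + int i} - {y}) = - {y}"
      proof -
        have "x \<in> {..<0 + L + int (nat \<bar>x\<bar>)}" for x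
          using L_pos by auto
        then show ?thesis
          by blast
      qed
      then have "(SUP i. green (kern \<omega>) ({..<0 + L + int i} - {y}) z y) = green (kern \<omega>) (- {y}) z y"
        using green_SUP_sets[OF inc, of "kern \<omega>" z y] by simp
      then have lim: "(\<lambda>i. green (kern \<omega>) ({..<0 + L + int i} - {y}) z y) \<longlonglongrightarrow> green (kern \<omega>) (- {y}) z y"
        using LIMSEQ_SUP[of "\<lambda>i. green (kern \<omega>) ({..<0 + L + int i} - {y}) z y"] inc
        by (auto simp: mono_def intro!: green_mono)
      obtain a where a: "0 < a" "a < green (kern \<omega>) (- {y}) z y"
        using dense[of 0 "green (kern \<omega>) (- {y}) z y"] elim by auto
      have "(\<lambda>i. ennreal (c i)) \<longlonglongrightarrow> ennreal 0"
        unfolding c_def by (intro tendsto_ennrealI LIMSEQ_Suc[OF lim_1_over_n])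
      then have "eventually (\<lambda>i. ennreal (c i) < a) sequentially"
        using a(1) by (intro order_tendstoD(2)) auto
      moreover have "eventually (\<lambda>i. a < green (kern \<omega>) ({..<0 + L + int i} - {y}) z y) sequentially"
        using lim a(2) by (rule order_tendstoD(1))
      ultimately show ?thesis
        by eventually_elim auto
    qed
    have "eventually (\<lambda>i. \<forall>z\<in>{0..<0 + R}. \<forall>y\<in>{0..<0 + L}. ennreal (c i) \<le> green (kern \<omega>) ({..<0 + L + int i} - {y}) z y) sequentially"
      by (intro eventually_ball_finite ballI ev) auto
    then obtain i where "\<forall>z\<in>{0..<0 + R}. \<forall>y\<in>{0..<0 + L}. ennreal (c i) \<le> green (kern \<omega>) ({..<0 + L + int i} - {y}) z y"
      by (auto simp: eventually_sequentially)
    then have "\<omega> \<notin> A i"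
      by (auto simp: A_def stuck_def not_less)
    then show ?case
      by blast
  qed
  then have "emeasure P (\<Inter>i. A i) = 0"
    using AE_iff_null_sets[of "\<Inter>i. A i" P] by (auto simp: null_sets_def)
  then have "(\<lambda>i. emeasure P (A i)) \<longlonglongrightarrow> 0"
    using Lim_emeasure_decseq[of A P] \<open>decseq A\<close> A by (simp add: image_subset_iff)
  then have "eventually (\<lambda>i. emeasure P (A i) < ennreal \<theta>) sequentially"
    using assms by (intro order_tendstoD(2)) auto
  then obtain i where "emeasure P (A i) < ennreal \<theta>"
    by (auto simp: eventually_sequentially)
  then have "emeasure P (stuck (ennreal (c i)) i w) \<le> ennreal \<theta>" for w
    using emeasure_stuck[of "ennreal (c i)" i w] by (simp add: A_def)
  moreover have "0 < c i"
    by (simp add: c_def)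
  ultimately show ?thesis
    by (rule that[rotated])
qed

section \<open>Conditioning on the explored part and entrance from the left\<close>

lemma subalgebra_rows: "subalgebra P (rows A)"
  by (simp add: subalgebra_def space_P rows_subset)

lemma sigma_finite_subalgebra_rows: "sigma_finite_subalgebra P (rows A)"
  by (intro finite_measure_subalgebra_is_sigma_finite)
    (simp add: finite_measure_subalgebra_def finite_measure_subalgebra_axioms_def subalgebra_rows finite_measure_axioms)

text \<open>That a walk from \<open>- x\<close> enters \<open>{- k..}\<close> at \<open>- k\<close>
  depends only on sites left of \<open>- k\<close>, so it is independent of \<open>B\<close> and of
  the way on to 0 inside \<open>{- k..}\<close>. Its mean is \<open>record_prob (x - k)\<close>, and
  summing over \<open>x\<close> collects at least one unit per window of \<open>R\<close>
  sites.\<close>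

lemma hit_average_ge_entrance:
  assumes n: "2 * (int k + R) \<le> int n" and B: "B \<in> sets (rows {- int k..})"
  shows "ennreal (1 / (4 * real_of_int R)) *
      (\<integral>\<^sup>+ \<omega>. green (kern \<omega>) ({- int k..} - {0}) (- int k) 0 * indicator B \<omega> \<partial>P) \<le>
    (\<integral>\<^sup>+ \<omega>. hit_average n \<omega> * indicator B \<omega> \<partial>P)"
proof -
  let ?f = "\<lambda>\<omega>. green (kern \<omega>) ({- int k..} - {0}) (- int k) 0 * indicator B \<omega>"
  let ?e = "\<lambda>x \<omega>. green (kern \<omega>) {..<- int k} (- int x) (- int k)"
  have BP [measurable]: "B \<in> sets P"
    using B rows_subset by blast
  have fm: "?f \<in> borel_measurable (rows {- int k..})"
    using B by (intro borel_measurable_times_ennreal measurable_green_rows borel_measurable_indicator) auto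
  have mult: "(\<integral>\<^sup>+ \<omega>. ?e x \<omega> * ?f \<omega> \<partial>P) = record_prob (int x - int k) * (\<integral>\<^sup>+ \<omega>. ?f \<omega> \<partial>P)" for x
  proof -
    have "(\<integral>\<^sup>+ \<omega>. ?e x \<omega> * ?f \<omega> \<partial>P) = (\<integral>\<^sup>+ \<omega>. ?e x \<omega> \<partial>P) * (\<integral>\<^sup>+ \<omega>. ?f \<omega> \<partial>P)"
      by (rule nn_integral_rows_mult[where A = "{..<- int k}" and B = "{- int k..}", OF _ measurable_green_rows(1) fm]) auto
    moreover have "{d. d + - int x \<in> {..<- int k}} = {..<int x - int k}"
      by auto
    then have "(\<integral>\<^sup>+ \<omega>. ?e x \<omega> \<partial>P) = record_prob (int x - int k)"
      using nn_integral_green_shift[of "{..<- int k}" 0 "- int x" "int x - int k"] by (simp add: record_prob_def)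
    ultimately show ?thesis
      by simp
  qed
  \<comment> \<open>The number of disjoint windows of length \<open>R\<close> that fit into the
    starting points beyond \<open>- k\<close>.\<close>
  define q where "q = (n - k) div nat R"
  have "of_nat q \<le> (\<Sum>z\<in>{1..<1 + int q * R}. record_prob z)"
    by (rule record_prob_sum)
  also have "\<dots> \<le> (\<Sum>x\<in>{Suc k..n}. record_prob (int x - int k))"
  proof -
    have "int q * R \<le> int n - int k"
    proof -
      have "q * nat R \<le> n - k"
        by (simp add: q_def)
      then have "int q * int (nat R) \<le> int (n - k)"
        by (metis of_nat_le_iff of_nat_mult)
      then show ?thesis
        using n R_pos by (simp add: of_nat_diff)
    qed
    then have "{1..<1 + int q * R} \<subseteq> (\<lambda>x. int x - int k) ` {Suc k..n}"
    proof (intro subsetI)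
      fix z assume "z \<in> {1..<1 + int q * R}"
      then have "z = int (nat (z + int k)) - int k" "nat (z + int k) \<in> {Suc k..n}"
        using \<open>int q * R \<le> int n - int k\<close> by auto
      then show "z \<in> (\<lambda>x. int x - int k) ` {Suc k..n}"
        by (rule image_eqI)
    qed
    then have "(\<Sum>z\<in>{1..<1 + int q * R}. record_prob z) \<le> (\<Sum>z\<in>(\<lambda>x. int x - int k) ` {Suc k..n}. record_prob z)"
      by (intro sum_mono2) auto
    also have "\<dots> = (\<Sum>x\<in>{Suc k..n}. record_prob (int x - int k))"
      by (subst sum.reindex) (auto simp: inj_on_def)
    finally show ?thesis .
  qed
  finally have e: "of_nat q \<le> (\<Sum>x\<in>{Suc k..n}. record_prob (int x - int k))" .
  have "of_nat q * (\<integral>\<^sup>+ \<omega>. ?f \<omega> \<partial>P) \<le> (\<Sum>x\<in>{Suc k..n}. record_prob (int x - int k)) * (\<integral>\<^sup>+ \<omega>. ?f \<omega> \<partial>P)"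
    by (rule mult_right_mono[OF e]) simp
  also have "\<dots> = (\<integral>\<^sup>+ \<omega>. (\<Sum>x\<in>{Suc k..n}. ?e x \<omega> * ?f \<omega>) \<partial>P)"
    by (simp add: nn_integral_sum mult sum_distrib_right)
  also have "\<dots> \<le> (\<integral>\<^sup>+ \<omega>. (\<Sum>x=1..n. green (kern \<omega>) (- {0}) (- int x) 0) * indicator B \<omega> \<partial>P)"
  proof (rule nn_integral_mono)
    fix \<omega>
    have "(\<Sum>x\<in>{Suc k..n}. ?e x \<omega> * ?f \<omega>) \<le> (\<Sum>x\<in>{Suc k..n}. green (kern \<omega>) (- {0}) (- int x) 0 * indicator B \<omega>)"
    proof (rule sum_mono)
      fix x
      have "?e x \<omega> * green (kern \<omega>) ({- int k..} - {0}) (- int k) 0 \<le>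
          ?e x \<omega> * green (kern \<omega>) (- {0}) (- int k) 0"
        by (intro mult_left_mono green_mono) auto
      also have "\<dots> \<le> green (kern \<omega>) (- {0}) (- int x) 0"
        by (rule green_mult_le) auto
      finally show "?e x \<omega> * ?f \<omega> \<le> green (kern \<omega>) (- {0}) (- int x) 0 * indicator B \<omega>"
        by (simp add: mult_right_mono flip: mult.assoc)
    qed
    also have "\<dots> \<le> (\<Sum>x=1..n. green (kern \<omega>) (- {0}) (- int x) 0 * indicator B \<omega>)"
      by (rule sum_mono2) auto
    finally show "(\<Sum>x\<in>{Suc k..n}. ?e x \<omega> * ?f \<omega>) \<le> (\<Sum>x=1..n. green (kern \<omega>) (- {0}) (- int x) 0) * indicator B \<omega>"
      by (simp add: sum_distrib_right)
  qed
  finally have main: "of_nat q * (\<integral>\<^sup>+ \<omega>. ?f \<omega> \<partial>P) \<le>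
      (\<integral>\<^sup>+ \<omega>. (\<Sum>x=1..n. green (kern \<omega>) (- {0}) (- int x) 0) * indicator B \<omega> \<partial>P)" .
  have n0: "0 < n"
    using n R_pos by auto
  \<comment> \<open>From \<open>n - k < (q + 1) * R\<close> and \<open>2 * (k + R) \<le> n\<close>
    one gets \<open>n < 2 * q * R\<close>; the factor 4 leaves room.\<close>
  have "real_of_int R * real n \<le> 4 * real_of_int R * (real q * real_of_int R)"
  proof -
    have "int n - int k < int (Suc q) * R"
    proof -
      have "n - k < Suc q * nat R"
        using R_pos by (simp add: q_def dividend_less_div_times)
      then have "int (n - k) < int (Suc q) * int (nat R)"
        by (metis of_nat_less_iff of_nat_mult)
      then show ?thesis
        using n R_pos by (simp add: of_nat_diff)
    qed
    then have "int n \<le> 4 * (int q * R)"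
      using n by (simp add: algebra_simps)
    then have "real n \<le> 4 * (real q * real_of_int R)"
      by (metis (mono_tags, lifting) of_int_le_iff of_int_mult of_int_numeral of_int_of_nat_eq)
    then show ?thesis
      using R_pos by (simp add: mult_left_mono mult.left_commute)
  qed
  then have "1 / (4 * real_of_int R) \<le> real q / real n"
    using n0 R_pos by (simp add: field_simps)
  then have "ennreal (1 / (4 * real_of_int R)) \<le> of_nat q / of_nat n"
    using n0 by (simp add: ennreal_of_nat_eq_real_of_nat divide_ennreal ennreal_leI)
  then have "ennreal (1 / (4 * real_of_int R)) * (\<integral>\<^sup>+ \<omega>. ?f \<omega> \<partial>P) \<le> of_nat q / of_nat n * (\<integral>\<^sup>+ \<omega>. ?f \<omega> \<partial>P)"
    by (rule mult_right_mono) simp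
  also have "\<dots> = of_nat q * (\<integral>\<^sup>+ \<omega>. ?f \<omega> \<partial>P) / of_nat n"
    by (simp add: divide_ennreal_def mult_ac)
  also have "\<dots> \<le> (\<integral>\<^sup>+ \<omega>. (\<Sum>x=1..n. green (kern \<omega>) (- {0}) (- int x) 0) * indicator B \<omega> \<partial>P) / of_nat n"
    by (rule divide_right_mono_ennreal[OF main])
  also have "\<dots> = (\<integral>\<^sup>+ \<omega>. (\<Sum>x=1..n. green (kern \<omega>) (- {0}) (- int x) 0) * indicator B \<omega> / of_nat n \<partial>P)"
    by (rule nn_integral_divide[symmetric]) measurable
  also have "\<dots> = (\<integral>\<^sup>+ \<omega>. hit_average n \<omega> * indicator B \<omega> \<partial>P)"
    by (simp add: hit_average_def divide_ennreal_def mult_ac)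
  finally show ?thesis .
qed

end

section \<open>Comparison of the visits with the hitting probability\<close>

text \<open>Split at the exit from \<open>E\<close>: from every exit point the walk comes back to
  \<open>y\<close> within \<open>D\<close> with probability at most \<open>a\<close>, and the total
  exit mass is at most 1. Demanding the bound only where the exit Green function is nonzero lets
  bounded jumps confine the exit points.\<close>

lemma green_extend_le:
  assumes \<kappa>: "substochastic \<kappa>" and E: "E \<subseteq> D" "y \<in> E"
    and a: "\<And>z. z \<notin> E \<Longrightarrow> green \<kappa> E y z \<noteq> 0 \<Longrightarrow> green \<kappa> (D - {y}) z y \<le> a"
  shows "green \<kappa> D y y \<le> green \<kappa> E y y + a * green \<kappa> D y y"
proof -
  have y: "y \<in> D"
    using E by auto
  have "zsum (\<lambda>z. indicator (- E) z * green \<kappa> E y z * green \<kappa> D z y) \<le>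
      zsum (\<lambda>z. indicator (- E) z * green \<kappa> E y z * (a * green \<kappa> D y y))"
  proof (rule nn_integral_mono)
    fix z
    show "indicator (- E) z * green \<kappa> E y z * green \<kappa> D z y \<le> indicator (- E) z * green \<kappa> E y z * (a * green \<kappa> D y y)"
    proof (cases "z \<notin> E \<and> green \<kappa> E y z \<noteq> 0")
      case True
      then show ?thesis
        unfolding green_hit[OF y, of \<kappa> z] using a[of z] by (intro mult_left_mono mult_right_mono) auto
    qed (auto simp: indicator_def)
  qed
  also have "\<dots> = zsum (\<lambda>z. indicator (- E) z * green \<kappa> E y z) * (a * green \<kappa> D y y)"
    by (rule zsum_multc)
  also have "\<dots> \<le> 1 * (a * green \<kappa> D y y)"
    by (intro mult_right_mono zsum_green_exit_le_1 \<kappa>) simp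
  finally show ?thesis
    using green_split[OF E(1), of \<kappa> y y] E(2) by (simp add: add_left_mono)
qed

lemma substochastic_discount:
  assumes "substochastic \<kappa>" "s \<le> 1"
  shows "substochastic (\<lambda>u v. ennreal s * \<kappa> u v)"
  unfolding substochastic_def
proof
  fix x
  have "zsum (\<lambda>v. ennreal s * \<kappa> x v) \<le> 1 * zsum (\<kappa> x)"
    unfolding zsum_cmult using assms(2) by (intro mult_right_mono) (auto simp: ennreal_le_1)
  also have "\<dots> \<le> 1"
    using assms(1) by (simp add: substochastic_def)
  finally show "zsum (\<lambda>v. ennreal s * \<kappa> x v) \<le> 1" .
qed

lemma discount_le:
  assumes "s \<le> 1"
  shows "ennreal s * a \<le> a"
  using mult_right_mono[of "ennreal s" 1 a] assms by (simp add: ennreal_le_1)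

context rwre
begin

text \<open>A walk that leaves \<open>{- l..}\<close> to the left lands in \<open>{entrance_level l..<- l}\<close>.\<close>

definition entrance_level :: "nat \<Rightarrow> int" where
  "entrance_level l = - int l - L"

text \<open>The threshold 1/2 matches a doubling of \<open>g\<close>: if all return probabilities
  from the window are at most 1/2, then \<open>G \<le> g + G / 2\<close>.\<close>

definition reachable :: "nat \<Rightarrow> env set" where
  "reachable l = {\<omega> \<in> space P. \<exists>y\<in>{entrance_level l..<entrance_level l + L}. ennreal (1 / 2) < green (kern \<omega>) (- {0}) y 0}"

lemma reachable_sets [measurable]: "reachable l \<in> sets P"
  unfolding reachable_def
  by (intro sets.sets_Collect_finite_Ex borel_measurable_less green_measurable measurable_const) auto

text \<open>From \<open>- x\<close> left of the window the walk surely enters one of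
  \<open>R\<close> sites, from each of these reaches \<open>y\<close> with probability at least
  \<open>c\<close>, and from \<open>y\<close> hits 0 with probability above 1/2. At least half of
  the starting points lie that far left.\<close>

lemma AE_hit_average_ge:
  assumes c: "0 < c" and n: "2 * (int (k + m) + L) \<le> int n" "0 < n"
  shows "AE \<omega> in P. \<omega> \<in> reachable (k + m) - stuck (ennreal c) m (entrance_level (k + m)) \<longrightarrow>
    ennreal (c / 4) \<le> hit_average n \<omega>"
  using AE_exit_window
proof eventually_elim
  case (elim \<omega>)
  note exit = this
  let ?w = "entrance_level (k + m)"
  have ?case if "\<omega> \<in> reachable (k + m) - stuck (ennreal c) m ?w"
  proof -
  from that obtain y where y: "?w \<le> y" "y < ?w + L" "ennreal (1 / 2) < green (kern \<omega>) (- {0}) y 0"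
    and st: "\<omega> \<in> space P" "\<omega> \<notin> stuck (ennreal c) m ?w"
    by (auto simp: reachable_def)
  define D where "D = {..<- int k} - {y}"
  \<comment> \<open>The set used in \<open>stuck\<close> ends exactly where the explored part
    \<open>{- k..}\<close> begins.\<close>
  have "?w + L + int m = - int k"
    by (simp add: entrance_level_def)
  then have cz: "ennreal c \<le> green (kern \<omega>) D z y" if "z \<in> {?w..<?w + R}" for z
    using st that y by (auto simp: stuck_def D_def not_less)
  have yk: "y < - int k"
    using y by (simp add: entrance_level_def)
  have hit: "ennreal (c / 2) \<le> green (kern \<omega>) (- {0}) (- int x) 0" if x: "- int x < ?w" for x
  proof -
    have "ennreal c = (\<Sum>z\<in>{?w..<?w + R}. green (kern \<omega>) {..<?w} (- int x) z) * ennreal c"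
      using exit x by simp
    also have "\<dots> = (\<Sum>z\<in>{?w..<?w + R}. indicator {?w..<?w + R} z * (green (kern \<omega>) {..<?w} (- int x) z * ennreal c))"
      unfolding sum_distrib_right by (intro sum.cong) auto
    also have "\<dots> = zsum (\<lambda>z. indicator {?w..<?w + R} z * (green (kern \<omega>) {..<?w} (- int x) z * ennreal c))"
      by (rule zsum_window[symmetric]) simp
    also have "\<dots> \<le> zsum (\<lambda>z. indicator (- {..<?w}) z * green (kern \<omega>) {..<?w} (- int x) z * green (kern \<omega>) D z y)"
    proof (rule nn_integral_mono)
      fix z
      show "indicator {?w..<?w + R} z * (green (kern \<omega>) {..<?w} (- int x) z * ennreal c) \<le>
          indicator (- {..<?w}) z * green (kern \<omega>) {..<?w} (- int x) z * green (kern \<omega>) D z y"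
        using cz[of z] by (auto simp: indicator_def intro!: mult_left_mono)
    qed
    also have "\<dots> \<le> green (kern \<omega>) D (- int x) y"
    proof -
      have "{..<?w} \<subseteq> D"
        using y L_pos by (auto simp: D_def entrance_level_def)
      from green_split[OF this, of "kern \<omega>" "- int x" y] show ?thesis
        by simp
    qed
    finally have "ennreal c * ennreal (1 / 2) \<le> green (kern \<omega>) D (- int x) y * green (kern \<omega>) (- {0}) y 0"
      by (intro mult_mono less_imp_le[OF y(3)]) auto
    also have "\<dots> \<le> green (kern \<omega>) (- {0}) (- int x) 0"
      by (rule green_mult_le) (auto simp: D_def)
    also have "ennreal c * ennreal (1 / 2) = ennreal (c / 2)"
      using c by (subst ennreal_mult[symmetric]) auto
    finally show ?thesis .
  qed
  let ?a = "k + m + nat L"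
  have a: "2 * ?a \<le> n"
  proof -
    have "int (2 * ?a) \<le> int n"
      using n(1) L_pos by simp
    then show ?thesis
      by (simp only: of_nat_le_iff)
  qed
  have "ennreal (real n * (c / 4)) \<le> ennreal (real (n - ?a) * (c / 2))"
  proof (rule ennreal_leI)
    have "real n / 2 \<le> real (n - ?a)"
      using a by (simp add: of_nat_diff)
    then have "real n / 2 * (c / 2) \<le> real (n - ?a) * (c / 2)"
      using c by (intro mult_right_mono) auto
    then show "real n * (c / 4) \<le> real (n - ?a) * (c / 2)"
      by simp
  qed
  also have "\<dots> = (\<Sum>x\<in>{Suc ?a..n}. ennreal (c / 2))"
    using c by (subst ennreal_mult) (auto simp: ennreal_of_nat_eq_real_of_nat)
  also have "\<dots> \<le> (\<Sum>x\<in>{Suc ?a..n}. green (kern \<omega>) (- {0}) (- int x) 0)"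
    using L_pos by (intro sum_mono hit) (auto simp: entrance_level_def)
  also have "\<dots> \<le> (\<Sum>x=1..n. green (kern \<omega>) (- {0}) (- int x) 0)"
    by (rule sum_mono2) auto
  finally have "ennreal (real n * (c / 4)) / of_nat n \<le> hit_average n \<omega>"
    unfolding hit_average_def by (rule divide_right_mono_ennreal)
  then show ?thesis
    using n(2) c by (simp add: ennreal_of_nat_eq_real_of_nat divide_ennreal)
  qed
  then show ?case
    by blast
qed

text \<open>Bounded jumps make the walk leave \<open>{- l..}\<close> into the window of
  \<open>L\<close> sites; outside \<open>reachable l\<close>, \<open>green_extend_le\<close> applies
  with \<open>a = 1 / 2\<close>.\<close>

lemma AE_jump_reachable:
  assumes s: "0 \<le> s" "s < 1" and l: "l \<le> N"
  shows "AE \<omega> in P. 2 * green (\<lambda>u v. ennreal s * kern \<omega> u v) {- int l..} 0 0 <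
      green (\<lambda>u v. ennreal s * kern \<omega> u v) {- int N..} 0 0 \<longrightarrow> \<omega> \<in> reachable l"
  using AE_kern_eq_0 AE_environments
proof eventually_elim
  case (elim \<omega>)
  note k0 = elim(1) and \<omega> = elim(2)
  let ?\<kappa> = "\<lambda>u v. ennreal s * kern \<omega> u v"
  let ?D = "{- int N..}" and ?E = "{- int l..}"
  have False if jump: "2 * green ?\<kappa> ?E 0 0 < green ?\<kappa> ?D 0 0" and nr: "\<omega> \<notin> reachable l"
  proof -
  have "green ?\<kappa> ?D 0 0 \<le> green ?\<kappa> ?E 0 0 + ennreal (1 / 2) * green ?\<kappa> ?D 0 0"
  proof (rule green_extend_le)
    show "substochastic ?\<kappa>"
      using s \<omega> by (intro substochastic_discount substochastic_kern) auto
    fix z assume z: "z \<notin> ?E" "green ?\<kappa> ?E 0 z \<noteq> 0"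
    have "z \<in> {entrance_level l..<entrance_level l + L}"
    proof (rule ccontr)
      assume "z \<notin> {entrance_level l..<entrance_level l + L}"
      then have "green ?\<kappa> ?E 0 z = 0"
        using z(1) k0 by (intro green_zero) (auto simp: entrance_level_def)
      then show False
        using z(2) by simp
    qed
    then have "green (kern \<omega>) (- {0}) z 0 \<le> ennreal (1 / 2)"
      using nr \<omega> by (auto simp: reachable_def space_P not_less)
    moreover have "green ?\<kappa> (?D - {0}) z 0 \<le> green (kern \<omega>) (- {0}) z 0"
      using s by (intro green_mono discount_le) auto
    ultimately show "green ?\<kappa> (?D - {0}) z 0 \<le> ennreal (1 / 2)"
      by (rule order_trans[rotated])
  qed (use l in auto)
  \<comment> \<open>The discount makes the Green functions finite, so that half of the left side can
    be subtracted.\<close>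
  moreover have "green ?\<kappa> ?D 0 0 \<le> ennreal (1 / (1 - s))"
    using s by (intro green_discount_le substochastic_kern \<omega>)
  then obtain d where d: "0 \<le> d" "green ?\<kappa> ?D 0 0 = ennreal d"
    by (cases "green ?\<kappa> ?D 0 0") (auto simp: top_unique)
  moreover have "green ?\<kappa> ?E 0 0 \<le> green ?\<kappa> ?D 0 0"
    using l by (intro green_mono) auto
  then obtain e where e: "0 \<le> e" "green ?\<kappa> ?E 0 0 = ennreal e"
    using d by (cases "green ?\<kappa> ?E 0 0") (auto simp: top_unique)
  moreover have "ennreal (1 / 2) * ennreal d = ennreal (d / 2)"
    using d(1) by (subst ennreal_mult[symmetric]) auto
  moreover have "2 * ennreal e = ennreal (2 * e)"
    using e(1) by (simp add: ennreal_mult)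
  ultimately show False
    using jump by (auto simp: ennreal_less_iff simp flip: ennreal_plus)
  qed
  then show ?case
    by blast
qed

lemma nn_integral_cond_exp:
  assumes "B \<in> sets (rows A)" "f \<in> borel_measurable P"
  shows "(\<integral>\<^sup>+ \<omega>. nn_cond_exp P (rows A) f \<omega> * indicator B \<omega> \<partial>P) = (\<integral>\<^sup>+ \<omega>. f \<omega> * indicator B \<omega> \<partial>P)"
  using sigma_finite_subalgebra.nn_cond_exp_intg[OF sigma_finite_subalgebra_rows, of "indicator B" A f] assms
  by (simp add: mult.commute)

text \<open>Instantiates \<open>good_levels\<close>. The bound \<open>c0 / 64\<close> on \<delta>
  controls returns from beyond the gap, the other one single bad steps; neither involves
  \<open>s\<close>, \<open>N\<close> or \<open>n\<close>.\<close>

lemma discounted_mean_bound: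
  assumes s: "0 \<le> s" "s < 1" and c0: "0 < c0"
    and stuck: "\<And>w. emeasure P (stuck (ennreal c0) m w) \<le> ennreal (1 / 16)"
    and \<delta>: "0 < \<delta>" "\<delta> \<le> c0 / 64" "\<delta> \<le> 1 / (4 * real_of_int R) * (1 - 1 / c)"
    and c: "1 < c" "c ^ Suc m \<le> 2" and n: "2 * (int N + int m + L + R) \<le> int n"
  shows "ennreal \<delta> * (\<integral>\<^sup>+ \<omega>. green (\<lambda>u v. ennreal s * kern \<omega> u v) {- int N..} 0 0 \<partial>P) \<le>
    of_nat (8 * Suc m) * (\<integral>\<^sup>+ \<omega>. hit_average n \<omega> * green (\<lambda>u v. ennreal s * kern \<omega> u v) {- int N..} 0 0 \<partial>P)"
proof -
  define hb where "hb = 1 / (4 * real_of_int R)"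
  have hb: "0 < hb"
    using R_pos by (simp add: hb_def)
  let ?F = "hit_average n"
  let ?\<F> = "\<lambda>k. rows {- int k..}"
  let ?g = "\<lambda>k \<omega>. green (\<lambda>u v. ennreal s * kern \<omega> u v) {- int k..} 0 0"
  define f where "f k \<omega> = green (kern \<omega>) ({- int k..} - {0}) (- int k) 0" for k \<omega>
  define M where "M k = nn_cond_exp P (?\<F> k) ?F" for k
  \<comment> \<open>Either condition gives \<open>?F\<close> mass at least \<delta> per unit of
    probability: the first by conditional expectation, the second because \<open>?F\<close> carries
    at least \<open>hb\<close> times the mass of \<open>f k\<close>, by
    \<open>hit_average_ge_entrance\<close>.\<close>
  define good where "good k = {\<omega> \<in> environments. ennreal \<delta> \<le> M k \<omega>} \<union> {\<omega> \<in> environments. ennreal (\<delta> / hb) < f k \<omega>}" for k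
  have fm [measurable]: "f k \<in> borel_measurable (?\<F> k)" for k
    unfolding f_def by (rule measurable_green_rows) auto
  have Mm [measurable]: "M k \<in> borel_measurable (?\<F> k)" for k
    unfolding M_def by (rule borel_measurable_nn_cond_exp)
  have M1: "{\<omega> \<in> environments. ennreal \<delta> \<le> M k \<omega>} \<in> sets (?\<F> k)" for k
    using borel_measurable_le[OF measurable_const Mm, of "ennreal \<delta>" k] by simp
  have M2: "{\<omega> \<in> environments. ennreal (\<delta> / hb) < f k \<omega>} \<in> sets (?\<F> k)" for k
    using borel_measurable_less[OF measurable_const fm, of "ennreal (\<delta> / hb)" k] by simp
  have good [measurable]: "good k \<in> sets (?\<F> k)" for k
    unfolding good_def by (intro sets.Un M1 M2)
  have \<delta>hb: "\<delta> / hb \<le> 1 - 1 / c"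
    using \<delta>(3) hb by (simp add: hb_def field_simps)
  have good0: "\<omega> \<in> good 0" if "\<omega> \<in> environments" for \<omega>
  proof -
    \<comment> \<open>At level 0 the walk already stands at 0.\<close>
    have "f 0 \<omega> = 1"
      by (simp add: f_def green_outside)
    moreover have "\<delta> / hb < 1"
    proof -
      have "1 - 1 / c < 1"
        using c(1) by simp
      with \<delta>hb show ?thesis
        by (rule le_less_trans)
    qed
    ultimately show ?thesis
      using that \<delta>(1) hb by (auto simp: good_def ennreal_less_one_iff)
  qed
  have mass: "ennreal \<delta> * emeasure P B \<le> (\<integral>\<^sup>+ \<omega>. ?F \<omega> * indicator B \<omega> \<partial>P)"
    if k: "k \<le> N" and B: "B \<in> sets (?\<F> k)" "B \<subseteq> good k" for k B
  proof -
    define B1 where "B1 = B \<inter> {\<omega> \<in> environments. ennreal \<delta> \<le> M k \<omega>}"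
    define B2 where "B2 = B - {\<omega> \<in> environments. ennreal \<delta> \<le> M k \<omega>}"
    have B1: "B1 \<in> sets (?\<F> k)" and B2: "B2 \<in> sets (?\<F> k)"
      using B M1 by (auto simp: B1_def B2_def)
    have P12 [measurable]: "B1 \<in> sets P" "B2 \<in> sets P" "B \<in> sets P"
      using B1 B2 B rows_subset by blast+
    have "ennreal \<delta> * emeasure P B1 = (\<integral>\<^sup>+ \<omega>. ennreal \<delta> * indicator B1 \<omega> \<partial>P)"
      by (simp add: nn_integral_cmult_indicator)
    also have "\<dots> \<le> (\<integral>\<^sup>+ \<omega>. M k \<omega> * indicator B1 \<omega> \<partial>P)"
      by (intro nn_integral_mono) (auto simp: B1_def indicator_def)
    also have "\<dots> = (\<integral>\<^sup>+ \<omega>. ?F \<omega> * indicator B1 \<omega> \<partial>P)"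
      unfolding M_def by (rule nn_integral_cond_exp[OF B1]) simp
    finally have 1: "ennreal \<delta> * emeasure P B1 \<le> (\<integral>\<^sup>+ \<omega>. ?F \<omega> * indicator B1 \<omega> \<partial>P)" .
    have "ennreal \<delta> * emeasure P B2 = ennreal hb * (\<integral>\<^sup>+ \<omega>. ennreal (\<delta> / hb) * indicator B2 \<omega> \<partial>P)"
      using hb \<delta>(1) by (simp add: nn_integral_cmult_indicator flip: mult.assoc ennreal_mult)
    also have "\<dots> \<le> ennreal hb * (\<integral>\<^sup>+ \<omega>. f k \<omega> * indicator B2 \<omega> \<partial>P)"
      using B(2) by (intro mult_left_mono nn_integral_mono) (auto simp: B2_def good_def indicator_def)
    also have "\<dots> \<le> (\<integral>\<^sup>+ \<omega>. ?F \<omega> * indicator B2 \<omega> \<partial>P)"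
      unfolding hb_def f_def using n k L_pos by (intro hit_average_ge_entrance B2) auto
    finally have 2: "ennreal \<delta> * emeasure P B2 \<le> (\<integral>\<^sup>+ \<omega>. ?F \<omega> * indicator B2 \<omega> \<partial>P)" .
    have "B1 \<union> B2 = B" "B1 \<inter> B2 = {}"
      by (auto simp: B1_def B2_def)
    then have "emeasure P B = emeasure P B1 + emeasure P B2"
      by (metis P12(1,2) plus_emeasure)
    then have "ennreal \<delta> * emeasure P B = ennreal \<delta> * emeasure P B1 + ennreal \<delta> * emeasure P B2"
      by (simp add: distrib_left)
    also have "\<dots> \<le> (\<integral>\<^sup>+ \<omega>. ?F \<omega> * indicator B1 \<omega> \<partial>P) + (\<integral>\<^sup>+ \<omega>. ?F \<omega> * indicator B2 \<omega> \<partial>P)"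
      using 1 2 by (rule add_mono)
    also have "\<dots> = (\<integral>\<^sup>+ \<omega>. ?F \<omega> * indicator B1 \<omega> + ?F \<omega> * indicator B2 \<omega> \<partial>P)"
      by (rule nn_integral_add[symmetric]) auto
    also have "\<dots> = (\<integral>\<^sup>+ \<omega>. ?F \<omega> * indicator B \<omega> \<partial>P)"
      by (intro nn_integral_cong) (auto simp: B1_def B2_def indicator_def)
    finally show ?thesis .
  qed
  have step: "?g (Suc k) \<omega> \<le> ennreal c * ?g k \<omega>" if \<omega>: "\<omega> \<in> environments" "\<omega> \<notin> good (Suc k)" for k \<omega>
  proof -
    have "?g (Suc k) \<omega> \<le> ?g k \<omega> + f (Suc k) \<omega> * ?g (Suc k) \<omega>"
    proof (rule green_extend_le)
      show "substochastic (\<lambda>u v. ennreal s * kern \<omega> u v)"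
        using s \<omega> by (intro substochastic_discount substochastic_kern) auto
      fix z assume z: "z \<notin> {- int k..}"
      show "green (\<lambda>u v. ennreal s * kern \<omega> u v) ({- int (Suc k)..} - {0}) z 0 \<le> f (Suc k) \<omega>"
      \<comment> \<open>Of the sites outside \<open>{- k..}\<close> only \<open>- Suc k\<close> lies
        in the enlarged set; from the others the killed walk does not move.\<close>
      proof (cases "z = - int (Suc k)")
        case True
        then show ?thesis
          unfolding f_def using s by (auto intro!: green_mono discount_le)
      next
        case False
        then have "z \<notin> {- int (Suc k)..} - {0}" "z \<noteq> 0"
          using z by auto
        then show ?thesis
          by (simp add: green_outside)
      qed
    qed auto
    also have "\<dots> \<le> ?g k \<omega> + ennreal (1 - 1 / c) * ?g (Suc k) \<omega>"
    proof -
      have "f (Suc k) \<omega> \<le> ennreal (\<delta> / hb)"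
        using \<omega> by (auto simp: good_def not_less)
      also have "\<dots> \<le> ennreal (1 - 1 / c)"
        by (rule ennreal_leI[OF \<delta>hb])
      finally show ?thesis
        by (intro add_left_mono mult_right_mono) auto
    qed
    finally have *: "?g (Suc k) \<omega> \<le> ?g k \<omega> + ennreal (1 - 1 / c) * ?g (Suc k) \<omega>" .
    have "?g j \<omega> \<le> ennreal (1 / (1 - s))" for j
      using s by (intro green_discount_le substochastic_kern \<omega>)
    then obtain d e where "0 \<le> d" "?g (Suc k) \<omega> = ennreal d" "0 \<le> e" "?g k \<omega> = ennreal e"
      by (metis ennreal_cases ennreal_neq_top top_unique)
    \<comment> \<open>Solving for the finite \<open>d\<close> gives exactly the factor
      \<open>c\<close>; this is the origin of the bound \<open>1 - 1 / c\<close> for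
      \<open>f\<close>.\<close>
    moreover from this * have "d \<le> e + (1 - 1 / c) * d"
      using c(1) by (simp flip: ennreal_plus ennreal_mult)
    then have "d \<le> c * e"
      using c(1) by (simp add: field_simps)
    ultimately show ?thesis
      using c(1) by (simp flip: ennreal_mult)
  qed
  have jump: "emeasure P (B \<inter> {\<omega> \<in> space P. 2 * ?g (min (k + m) N) \<omega> < ?g N \<omega>}) \<le> 1 / 8 * emeasure P B"
    if k: "k \<le> N" and B: "B \<in> sets (?\<F> k)" "B \<inter> good k = {}" for k B
  proof (cases "N \<le> k + m")
    case True
    \<comment> \<open>Here the minimum is \<open>N\<close>, so the event is empty.\<close>
    have "\<not> 2 * a < a" for a :: ennreal
      using mult_right_mono[of 1 2 a] by (simp add: not_less)
    then show ?thesis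
      using True by (simp add: min_absorb2)
  next
    case False
    let ?w = "entrance_level (k + m)"
    let ?S = "stuck (ennreal c0) m ?w" and ?H = "reachable (k + m)"
    have BP [measurable]: "B \<in> sets P"
      using B rows_subset by blast
    \<comment> \<open>A jump forces \<open>?H\<close>. The part in \<open>?S\<close> costs 1/16 by
      independence of \<open>B\<close>, the part outside \<open>?S\<close> another 1/16 because
      \<open>?F\<close> is large there.\<close>
    have "emeasure P (B \<inter> {\<omega> \<in> space P. 2 * ?g (min (k + m) N) \<omega> < ?g N \<omega>}) \<le>
        emeasure P (B \<inter> ?S \<union> B \<inter> (?H - ?S))"
    proof (rule emeasure_mono_AE)
      show "AE \<omega> in P. \<omega> \<in> B \<inter> {\<omega> \<in> space P. 2 * ?g (min (k + m) N) \<omega> < ?g N \<omega>} \<longrightarrow> \<omega> \<in> B \<inter> ?S \<union> B \<inter> (?H - ?S)"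
        using AE_jump_reachable[OF s, of "k + m" N] False
        by (auto elim!: eventually_mono simp: min_absorb1)
    qed measurable
    also have "\<dots> \<le> emeasure P (B \<inter> ?S) + emeasure P (B \<inter> (?H - ?S))"
      by (rule emeasure_subadditive) auto
    also have "emeasure P (B \<inter> ?S) \<le> ennreal (1 / 16) * emeasure P B"
    proof -
      have "?w + L + int m = - int k"
        by (simp add: entrance_level_def)
      then have S: "?S \<in> sets (rows {..<- int k})"
        using stuck_rows[of "ennreal c0" m ?w] by simp
      have "emeasure P (B \<inter> ?S) = (\<integral>\<^sup>+ \<omega>. indicator ?S \<omega> * indicator B \<omega> \<partial>P)"
      proof -
        have "indicator ?S \<omega> * indicator B \<omega> = (indicator (B \<inter> ?S) \<omega> :: ennreal)" for \<omega>
          by (auto simp: indicator_def)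
        then show ?thesis
          by simp
      qed
      also have "\<dots> = (\<integral>\<^sup>+ \<omega>. indicator ?S \<omega> \<partial>P) * (\<integral>\<^sup>+ \<omega>. indicator B \<omega> \<partial>P)"
        by (rule nn_integral_rows_mult[where A = "{..<- int k}" and B = "{- int k..}"])
          (auto intro!: borel_measurable_indicator S B)
      also have "\<dots> \<le> ennreal (1 / 16) * emeasure P B"
        using stuck[of ?w] by (simp add: mult_right_mono)
      finally show ?thesis .
    qed
    also have "emeasure P (B \<inter> (?H - ?S)) \<le> ennreal (1 / 16) * emeasure P B"
    proof -
      \<comment> \<open>Markov's inequality given the explored part: \<open>?F\<close> is at least
        \<open>c0 / 4\<close> on this event, while its conditional mean on \<open>B\<close> is below
        \<open>\<delta> \<le> c0 / 64\<close>.\<close>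
      have "ennreal (c0 / 4) * emeasure P (B \<inter> (?H - ?S)) = (\<integral>\<^sup>+ \<omega>. ennreal (c0 / 4) * indicator (B \<inter> (?H - ?S)) \<omega> \<partial>P)"
        by (simp add: nn_integral_cmult_indicator)
      also have "\<dots> \<le> (\<integral>\<^sup>+ \<omega>. ?F \<omega> * indicator B \<omega> \<partial>P)"
      proof (rule nn_integral_mono_AE)
        have "2 * (int (k + m) + L) \<le> int n" "0 < n"
          using n False R_pos L_pos by auto
        from AE_hit_average_ge[OF c0 this]
        show "AE \<omega> in P. ennreal (c0 / 4) * indicator (B \<inter> (?H - ?S)) \<omega> \<le> ?F \<omega> * indicator B \<omega>"
          by eventually_elim (auto simp: indicator_def)
      qed
      also have "\<dots> = (\<integral>\<^sup>+ \<omega>. M k \<omega> * indicator B \<omega> \<partial>P)"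
        unfolding M_def by (rule nn_integral_cond_exp[OF B(1), symmetric]) simp
      also have "\<dots> \<le> (\<integral>\<^sup>+ \<omega>. ennreal \<delta> * indicator B \<omega> \<partial>P)"
        using B(2) by (intro nn_integral_mono) (auto simp: good_def space_P indicator_def not_le intro: less_imp_le)
      also have "\<dots> = ennreal \<delta> * emeasure P B"
        by (simp add: nn_integral_cmult_indicator)
      also have "\<dots> \<le> ennreal (c0 / 64) * emeasure P B"
        using \<delta>(2) by (intro mult_right_mono ennreal_leI) auto
      also have "ennreal (c0 / 64) = ennreal (c0 / 4) * ennreal (1 / 16)"
        using c0 by (subst ennreal_mult[symmetric]) auto
      finally have "ennreal (c0 / 4) * emeasure P (B \<inter> (?H - ?S)) \<le> ennreal (c0 / 4) * (ennreal (1 / 16) * emeasure P B)"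
        by (simp add: mult.assoc)
      then show ?thesis
        using c0 by (subst (asm) ennreal_mult_le_mult_iff) auto
    qed
    also have "ennreal (1 / 16) * emeasure P B + ennreal (1 / 16) * emeasure P B = ennreal (1 / 8) * emeasure P B"
      by (simp flip: distrib_right ennreal_plus)
    also have "ennreal (1 / 8) = 1 / 8"
      using divide_ennreal[of 1 8] by simp
    finally show ?thesis
      by (simp add: add_mono)
  qed
  interpret good_levels P ?\<F> good ?g ?F "ennreal \<delta>" "1 / 8" "ennreal c" m N
  proof
    show "ennreal c ^ Suc m \<le> 2"
      using c ennreal_leI[OF c(2)] by (simp add: ennreal_power del: power_Suc)
  next
    fix i j :: nat and \<omega> assume "i \<le> j"
    then show "?g i \<omega> \<le> ?g j \<omega>"
      by (intro green_mono) auto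
  next
    show "good 0 = space P"
      using good0 by (auto simp: space_P good_def)
  next
    fix k \<omega> assume "\<omega> \<in> space P" "\<omega> \<notin> good (Suc k)"
    then show "?g (Suc k) \<omega> \<le> ennreal c * ?g k \<omega>"
      unfolding space_P by (rule step)
  next
    fix k B assume "k \<le> N" "B \<in> sets (?\<F> k)" "B \<inter> good k = {}"
    then show "emeasure P (B \<inter> {\<omega> \<in> space P. 2 * ?g (min (k + m) N) \<omega> < ?g N \<omega>}) \<le> 1 / 8 * emeasure P B"
      by (rule jump)
  qed (use c in \<open>auto simp: space_P rows_subset mass good intro!: rows_mono measurable_green_rows\<close>)
  show ?thesis
  proof (rule mean_bound)
    have "(\<integral>\<^sup>+ \<omega>. ?g N \<omega> \<partial>P) \<le> (\<integral>\<^sup>+ \<omega>. ennreal (1 / (1 - s)) \<partial>P)"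
      using s by (intro nn_integral_mono green_discount_le substochastic_kern) (auto simp: space_P)
    also have "\<dots> < \<infinity>"
      by (simp add: emeasure_space_1)
    finally show "(\<integral>\<^sup>+ \<omega>. ?g N \<omega> \<partial>P) < \<infinity>" .
  qed auto
qed

text \<open>For fixed \<open>N\<close> and \<open>s\<close> one large \<open>n\<close> gives a bound
  that mentions none of the three; then \<open>N\<close> tends to infinity and \<open>s\<close> to
  1, both by monotone convergence.\<close>

lemma mean_green_finite:
  assumes vel: "limiting_velocity P v" and v: "0 < v"
  shows "(\<integral>\<^sup>+ \<omega>. green (kern \<omega>) UNIV 0 0 \<partial>P) < \<infinity>"
proof -
  obtain m and c0 :: real where c0: "0 < c0" and stuck: "\<And>w. emeasure P (stuck (ennreal c0) m w) \<le> ennreal (1 / 16)"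
  proof (rule ex_stuck_small[of "1 / 16"])
    fix c m assume "0 < c" "\<And>w. emeasure P (stuck (ennreal c) m w) \<le> ennreal (1 / 16)"
    then show thesis
      by (rule that)
  qed simp
  \<comment> \<open>The largest factor for which \<open>Suc m\<close> bad steps at most double
    \<open>g\<close>.\<close>
  define c where "c = root (Suc m) 2"
  have c: "1 < c" "c ^ Suc m \<le> 2"
    unfolding c_def by (auto simp del: power_Suc)
  define \<delta> where "\<delta> = min (c0 / 64) (1 / (4 * real_of_int R) * (1 - 1 / c))"
  have \<delta>: "0 < \<delta>" "\<delta> \<le> c0 / 64" "\<delta> \<le> 1 / (4 * real_of_int R) * (1 - 1 / c)"
    using c0 c R_pos by (auto simp: \<delta>_def)
  let ?K = "of_nat (8 * Suc m) * ennreal (2 / v + 2)"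
  let ?\<kappa> = "\<lambda>s \<omega> u v. ennreal s * kern \<omega> u v"
  have bound: "ennreal \<delta> * (\<integral>\<^sup>+ \<omega>. green (?\<kappa> s \<omega>) {- int N..} 0 0 \<partial>P) \<le> ?K" if s: "0 \<le> s" "s < 1" for s N
  proof -
    have "eventually (\<lambda>n. 2 * (int N + int m + L + R) \<le> int n) sequentially"
      by (rule eventually_sequentiallyI[of "nat (2 * (int N + int m + L + R))"]) linarith
    with eventually_hit_average_green[OF vel v s]
    have "eventually (\<lambda>n. ennreal \<delta> * (\<integral>\<^sup>+ \<omega>. green (?\<kappa> s \<omega>) {- int N..} 0 0 \<partial>P) \<le> ?K) sequentially"
    proof eventually_elim
      case (elim n)
      have "ennreal \<delta> * (\<integral>\<^sup>+ \<omega>. green (?\<kappa> s \<omega>) {- int N..} 0 0 \<partial>P) \<le>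
          of_nat (8 * Suc m) * (\<integral>\<^sup>+ \<omega>. hit_average n \<omega> * green (?\<kappa> s \<omega>) {- int N..} 0 0 \<partial>P)"
        by (rule discounted_mean_bound[OF s c0 stuck \<delta> c elim(2)])
      also have "\<dots> \<le> of_nat (8 * Suc m) * (\<integral>\<^sup>+ \<omega>. hit_average n \<omega> * green (?\<kappa> s \<omega>) UNIV 0 0 \<partial>P)"
        by (intro mult_left_mono nn_integral_mono green_mono) auto
      also have "\<dots> \<le> ?K"
        by (rule mult_left_mono[OF elim(1)]) simp
      finally show ?case .
    qed
    then show ?thesis
      by (simp add: eventually_sequentially) blast
  qed
  have "ennreal \<delta> * (\<integral>\<^sup>+ \<omega>. green (?\<kappa> s \<omega>) UNIV 0 0 \<partial>P) \<le> ?K" if s: "0 \<le> s" "s < 1" for s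
  proof -
    have inc: "incseq (\<lambda>N. {- int N..})"
      by (auto simp: mono_def)
    have "x \<in> {- int (nat \<bar>x\<bar>)..}" for x
      by auto
    then have "(\<Union>N. {- int N..}) = UNIV"
      by blast
    then have "green (?\<kappa> s \<omega>) UNIV 0 0 = (SUP N. green (?\<kappa> s \<omega>) {- int N..} 0 0)" for \<omega>
      using green_SUP_sets[OF inc, of "?\<kappa> s \<omega>" 0 0] by simp
    then have "(\<integral>\<^sup>+ \<omega>. green (?\<kappa> s \<omega>) UNIV 0 0 \<partial>P) = (SUP N. \<integral>\<^sup>+ \<omega>. green (?\<kappa> s \<omega>) {- int N..} 0 0 \<partial>P)"
      by (simp only:) (rule nn_integral_monotone_convergence_SUP, auto simp: mono_def le_fun_def intro!: green_mono)
    then show ?thesis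
      using bound[OF s] by (simp only: SUP_mult_left_ennreal) (rule SUP_least)
  qed
  then have "ennreal \<delta> * (\<integral>\<^sup>+ \<omega>. green (?\<kappa> (real i / real (Suc i)) \<omega>) UNIV 0 0 \<partial>P) \<le> ?K" for i
    by (auto simp del: of_nat_Suc)
  moreover have "(\<integral>\<^sup>+ \<omega>. green (kern \<omega>) UNIV 0 0 \<partial>P) =
      (SUP i. \<integral>\<^sup>+ \<omega>. green (?\<kappa> (real i / real (Suc i)) \<omega>) UNIV 0 0 \<partial>P)"
  proof -
    have "incseq (\<lambda>i \<omega>. green (?\<kappa> (real i / real (Suc i)) \<omega>) UNIV 0 0)"
      using incseq_discount[of 1] by (auto simp: mono_def le_fun_def intro!: green_mono mult_right_mono)
    then show ?thesis
      unfolding green_SUP_discount[of "kern _" UNIV 0 0]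
      by (intro nn_integral_monotone_convergence_SUP) auto
  qed
  ultimately have "ennreal \<delta> * (\<integral>\<^sup>+ \<omega>. green (kern \<omega>) UNIV 0 0 \<partial>P) \<le> ?K"
    by (simp only: SUP_mult_left_ennreal) (rule SUP_least)
  also have "?K < \<infinity>"
    by (simp add: ennreal_mult_less_top of_nat_less_top)
  finally show ?thesis
    using \<delta>(1) by (auto simp: ennreal_mult_less_top)
qed

end

theorem lemma1p3:
  fixes P :: "env measure" and L R :: int and v :: real
  assumes "prob_space P" and "sets P = sets env_space"
    and "0 < L" and "0 < R"
    and indep: "prob_space.indep_vars P (\<lambda>_. borel) (\<lambda>x \<omega>. jump_law \<omega> x) UNIV"
    and ident: "\<And>x y. distr P borel (\<lambda>\<omega>. jump_law \<omega> x) = distr P borel (\<lambda>\<omega>. jump_law \<omega> y)"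
    and irred: "AE \<omega> in P. irreducible_chain \<omega>"
    and bounded: "AE \<omega> in P. \<forall>a b. b \<notin> {a - L..a + R} \<longrightarrow> \<omega> a b = 0"
    and transient: "AE \<omega> in P. AE X in path_law \<omega> 0. filterlim X at_top sequentially"
    and velocity: "limiting_velocity P v"
  shows "(\<integral>\<^sup>+ X. visits0 X \<partial>annealed_law P 0) = (\<integral>\<^sup>+ \<omega>. \<integral>\<^sup>+ X. visits0 X \<partial>path_law \<omega> 0 \<partial>P) \<and>
    (v > 0 \<longleftrightarrow> (\<integral>\<^sup>+ X. visits0 X \<partial>annealed_law P 0) < \<infinity>)"
proof -
  interpret prob_space P by fact
  interpret rwre P L R
    by unfold_locales fact+
  have eq: "(\<integral>\<^sup>+ X. visits0 X \<partial>annealed_law P 0) = (\<integral>\<^sup>+ \<omega>. \<integral>\<^sup>+ X. visits0 X \<partial>path_law \<omega> 0 \<partial>P)"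
    by (rule nn_integral_annealed_law[OF visits0_measurable])
  also have "\<dots> = (\<integral>\<^sup>+ \<omega>. green (kern \<omega>) UNIV 0 0 \<partial>P)"
    by (intro nn_integral_cong nn_integral_visits0) (simp add: space_P)
  finally have green: "(\<integral>\<^sup>+ X. visits0 X \<partial>annealed_law P 0) = (\<integral>\<^sup>+ \<omega>. green (kern \<omega>) UNIV 0 0 \<partial>P)" .
  show ?thesis
    using eq mean_green_finite[OF velocity] velocity_pos[OF velocity] unfolding green by blast
qed

end
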